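(* Let $f:S^1\to S^2$ be a CaTherine wheel. Let $S^2_f=S^1\cup P^+\cup P^-$ and let $\mathcal{C}$ be the collection of subsets of $S^2_f$ consisting of: $\{p\}$ for each $p\in S^1$ lying in no nontrivial class of $\mathcal{L}^+(f)\cup\mathcal{L}^-(f)$; $\nu\cup H^+(\nu)$ for each nontrivial class $\nu$ of $\mathcal{L}^+(f)$; and $\nu\cup H^-(\nu)$ for each nontrivial class $\nu$ of $\mathcal{L}^-(f)$. Then $\mathcal{C}$ is an upper semi-continuous decomposition of $S^2_f$. Furthermore the quotient space of $S^2_f$ by $\mathcal{C}$ is homeomorphic to $S^2$, and there is a unique choice of this homeomorphism such that the restriction to $S^1$ of the quotient map $F:S^2_f\to S^2$ equals $f$.
   Context: $S^1,S^2$ are the oriented circle and 2-sphere. A closed interval $I\subset S^1$ is a closed subset homeomorphic to $[0,1]$ oriented from $S^1$ with endpoints $I^-,I^+$; $[p,q]$ is the oriented interval from $p$ to $q$. A CaTherine wheel is a continuous surjection $f:S^1\to S^2$ such that for each closed interval $I$, $f(I)$ is a closed disk and $f(\partial I)\subset\partial f(I)$. For such $f$ and $I$, each component $Y$ of $\partial f(I)\setminus f(\partial I)$ has a unique orientation (canonical orientation) making $f:I\cap f^{-1}(Y)\to Y$ monotone increasing; $Z^+(I)$ is the component (or $\emptyset$) whose canonical orientation agrees with its boundary orientation from the disk $f(I)\subset S^2$, $Z^-(I)$ the one (or $\emptyset$) where they disagree. $I$ is degenerate if $f(\partial I)$ is a point; then it is positively degenerate if $Z^+(I)=\emptyset$,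 negatively degenerate otherwise. $\mathcal{L}^\pm(f)$ is the set of unordered pairs $\{p,q\}$ with $[p,q]$ positively/negatively degenerate; each (with the diagonal) is an equivalence relation on $S^1$ whose classes are the nontrivial classes referred to. $P^+$ and $P^-$ are two copies of the hyperbolic plane (Poincaré disk), each with ideal boundary identified with $S^1$, so $S^2_f=S^1\cup P^+\cup P^-$ is topologized as a 2-sphere with $S^1$ as equator. $H^\pm(\nu)$ is the hyperbolic convex hull of $\nu$ in $P^\pm$. An upper semi-continuous decomposition of a compact Hausdorff space $X$ is a collection of pairwise disjoint closed subsets covering $X$ such that for each element $K$ and each open $V\supset K$ there is an open $U$ with $K\subset U\subset V$ that is a union of elements. *)

theory Defs
  imports "HOL-Complex_Analysis.Complex_Analysis" "HOL-Analysis.Cross3"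
begin

definition S1 :: "complex set" where
  "S1 = sphere 0 1"

definition S2 :: "(real^3) set" where
  "S2 = sphere 0 1"

text \<open>Closed intervals of S^1: every closed interval I is [p,q] with p = I^-, q = I^+, p \<noteq> q;
  [p,q] is the counterclockwise arc from p to q.\<close>

definition arc :: "complex \<Rightarrow> complex \<Rightarrow> complex set" where
  "arc p q = {s \<in> S1. Arg2pi (s / p) \<le> Arg2pi (q / p)}"

definition arc_le :: "complex \<Rightarrow> complex \<Rightarrow> complex \<Rightarrow> bool" where
  "arc_le p s t \<longleftrightarrow> Arg2pi (s / p) \<le> Arg2pi (t / p)"

definition sbd :: "(real^3) set \<Rightarrow> (real^3) set" where
  "sbd D = D \<inter> closure (S2 - D)"

definition catherine_wheel :: "(complex \<Rightarrow> real^3) \<Rightarrow> bool" where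
  "catherine_wheel f \<longleftrightarrow>
     continuous_on S1 f \<and> f ` S1 = S2 \<and>
     (\<forall>p\<in>S1. \<forall>q\<in>S1. p \<noteq> q \<longrightarrow>
        (f ` arc p q) homeomorphic (cball (0::complex) 1) \<and>
        {f p, f q} \<subseteq> sbd (f ` arc p q))"

text \<open>S^2 carries the standard orientation (outward normal). Stereographic projection from N
  onto the plane N-perp, in coordinates w.r.t. an orthonormal basis (u,v) with v \<times> u = N,
  is an orientation preserving chart S^2 - {N} \<rightarrow> C.\<close>

definition stereo :: "real^3 \<Rightarrow> real^3 \<Rightarrow> real^3 \<Rightarrow> real^3 \<Rightarrow> complex" where
  "stereo N u v x = Complex ((x \<bullet> u) / (1 - x \<bullet> N)) ((x \<bullet> v) / (1 - x \<bullet> N))"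

definition pos_chart :: "real^3 \<Rightarrow> real^3 \<Rightarrow> real^3 \<Rightarrow> bool" where
  "pos_chart N u v \<longleftrightarrow> N \<in> S2 \<and> norm u = 1 \<and> norm v = 1 \<and> u \<bullet> v = 0 \<and>
     u \<bullet> N = 0 \<and> v \<bullet> N = 0 \<and> cross3 v u = N"

definition circ :: "real \<Rightarrow> complex" where
  "circ t = cis (2 * pi * t)"

definition pos_param :: "(real^3) set \<Rightarrow> (complex \<Rightarrow> real^3) \<Rightarrow> (real^3 \<Rightarrow> complex) \<Rightarrow> bool" where
  "pos_param D h g \<longleftrightarrow> homeomorphism (cball 0 1) D h g \<and>
     (\<exists>N u v. pos_chart N u v \<and> N \<notin> D \<and>
        winding_number (stereo N u v \<circ> h \<circ> circ) (stereo N u v (h 0)) = 1)"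

text \<open>Linear order on the arc \<partial>D - {e} induced by the boundary orientation of \<partial>D
  (as the boundary of D \<subseteq> S^2), cut open at the point e.\<close>
definition bd_le :: "(real^3 \<Rightarrow> complex) \<Rightarrow> real^3 \<Rightarrow> real^3 \<Rightarrow> real^3 \<Rightarrow> bool" where
  "bd_le g e y1 y2 \<longleftrightarrow> Arg2pi (g y1 / g e) \<le> Arg2pi (g y2 / g e)"

text \<open>Component Y of \<partial>f([p,q]) - f({p,q}) whose canonical orientation (the one making
  f : [p,q] \<inter> f^-1(Y) \<rightarrow> Y monotone increasing) agrees with its boundary orientation.\<close>
definition agrees :: "(complex \<Rightarrow> real^3) \<Rightarrow> complex \<Rightarrow> complex \<Rightarrow> (real^3) set \<Rightarrow> bool" where
  "agrees f p q Y \<longleftrightarrow>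
     (\<exists>h g e. pos_param (f ` arc p q) h g \<and> e \<in> sbd (f ` arc p q) - Y \<and>
        (\<forall>s\<in>arc p q \<inter> f -` Y. \<forall>t\<in>arc p q \<inter> f -` Y.
            arc_le p s t \<longrightarrow> bd_le g e (f s) (f t)))"

definition Zplus_nonempty :: "(complex \<Rightarrow> real^3) \<Rightarrow> complex \<Rightarrow> complex \<Rightarrow> bool" where
  "Zplus_nonempty f p q \<longleftrightarrow>
     (\<exists>Y \<in> components (sbd (f ` arc p q) - f ` {p, q}). agrees f p q Y)"

definition degenerate :: "(complex \<Rightarrow> real^3) \<Rightarrow> complex \<Rightarrow> complex \<Rightarrow> bool" where
  "degenerate f p q \<longleftrightarrow> p \<in> S1 \<and> q \<in> S1 \<and> p \<noteq> q \<and> f p = f q"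

definition pos_degenerate :: "(complex \<Rightarrow> real^3) \<Rightarrow> complex \<Rightarrow> complex \<Rightarrow> bool" where
  "pos_degenerate f p q \<longleftrightarrow> degenerate f p q \<and> \<not> Zplus_nonempty f p q"

definition neg_degenerate :: "(complex \<Rightarrow> real^3) \<Rightarrow> complex \<Rightarrow> complex \<Rightarrow> bool" where
  "neg_degenerate f p q \<longleftrightarrow> degenerate f p q \<and> Zplus_nonempty f p q"

definition Lplus_rel :: "(complex \<Rightarrow> real^3) \<Rightarrow> (complex \<times> complex) set" where
  "Lplus_rel f = {(p, q). p \<in> S1 \<and> q \<in> S1 \<and> (p = q \<or> pos_degenerate f p q \<or> pos_degenerate f q p)}"

definition Lminus_rel :: "(complex \<Rightarrow> real^3) \<Rightarrow> (complex \<times> complex) set" where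
  "Lminus_rel f = {(p, q). p \<in> S1 \<and> q \<in> S1 \<and> (p = q \<or> neg_degenerate f p q \<or> neg_degenerate f q p)}"

definition nontrivial_classes :: "(complex \<times> complex) set \<Rightarrow> complex set set" where
  "nontrivial_classes R = {\<nu> \<in> S1 // R. \<not> (\<exists>p. \<nu> = {p})}"

definition PD :: "complex set" where
  "PD = ball 0 1"

definition hdist :: "complex \<Rightarrow> complex \<Rightarrow> real" where
  "hdist x y = arcosh (1 + 2 * (cmod (x - y))\<^sup>2 / ((1 - (cmod x)\<^sup>2) * (1 - (cmod y)\<^sup>2)))"

definition hconvex :: "complex set \<Rightarrow> bool" where
  "hconvex C \<longleftrightarrow> C \<subseteq> PD \<and>
     (\<forall>x\<in>C. \<forall>y\<in>C. \<forall>z\<in>PD. hdist x z + hdist z y = hdist x y \<longrightarrow> z \<in> C)"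

definition hhull :: "complex set \<Rightarrow> complex set" where
  "hhull \<nu> = \<Inter> {C. hconvex C \<and> closedin (top_of_set PD) C \<and> \<nu> \<subseteq> closure C}"

text \<open>Modelled as the unit sphere in R^3: S^1 is the equator, P^+ (resp. P^-) is the open upper
  (lower) hemisphere, identified with the Poincare disk by vertical projection; this extends to
  the identity on the ideal boundary S^1.\<close>

definition S2f :: "(real^3) set" where
  "S2f = sphere 0 1"

definition eqemb :: "complex \<Rightarrow> real^3" where
  "eqemb z = vector [Re z, Im z, 0]"

definition hemi :: "bool \<Rightarrow> complex \<Rightarrow> real^3" where
  "hemi b z = vector [Re z, Im z, (if b then 1 else -1) * sqrt (1 - (cmod z)\<^sup>2)]"

definition decomp :: "(complex \<Rightarrow> real^3) \<Rightarrow> (real^3) set set" where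
  "decomp f =
     {{eqemb p} | p. p \<in> S1 \<and>
        (\<forall>\<nu> \<in> nontrivial_classes (Lplus_rel f) \<union> nontrivial_classes (Lminus_rel f). p \<notin> \<nu>)}
     \<union> {eqemb ` \<nu> \<union> hemi True ` hhull \<nu> | \<nu>. \<nu> \<in> nontrivial_classes (Lplus_rel f)}
     \<union> {eqemb ` \<nu> \<union> hemi False ` hhull \<nu> | \<nu>. \<nu> \<in> nontrivial_classes (Lminus_rel f)}"

definition usc_decomposition :: "'a topology \<Rightarrow> 'a set set \<Rightarrow> bool" where
  "usc_decomposition X \<C> \<longleftrightarrow>
     (\<forall>K\<in>\<C>. closedin X K) \<and> pairwise disjnt \<C> \<and> \<Union>\<C> = topspace X \<and>
     (\<forall>K\<in>\<C>. \<forall>V. openin X V \<and> K \<subseteq> V \<longrightarrow>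
        (\<exists>U. openin X U \<and> K \<subseteq> U \<and> U \<subseteq> V \<and> (\<exists>\<U>. \<U> \<subseteq> \<C> \<and> U = \<Union>\<U>)))"

text \<open>F : X \<rightarrow> Y realises Y as the quotient of X by the decomposition \<C>: F is a quotient
  map whose fibres are exactly the elements of \<C>. (Equivalently, F = \<Phi> \<circ> \<pi> with \<pi> the
  quotient projection X \<rightarrow> X/\<C> and \<Phi> : X/\<C> \<rightarrow> Y a homeomorphism.)\<close>
definition quotient_by :: "'a topology \<Rightarrow> 'a set set \<Rightarrow> 'b topology \<Rightarrow> ('a \<Rightarrow> 'b) \<Rightarrow> bool" where
  "quotient_by X \<C> Y F \<longleftrightarrow> quotient_map X Y F \<and>
     (\<forall>x\<in>topspace X. \<forall>y\<in>topspace X. F x = F y \<longleftrightarrow> (\<exists>K\<in>\<C>. x \<in> K \<and> y \<in> K))"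

end

theory Submission
  imports Defs
begin

text \<open>Complementary intervals of the circle are mapped to complementary disks with a common boundary,
and three consecutive intervals to three disks tiling the sphere. A theta graph argument with winding
numbers shows that two adjacent disks orient three common boundary points oppositely, so such a
tiling has at most two triple points; it also shows that two linked pairs in different fibres of
\<open>f\<close> have opposite signs. Consequently the sign is constant on each fibre, the classes of one sign are
pairwise unlinked, and every pair of points outside the relation of a given sign is crossed by a
pair inside it. In the Klein model this maximality makes the convex hulls of the classes of one sign
a partition of the closed disk. Sending a hull to the value of \<open>f\<close> on its class is therefore
well defined on both hemispheres; it is continuous because the relations are closed, and its fibres
are the elements of the decomposition.\<close>

subsection \<open>Cyclic order on the circle\<close>

text \<open>Orientation is given only by a winding number in a chart, while all comparisons concern
  boundary points, about which the boundary curve itself has no winding number. The substitute is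
  the angle sum of a curvilinear triangle: three boundary points in positive order are joined by
  paths inside the disk, each path avoiding the opposite vertex, and the winding numbers of the
  paths about the opposite vertices add up to 1/2. The sum depends on the paths alone, so the same
  paths can be read in two disks; this yields agreement for nested disks and reversal for adjacent
  ones. What is proved about signs afterwards is a parity count of such reversals. A canonical
  orientation is a condition on all pairs of parameters of an interval. It can be tested on a single
  pair, because a tiling with exactly two triple points sorts the remaining boundary points into two
  arcs, one for each of two tiles.\<close>

definition ccw :: "complex \<Rightarrow> complex \<Rightarrow> complex \<Rightarrow> bool" where
  "ccw a b c \<longleftrightarrow> 0 < Im (cnj (b - a) * (c - a))"

lemma S1_iff: "z \<in> S1 \<longleftrightarrow> cmod z = 1"
  by (simp add: S1_def)

lemma S1_nz: "z \<in> S1 \<Longrightarrow> z \<noteq> 0"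
  by (auto simp: S1_iff)

lemma S1_cis: "z \<in> S1 \<Longrightarrow> z = cis (Arg2pi z)"
  using complex_norm_eq_1_exp by (simp add: S1_iff cis_conv_exp)

lemma Arg2pi_S1_inj: "a \<in> S1 \<Longrightarrow> b \<in> S1 \<Longrightarrow> Arg2pi a = Arg2pi b \<longleftrightarrow> a = b"
  by (metis S1_cis)

text \<open>The product form makes the sign readable: half the difference of two arguments from
  \<open>[0, 2 * pi)\<close> lies strictly between \<open>- pi\<close> and \<open>pi\<close>, where
  \<open>sin\<close> has the sign of its argument.\<close>

lemma Im_cis_triple:
  "Im (cnj (cis \<beta> - cis \<alpha>) * (cis \<gamma> - cis \<alpha>))
     = 4 * sin ((\<beta> - \<alpha>) / 2) * sin ((\<gamma> - \<beta>) / 2) * sin ((\<gamma> - \<alpha>) / 2)"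
proof -
  define u v where "u = (\<beta> - \<alpha>) / 2" and "v = (\<gamma> - \<beta>) / 2"
  have 1: "\<beta> - \<alpha> = 2 * u" "\<gamma> - \<beta> = 2 * v" "\<gamma> - \<alpha> = 2 * (u + v)"
    by (auto simp: u_def v_def field_simps)
  have "Im (cnj (cis \<beta> - cis \<alpha>) * (cis \<gamma> - cis \<alpha>)) = sin (\<gamma> - \<beta>) + sin (\<beta> - \<alpha>) - sin (\<gamma> - \<alpha>)"
    by (simp add: sin_diff algebra_simps)
  also have "\<dots> = sin (2 * v) + sin (2 * u) - sin (2 * u + 2 * v)"
    using 1 by (simp add: algebra_simps)
  also have "\<dots> = 2 * sin v * cos v + 2 * sin u * cos u
      - (2 * sin u * cos u * ((cos v)\<^sup>2 - (sin v)\<^sup>2) + ((cos u)\<^sup>2 - (sin u)\<^sup>2) * (2 * sin v * cos v))"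
    by (simp only: sin_add sin_double cos_double)
  also have "\<dots> = 4 * sin u * sin v * sin (u + v)"
  proof -
    have "(sin v)\<^sup>2 + (cos v)\<^sup>2 = 1" "(sin u)\<^sup>2 + (cos u)\<^sup>2 = 1"
      by simp_all
    then show ?thesis unfolding sin_add by algebra
  qed
  also have "u + v = (\<gamma> - \<alpha>) / 2" by (simp add: u_def v_def field_simps)
  finally show ?thesis by (simp only: u_def v_def)
qed

lemma sgn_sin_half_diff:
  assumes "0 \<le> \<alpha>" "\<alpha> < 2 * pi" "0 \<le> \<beta>" "\<beta> < 2 * pi"
  shows "sgn (sin ((\<beta> - \<alpha>) / 2)) = sgn (\<beta> - \<alpha>)"
proof (cases "\<beta> = \<alpha>")
  case False
  then consider "\<alpha> < \<beta>" | "\<beta> < \<alpha>" by linarith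
  then show ?thesis
  proof cases
    case 1
    then have "0 < sin ((\<beta> - \<alpha>) / 2)" using assms by (intro sin_gt_zero) auto
    with 1 show ?thesis by simp
  next
    case 2
    then have "0 < sin ((\<alpha> - \<beta>) / 2)" using assms by (intro sin_gt_zero) auto
    moreover have "sin ((\<beta> - \<alpha>) / 2) = - sin ((\<alpha> - \<beta>) / 2)"
      by (metis minus_diff_eq minus_divide_left sin_minus)
    ultimately show ?thesis using 2 by simp
  qed
qed simp

text \<open>The signed area is convenient for rotation and openness; this form in terms of a linear
  order turns statements about several circle points into case distinctions with
  inequalities.\<close>

lemma ccw_iff_Arg2pi:
  assumes "a \<in> S1" "b \<in> S1" "c \<in> S1"
  shows "ccw a b c \<longleftrightarrow>
    (Arg2pi a < Arg2pi b \<and> Arg2pi b < Arg2pi c) \<or>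
    (Arg2pi b < Arg2pi c \<and> Arg2pi c < Arg2pi a) \<or>
    (Arg2pi c < Arg2pi a \<and> Arg2pi a < Arg2pi b)"
proof -
  define \<alpha> \<beta> \<gamma> where d: "\<alpha> = Arg2pi a" "\<beta> = Arg2pi b" "\<gamma> = Arg2pi c"
  have eq: "a = cis \<alpha>" "b = cis \<beta>" "c = cis \<gamma>"
    using assms S1_cis by (auto simp: d)
  have r: "0 \<le> \<alpha>" "\<alpha> < 2 * pi" "0 \<le> \<beta>" "\<beta> < 2 * pi" "0 \<le> \<gamma>" "\<gamma> < 2 * pi"
    using Arg2pi by (auto simp: d)
  have "ccw a b c \<longleftrightarrow> sgn (4 * sin ((\<beta> - \<alpha>) / 2) * sin ((\<gamma> - \<beta>) / 2) * sin ((\<gamma> - \<alpha>) / 2)) = 1"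
    unfolding ccw_def eq Im_cis_triple by (simp add: sgn_1_pos)
  also have "\<dots> \<longleftrightarrow> sgn (\<beta> - \<alpha>) * sgn (\<gamma> - \<beta>) * sgn (\<gamma> - \<alpha>) = 1"
    using r by (simp add: sgn_mult sgn_sin_half_diff)
  also have "\<dots> \<longleftrightarrow> (\<alpha> < \<beta> \<and> \<beta> < \<gamma>) \<or> (\<beta> < \<gamma> \<and> \<gamma> < \<alpha>) \<or> (\<gamma> < \<alpha> \<and> \<alpha> < \<beta>)"
    by (auto simp: sgn_if split: if_splits)
  finally show ?thesis by (simp add: d)
qed

lemma ccw_rotate: "ccw a b c \<Longrightarrow> ccw b c a"
  by (simp add: ccw_def algebra_simps)

lemma ccw_distinct: "ccw a b c \<Longrightarrow> a \<noteq> b \<and> b \<noteq> c \<and> a \<noteq> c"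
  by (auto simp: ccw_def algebra_simps)

lemma ccw_asym: "ccw a b c \<Longrightarrow> \<not> ccw a c b"
  by (simp add: ccw_def algebra_simps)

lemma ccw_total:
  assumes "a \<in> S1" "b \<in> S1" "c \<in> S1" "a \<noteq> b" "b \<noteq> c" "a \<noteq> c"
  shows "ccw a b c \<or> ccw a c b"
  using assms Arg2pi_S1_inj[of a b] Arg2pi_S1_inj[of c b] Arg2pi_S1_inj[of a c]
  by (simp add: ccw_iff_Arg2pi) linarith

lemma Arg2pi_divide_S1:
  assumes "s \<in> S1" "p \<in> S1"
  shows "Arg2pi (s / p) = (if Arg2pi p \<le> Arg2pi s then Arg2pi s - Arg2pi p
                           else Arg2pi s - Arg2pi p + 2 * pi)"
proof (rule Arg2pi_unique[where r = 1])
  have "s / p = cis (Arg2pi s - Arg2pi p)"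
    using assms by (metis S1_cis cis_divide)
  moreover have "cis (Arg2pi s - Arg2pi p + 2 * pi) = cis (Arg2pi s - Arg2pi p)"
    by (simp flip: cis_mult)
  ultimately show "complex_of_real 1 * exp (\<i> * complex_of_real (if Arg2pi p \<le> Arg2pi s then Arg2pi s - Arg2pi p
                           else Arg2pi s - Arg2pi p + 2 * pi)) = s / p"
    by (simp add: cis_conv_exp)
qed (use Arg2pi[of s] Arg2pi[of p] in auto)

text \<open>Besides \<open>arc\<close>, this also evaluates \<open>bd_le\<close>, which is the same
  comparison applied to the boundary parameters \<open>g y\<close>.\<close>

lemma arc_le_iff:
  assumes "p \<in> S1" "s \<in> S1" "t \<in> S1"
  shows "arc_le p s t \<longleftrightarrow> s = p \<or> s = t \<or> ccw p s t"
proof -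
  have "Arg2pi s = Arg2pi p \<longleftrightarrow> s = p" "Arg2pi s = Arg2pi t \<longleftrightarrow> s = t"
    using assms Arg2pi_S1_inj by auto
  then show ?thesis
    using Arg2pi[of s] Arg2pi[of p] Arg2pi[of t]
    unfolding arc_le_def Arg2pi_divide_S1[OF assms(2,1)] Arg2pi_divide_S1[OF assms(3,1)]
      ccw_iff_Arg2pi[OF assms] by (auto split: if_splits)
qed

lemma mem_arc_iff:
  assumes "p \<in> S1" "q \<in> S1"
  shows "s \<in> arc p q \<longleftrightarrow> s \<in> S1 \<and> (s = p \<or> s = q \<or> ccw p s q)"
  using arc_le_iff[OF assms(1) _ assms(2)] unfolding arc_def arc_le_def by blast

lemma ccw_trans:
  assumes "a \<in> S1" "b \<in> S1" "c \<in> S1" "d \<in> S1" "ccw a b c" "ccw a c d"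
  shows "ccw a b d" "ccw b c d"
  using assms by (auto simp: ccw_iff_Arg2pi)

lemma arc_split:
  assumes "p \<in> S1" "s \<in> S1" "q \<in> S1" "ccw p s q"
  shows "arc p q = arc p s \<union> arc s q"
proof -
  have "Arg2pi x = Arg2pi p \<longleftrightarrow> x = p" "Arg2pi x = Arg2pi q \<longleftrightarrow> x = q" "Arg2pi x = Arg2pi s \<longleftrightarrow> x = s"
    if "x \<in> S1" for x
    using assms Arg2pi_S1_inj that by auto
  then show ?thesis
    using assms
    by (auto simp: mem_arc_iff ccw_iff_Arg2pi set_eq_iff)
qed

lemma arc_Un_arc:
  assumes "p \<in> S1" "q \<in> S1" "p \<noteq> q"
  shows "arc p q \<union> arc q p = S1"
  using assms ccw_total[of p _ q] by (auto simp: mem_arc_iff) (metis ccw_rotate)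

lemma arc_sub_S1: "arc p q \<subseteq> S1"
  by (auto simp: arc_def)

lemma arc_ends: "p \<in> S1 \<Longrightarrow> q \<in> S1 \<Longrightarrow> p \<in> arc p q \<and> q \<in> arc p q"
  by (simp add: mem_arc_iff)

lemma ccw_arc_eq:
  assumes "p \<in> S1" "q \<in> S1" "p \<noteq> q"
  shows "{s \<in> S1. ccw p s q} = (\<lambda>t. p * cis t) ` {0<..<Arg2pi (q / p)}"
proof -
  have *: "ccw p s q \<longleftrightarrow> 0 < Arg2pi (s / p) \<and> Arg2pi (s / p) < Arg2pi (q / p)" if "s \<in> S1" for s
    using Arg2pi[of s] Arg2pi[of p] Arg2pi[of q] Arg2pi_S1_inj[OF that assms(1)] Arg2pi_S1_inj[OF assms(2,1)] assms(3)
    unfolding Arg2pi_divide_S1[OF that assms(1)] Arg2pi_divide_S1[OF assms(2,1)]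
      ccw_iff_Arg2pi[OF assms(1) that assms(2)] by (auto split: if_splits)
  show ?thesis
  proof (intro equalityI subsetI)
    fix s assume s: "s \<in> {s \<in> S1. ccw p s q}"
    then have "s / p \<in> S1" using assms by (simp add: S1_iff norm_divide)
    then have "s / p = cis (Arg2pi (s / p))" by (rule S1_cis)
    then have "s = p * cis (Arg2pi (s / p))"
      using S1_nz[OF assms(1)] by (metis nonzero_mult_div_cancel_left times_divide_eq_right)
    then show "s \<in> (\<lambda>t. p * cis t) ` {0<..<Arg2pi (q / p)}" using s * by auto
  next
    fix s assume "s \<in> (\<lambda>t. p * cis t) ` {0<..<Arg2pi (q / p)}"
    then obtain t where t: "0 < t" "t < Arg2pi (q / p)" "s = p * cis t" by auto
    have s: "s \<in> S1" using t assms by (simp add: S1_iff norm_mult)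
    have "Arg2pi (s / p) = t"
    proof (rule Arg2pi_unique[where r = 1])
      show "complex_of_real 1 * exp (\<i> * complex_of_real t) = s / p"
        using t S1_nz[OF assms(1)] by (simp add: cis_conv_exp)
    qed (use t Arg2pi[of "q / p"] in auto)
    then show "s \<in> {s \<in> S1. ccw p s q}" using s * t by auto
  qed
qed

lemma connected_ccw_arc:
  assumes "p \<in> S1" "q \<in> S1" "p \<noteq> q"
  shows "connected {s \<in> S1. ccw p s q}"
  unfolding ccw_arc_eq[OF assms]
  by (intro connected_continuous_image continuous_intros) auto

lemma ccw_arc_nonempty:
  assumes "p \<in> S1" "q \<in> S1" "p \<noteq> q"
  obtains s where "s \<in> S1" "ccw p s q"
proof -
  have "Arg2pi (q / p) \<noteq> 0"
    using assms Arg2pi_S1_inj[of q p] Arg2pi[of q] Arg2pi[of p] Arg2pi_divide_S1[of q p] by auto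
  then have "0 < Arg2pi (q / p)"
    using Arg2pi[of "q / p"] by linarith
  then have "{s \<in> S1. ccw p s q} \<noteq> {}"
    unfolding ccw_arc_eq[OF assms] by simp
  then show ?thesis using that by auto
qed

lemma connected_S1_delete:
  assumes "p \<in> S1"
  shows "connected (S1 - {p})"
proof -
  have "S1 - {p} = (\<lambda>t. p * cis t) ` {0<..<2 * pi}"
  proof (intro equalityI subsetI)
    fix s assume s: "s \<in> S1 - {p}"
    then have "s / p \<in> S1" using assms by (simp add: S1_iff norm_divide)
    then have "s / p = cis (Arg2pi (s / p))" by (rule S1_cis)
    then have eq: "s = p * cis (Arg2pi (s / p))"
      using S1_nz[OF assms(1)] by (metis nonzero_mult_div_cancel_left times_divide_eq_right)
    with s have "Arg2pi (s / p) \<noteq> 0" by auto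
    then show "s \<in> (\<lambda>t. p * cis t) ` {0<..<2 * pi}" using eq Arg2pi[of "s / p"] by auto
  next
    fix s assume "s \<in> (\<lambda>t. p * cis t) ` {0<..<2 * pi}"
    then obtain t where t: "0 < t" "t < 2 * pi" "s = p * cis t" by auto
    have "Arg2pi (cis t) = t"
      by (rule Arg2pi_unique[where r = 1]) (use t in \<open>auto simp: cis_conv_exp\<close>)
    then have "cis t \<noteq> 1" using t by (metis Arg2pi_of_real less_irrefl of_real_1 zero_less_one not_less_iff_gr_or_eq)
    then show "s \<in> S1 - {p}" using t assms S1_nz[OF assms] by (simp add: S1_iff norm_mult)
  qed
  then show ?thesis by (auto intro!: connected_continuous_image continuous_intros)
qed

subsection \<open>Theta graphs and winding numbers\<close>

lemma winding_number_theta: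
  assumes "path c" "path d" "pathstart c = pathstart d" "pathfinish c = pathfinish d"
    "z \<notin> path_image c" "z \<notin> path_image d"
  shows "winding_number (c +++ reversepath d) z = winding_number c z - winding_number d z"
  using assms by (simp add: winding_number_join winding_number_reversepath)

lemma winding_number_inside_cases:
  "simple_path \<gamma> \<Longrightarrow> z \<in> inside (path_image \<gamma>) \<Longrightarrow> winding_number \<gamma> z \<in> {-1, 1}"
  by (rule simple_closed_path_winding_number_inside) auto

text \<open>Continuous logarithms of the two factors add up to one of the product.\<close>

lemma winding_number_times:
  assumes "path p" "path q" "0 \<notin> path_image p" "0 \<notin> path_image q"
  shows "winding_number (\<lambda>t. p t * q t) 0 = winding_number p 0 + winding_number q 0"
proof -
  obtain p' where p': "path p'" "pathfinish p' - pathstart p' = 2 * of_real pi * \<i> * winding_number p 0"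
    "\<And>t. t \<in> {0..1} \<Longrightarrow> p t = 0 + exp (p' t)"
    using winding_number_as_continuous_log[OF assms(1,3)] by blast
  obtain q' where q': "path q'" "pathfinish q' - pathstart q' = 2 * of_real pi * \<i> * winding_number q 0"
    "\<And>t. t \<in> {0..1} \<Longrightarrow> q t = 0 + exp (q' t)"
    using winding_number_as_continuous_log[OF assms(2,4)] by blast
  have "winding_number (\<lambda>t. p t * q t) 0 = winding_number (exp \<circ> (\<lambda>t. p' t + q' t)) 0"
    by (rule winding_number_cong) (simp add: p' q' exp_add)
  also have "\<dots> = (pathfinish (\<lambda>t. p' t + q' t) - pathstart (\<lambda>t. p' t + q' t)) / (2 * of_real pi * \<i>)"
    by (rule winding_number_compose_exp) (use p' q' in \<open>auto simp: path_def intro!: continuous_intros\<close>)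
  also have "\<dots> = ((pathfinish p' - pathstart p') + (pathfinish q' - pathstart q')) / (2 * of_real pi * \<i>)"
    by (simp add: pathfinish_def pathstart_def)
  also have "\<dots> = winding_number p 0 + winding_number q 0"
    unfolding p' q' by (simp add: field_simps)
  finally show ?thesis .
qed

lemma winding_number_const: "a \<noteq> z \<Longrightarrow> winding_number (\<lambda>t. a) z = 0"
  using winding_number_trivial[of z a] by (simp add: linepath_refl)

lemma winding_number_uminus:
  assumes "path p" "0 \<notin> path_image p"
  shows "winding_number (\<lambda>t. - p t) 0 = winding_number p 0"
proof -
  have "winding_number (\<lambda>t. (-1) * p t) 0 = winding_number (\<lambda>t. -1) 0 + winding_number p 0"
    by (rule winding_number_times) (use assms in \<open>auto simp: path_def path_image_def\<close>)
  then show ?thesis by (simp add: winding_number_const)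
qed

text \<open>Of three arcs with common ends, one runs inside the loop of the other two; it contributes
  \<open>\<plusminus>1\<close> to the sum below and the other two contribute nothing.\<close>

lemma theta_middle:
  fixes c c1 c2 :: "real \<Rightarrow> complex"
  assumes c: "simple_path c" "pathstart c = a" "pathfinish c = b"
    and c1: "simple_path c1" "pathstart c1 = a" "pathfinish c1 = b"
    and c2: "simple_path c2" "pathstart c2 = a" "pathfinish c2 = b"
    and ab: "a \<noteq> b"
    and c12: "path_image c1 \<inter> path_image c2 = {a,b}"
    and c1c: "path_image c1 \<inter> path_image c = {a,b}"
    and c2c: "path_image c2 \<inter> path_image c = {a,b}"
    and ne: "path_image c \<inter> inside (path_image c1 \<union> path_image c2) \<noteq> {}"
    and x: "x \<in> path_image c - {a,b}" and x1: "x1 \<in> path_image c1 - {a,b}"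
    and x2: "x2 \<in> path_image c2 - {a,b}"
  shows "winding_number c1 x - winding_number c2 x \<in> {1,-1}"
    "winding_number c x1 = winding_number c2 x1" "winding_number c x2 = winding_number c1 x2"
proof -
  have split: "inside (path_image c1 \<union> path_image c) \<union> inside (path_image c2 \<union> path_image c) \<union>
           (path_image c - {a,b}) = inside (path_image c1 \<union> path_image c2)"
    using split_inside_simple_closed_curve[OF c1 c2 c ab c12 c1c c2c ne] by blast
  have arcs: "Path_Connected.arc c" "Path_Connected.arc c1" "Path_Connected.arc c2"
    using c c1 c2 ab by (auto simp: arc_simple_path)
  have paths: "path c" "path c1" "path c2" using c c1 c2 simple_path_imp_path by auto
  have sp: "simple_path (c1 +++ reversepath c2)"
    using arcs c c1 c2 ab c12 by (auto simp: simple_path_join_loop_eq arc_simple_path simple_path_reversepath)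
  have xin: "x \<in> inside (path_image (c1 +++ reversepath c2))"
    using split x paths c1 c2 by (auto simp: path_image_join)
  have "winding_number (c1 +++ reversepath c2) x \<in> {-1,1}"
    by (rule winding_number_inside_cases[OF sp xin])
  moreover have nx: "x \<notin> path_image c1" "x \<notin> path_image c2" using x c1c c2c by auto
  moreover have "winding_number (c1 +++ reversepath c2) x = winding_number c1 x - winding_number c2 x"
    by (rule winding_number_theta) (use paths c1 c2 nx in simp_all)
  ultimately show "winding_number c1 x - winding_number c2 x \<in> {1,-1}" by auto
  have out: "winding_number d1 y = winding_number d2 y"
    if d: "path d1" "path d2" "pathstart d1 = a" "pathstart d2 = a" "pathfinish d1 = b" "pathfinish d2 = b"
      and y: "y \<notin> path_image d1 \<union> path_image d2"
      and sub: "inside (path_image d1 \<union> path_image d2) \<subseteq> inside (path_image c1 \<union> path_image c2)"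
      and yc: "y \<in> path_image c1 \<union> path_image c2" for d1 d2 y
  proof -
    have "y \<notin> inside (path_image c1 \<union> path_image c2)"
      using yc inside_no_overlap by blast
    then have "y \<in> outside (path_image d1 \<union> path_image d2)"
      using y sub by (metis ComplI UnE inside_Un_outside subsetD)
    then have "winding_number (d1 +++ reversepath d2) y = 0"
      using d by (intro winding_number_zero_in_outside) (auto simp: path_image_join)
    moreover have "winding_number (d1 +++ reversepath d2) y = winding_number d1 y - winding_number d2 y"
      by (rule winding_number_theta) (use d y in simp_all)
    ultimately show ?thesis by simp
  qed
  show "winding_number c x1 = winding_number c2 x1"
    by (rule out) (use paths c c1 c2 x1 c1c c12 split in \<open>auto simp: Un_commute\<close>)
  show "winding_number c x2 = winding_number c1 x2"
    by (rule out) (use paths c c1 c2 x2 c2c c12 split in \<open>auto simp: Un_commute\<close>)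
qed

text \<open>Otherwise take \<open>P\<close> inside the loop of \<open>c1\<close> and
  \<open>c2\<close>. It is also inside a second loop, and the two inside regions are connected and
  avoid each other's frontier, hence coincide. Then their frontiers coincide, although they are
  different pairs of arcs.\<close>

lemma theta_exists_middle:
  fixes c1 c2 c3 :: "real \<Rightarrow> complex"
  assumes c1: "simple_path c1" "pathstart c1 = a" "pathfinish c1 = b"
    and c2: "simple_path c2" "pathstart c2 = a" "pathfinish c2 = b"
    and c3: "simple_path c3" "pathstart c3 = a" "pathfinish c3 = b"
    and ab: "a \<noteq> b"
    and c12: "path_image c1 \<inter> path_image c2 = {a,b}"
    and c13: "path_image c1 \<inter> path_image c3 = {a,b}"
    and c23: "path_image c2 \<inter> path_image c3 = {a,b}"
  shows "path_image c3 \<inter> inside (path_image c1 \<union> path_image c2) \<noteq> {} \<or>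
         path_image c1 \<inter> inside (path_image c2 \<union> path_image c3) \<noteq> {} \<or>
         path_image c2 \<inter> inside (path_image c1 \<union> path_image c3) \<noteq> {}"
proof (rule ccontr)
  assume "\<not> ?thesis"
  then have no: "path_image c3 \<inter> inside (path_image c1 \<union> path_image c2) = {}"
    "path_image c1 \<inter> inside (path_image c2 \<union> path_image c3) = {}"
    "path_image c2 \<inter> inside (path_image c1 \<union> path_image c3) = {}" by auto
  have paths: "path c1" "path c2" "path c3" using c1 c2 c3 simple_path_imp_path by auto
  have arcs: "Path_Connected.arc c1" "Path_Connected.arc c2" "Path_Connected.arc c3"
    using c1 c2 c3 ab by (auto simp: arc_simple_path)
  \<comment> \<open>Beyond the Jordan curve facts, the inside of a loop is described by the two arcs
    having different winding numbers; in this form membership passes from one loop to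
    another.\<close>
  have J: "inside (path_image d \<union> path_image e) \<noteq> {} \<and> connected (inside (path_image d \<union> path_image e)) \<and>
       open (inside (path_image d \<union> path_image e)) \<and>
      frontier (inside (path_image d \<union> path_image e)) = path_image d \<union> path_image e \<and>
      (\<forall>z \<in> inside (path_image d \<union> path_image e). winding_number d z \<noteq> winding_number e z) \<and>
      (\<forall>z. z \<notin> path_image d \<union> path_image e \<and> winding_number d z \<noteq> winding_number e z
         \<longrightarrow> z \<in> inside (path_image d \<union> path_image e))"
    if de: "Path_Connected.arc d" "Path_Connected.arc e" "pathstart d = a" "pathfinish d = b" "pathstart e = a" "pathfinish e = b"
      "path_image d \<inter> path_image e = {a,b}" for d e
  proof -
    have pde: "path d" "path e" using de arc_imp_path by auto
    have sp: "simple_path (d +++ reversepath e)"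
      using de ab by (auto simp: simple_path_join_loop_eq arc_simple_path simple_path_reversepath)
    have loop: "pathfinish (d +++ reversepath e) = pathstart (d +++ reversepath e)" using de by simp
    have pim: "path_image (d +++ reversepath e) = path_image d \<union> path_image e"
      using de by (simp add: path_image_join)
    have A1: "winding_number d z \<noteq> winding_number e z" if "z \<in> inside (path_image d \<union> path_image e)" for z
    proof -
      have "winding_number (d +++ reversepath e) z \<in> {-1,1}"
        by (rule winding_number_inside_cases[OF sp]) (simp add: pim that)
      moreover have "z \<notin> path_image d \<union> path_image e" using that inside_no_overlap by blast
      then have "winding_number (d +++ reversepath e) z = winding_number d z - winding_number e z"
        by (intro winding_number_theta) (use pde de in simp_all)
      ultimately show ?thesis by auto
    qed
    have A2: "z \<in> inside (path_image d \<union> path_image e)"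
      if "z \<notin> path_image d \<union> path_image e" "winding_number d z \<noteq> winding_number e z" for z
    proof (rule ccontr)
      assume "z \<notin> inside (path_image d \<union> path_image e)"
      then have "z \<in> outside (path_image (d +++ reversepath e))"
        using that unfolding pim by (metis ComplI UnE inside_Un_outside)
      then have "winding_number (d +++ reversepath e) z = 0"
        using sp loop simple_path_imp_path winding_number_zero_in_outside by blast
      moreover have "winding_number (d +++ reversepath e) z = winding_number d z - winding_number e z"
        by (rule winding_number_theta) (use that pde de in simp_all)
      ultimately show False using that by simp
    qed
    from Jordan_inside_outside[OF sp loop, unfolded pim]
    have "inside (path_image d \<union> path_image e) \<noteq> {}" "connected (inside (path_image d \<union> path_image e))"
      "open (inside (path_image d \<union> path_image e))"
      "frontier (inside (path_image d \<union> path_image e)) = path_image d \<union> path_image e"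
      by simp_all
    then show ?thesis using A1 A2 by presburger
  qed
  note J12 = J[OF arcs(1,2) c1(2,3) c2(2,3) c12] and J13 = J[OF arcs(1,3) c1(2,3) c3(2,3) c13]
    and J23 = J[OF arcs(2,3) c2(2,3) c3(2,3) c23]
  have sub: "U \<subseteq> V" if "connected U" "U \<inter> V \<noteq> {}" "frontier V \<inter> U = {}" for U V :: "complex set"
    using connected_Int_frontier[OF that(1,2)] that(3) by auto
  define I12 where "I12 = inside (path_image c1 \<union> path_image c2)"
  define I13 where "I13 = inside (path_image c1 \<union> path_image c3)"
  define I23 where "I23 = inside (path_image c2 \<union> path_image c3)"
  note J12 = J12[folded I12_def] and J13 = J13[folded I13_def] and J23 = J23[folded I23_def]
  note no = no[folded I12_def I13_def I23_def]
  have disj: "(path_image c1 \<union> path_image c2) \<inter> I12 = {}" "(path_image c1 \<union> path_image c3) \<inter> I13 = {}"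
     "(path_image c2 \<union> path_image c3) \<inter> I23 = {}"
    unfolding I12_def I13_def I23_def by (subst Int_commute, rule inside_no_overlap)+
  have con: "connected I12" "connected I13" "connected I23"
    and fr: "frontier I12 = path_image c1 \<union> path_image c2" "frontier I13 = path_image c1 \<union> path_image c3"
      "frontier I23 = path_image c2 \<union> path_image c3"
    using J12 J13 J23 by simp_all
  obtain P where P: "P \<in> I12" using J12 by blast
  then have Pn: "P \<notin> path_image c1" "P \<notin> path_image c2" "P \<notin> path_image c3"
    using no disj by auto
  have w12: "winding_number c1 P \<noteq> winding_number c2 P" using J12 P by blast
  obtain y1 where y1: "y1 \<in> path_image c1" "y1 \<noteq> a" "y1 \<noteq> b"
    using nonempty_simple_path_endless[OF c1(1)] c1 by auto
  obtain y2 where y2: "y2 \<in> path_image c2" "y2 \<noteq> a" "y2 \<noteq> b"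
    using nonempty_simple_path_endless[OF c2(1)] c2 by auto
  \<comment> \<open>The winding number of \<open>c3\<close> about \<open>P\<close> cannot equal both
    of the different values of \<open>c1\<close> and \<open>c2\<close>.\<close>
  consider "P \<in> I23" | "P \<in> I13"
    using w12 J13 J23 Pn by auto
  then show False
  proof cases
    case 1
    have "I12 \<subseteq> I23" using P 1 no disj by (intro sub con) (unfold fr, blast+)
    moreover have "I23 \<subseteq> I12" using P 1 no disj by (intro sub con) (unfold fr, blast+)
    ultimately have "path_image c1 \<union> path_image c2 = path_image c2 \<union> path_image c3"
      using fr by (metis subset_antisym)
    with y1 c12 c13 show False by blast
  next
    case 2
    have "I12 \<subseteq> I13" using P 2 no disj by (intro sub con) (unfold fr, blast+)
    moreover have "I13 \<subseteq> I12" using P 2 no disj by (intro sub con) (unfold fr, blast+)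
    ultimately have "path_image c1 \<union> path_image c2 = path_image c1 \<union> path_image c3"
      using fr by (metis subset_antisym)
    with y2 c12 c23 show False by blast
  qed
qed

text \<open>Whichever arc is the middle one, its bracket is 1 or -1 and the other two brackets
  vanish. The cyclic form of the sum spares the knowledge of which arc that is, and it matches the
  difference of two angle sums.\<close>

lemma theta_winding_sum:
  fixes c1 c2 c3 :: "real \<Rightarrow> complex"
  assumes c1: "simple_path c1" "pathstart c1 = a" "pathfinish c1 = b"
    and c2: "simple_path c2" "pathstart c2 = a" "pathfinish c2 = b"
    and c3: "simple_path c3" "pathstart c3 = a" "pathfinish c3 = b"
    and ab: "a \<noteq> b"
    and c12: "path_image c1 \<inter> path_image c2 = {a,b}"
    and c13: "path_image c1 \<inter> path_image c3 = {a,b}"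
    and c23: "path_image c2 \<inter> path_image c3 = {a,b}"
    and x1: "x1 \<in> path_image c1 - {a,b}" and x2: "x2 \<in> path_image c2 - {a,b}"
    and x3: "x3 \<in> path_image c3 - {a,b}"
  shows "(winding_number c1 x3 - winding_number c2 x3) + (winding_number c2 x1 - winding_number c3 x1)
       + (winding_number c3 x2 - winding_number c1 x2) \<noteq> 0"
proof -
  consider "path_image c3 \<inter> inside (path_image c1 \<union> path_image c2) \<noteq> {}"
    | "path_image c1 \<inter> inside (path_image c2 \<union> path_image c3) \<noteq> {}"
    | "path_image c2 \<inter> inside (path_image c1 \<union> path_image c3) \<noteq> {}"
    using theta_exists_middle[OF c1 c2 c3 ab c12 c13 c23] by blast
  then show ?thesis
  proof cases
    case 1
    show ?thesis
      using theta_middle[OF c3 c1 c2 ab c12 c13 c23 1 x3 x1 x2] by auto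
  next
    case 2
    have "path_image c2 \<inter> path_image c1 = {a,b}" "path_image c3 \<inter> path_image c1 = {a,b}"
      using c12 c13 by auto
    from theta_middle[OF c1 c2 c3 ab c23 this 2 x1 x2 x3] show ?thesis by auto
  next
    case 3
    have "path_image c3 \<inter> path_image c2 = {a,b}" using c23 by auto
    from theta_middle[OF c2 c1 c3 ab c13 c12 this 3 x2 x1 x3] show ?thesis by auto
  qed
qed

section \<open>Angle sums of curvilinear triangles in an embedded disk\<close>

lemma segment_S1_avoids:
  assumes "a \<in> cball 0 1" "b \<in> cball 0 1" "c \<in> S1" "a \<noteq> c" "b \<noteq> c"
  shows "closed_segment a b \<subseteq> cball 0 1 - {c}"
proof -
  have "closed_segment a b \<subseteq> cball 0 1"
    using assms by (intro closed_segment_subset) auto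
  moreover have "c \<notin> closed_segment a b"
  proof
    assume "c \<in> closed_segment a b"
    then have "c \<in> open_segment a b" using assms by (auto simp: open_segment_def)
    from dist_decreases_open_segment[OF this, of 0] show False
      using assms by (auto simp: S1_def)
  qed
  ultimately show ?thesis by blast
qed

text \<open>Pulled back to the closed unit disk, both paths avoid the circle point \<open>c\<close>.
  By strict convexity the disk without \<open>c\<close> is still convex, so a linear homotopy with
  fixed ends joins them. The angle at a boundary point therefore depends on the ends of the path
  only.\<close>

lemma winding_number_in_disk:
  fixes \<phi> :: "complex \<Rightarrow> complex"
  assumes \<phi>: "continuous_on (cball 0 1) \<phi>" "inj_on \<phi> (cball 0 1)"
    and c: "c \<in> S1" and g: "path g" "path_image g \<subseteq> \<phi> ` cball 0 1 - {\<phi> c}"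
    and p: "path p" "path_image p \<subseteq> cball 0 1 - {c}"
      "pathstart g = \<phi> (pathstart p)" "pathfinish g = \<phi> (pathfinish p)"
  shows "winding_number g (\<phi> c) = winding_number (\<phi> \<circ> p) (\<phi> c)"
proof -
  obtain \<psi> where h: "homeomorphism (cball 0 1) (\<phi> ` cball 0 1) \<phi> \<psi>"
    using homeomorphism_compact[OF compact_cball \<phi>(1) refl \<phi>(2)] by blast
  have cin: "c \<in> cball 0 1" using c by (simp add: S1_def)
  have g': "path_image (\<psi> \<circ> g) \<subseteq> cball 0 1 - {c}"
  proof
    fix y assume "y \<in> path_image (\<psi> \<circ> g)"
    then obtain z where z: "z \<in> path_image g" "y = \<psi> z" by (auto simp: path_image_compose)
    then obtain x where "x \<in> cball 0 1" "z = \<phi> x" "z \<noteq> \<phi> c" using g(2) by blast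
    then show "y \<in> cball 0 1 - {c}" using z homeomorphism_apply1[OF h] by auto
  qed
  have pg: "path (\<psi> \<circ> g)"
    by (rule path_continuous_image) (use g h in \<open>auto simp: homeomorphism_def intro: continuous_on_subset\<close>)
  have e: "pathstart p \<in> cball 0 1" "pathfinish p \<in> cball 0 1"
    using p pathstart_in_path_image pathfinish_in_path_image by blast+
  have "homotopic_paths (cball 0 1 - {c}) (\<psi> \<circ> g) p"
  proof (rule homotopic_paths_linear)
    show "pathstart p = pathstart (\<psi> \<circ> g)" "pathfinish p = pathfinish (\<psi> \<circ> g)"
      using p e h by (auto simp: pathstart_compose pathfinish_compose homeomorphism_def)
    show "closed_segment ((\<psi> \<circ> g) t) (p t) \<subseteq> cball 0 1 - {c}" if "t \<in> {0..1}" for t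
    proof -
      have "(\<psi> \<circ> g) t \<in> cball 0 1 - {c}" "p t \<in> cball 0 1 - {c}"
        using that g' p(2) unfolding path_image_def by blast+
      then show ?thesis using segment_S1_avoids[OF _ _ c] by blast
    qed
  qed (use pg p in auto)
  then have "homotopic_paths (- {\<phi> c}) (\<phi> \<circ> (\<psi> \<circ> g)) (\<phi> \<circ> p)"
    by (rule homotopic_paths_continuous_image)
       (use \<phi> cin in \<open>auto intro: continuous_on_subset simp: inj_on_def\<close>)
  then have "winding_number (\<phi> \<circ> (\<psi> \<circ> g)) (\<phi> c) = winding_number (\<phi> \<circ> p) (\<phi> c)"
    by (rule winding_number_homotopic_paths)
  moreover have "winding_number (\<phi> \<circ> (\<psi> \<circ> g)) (\<phi> c) = winding_number g (\<phi> c)"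
  proof (rule winding_number_cong)
    fix t :: real assume "0 \<le> t" "t \<le> 1"
    then have "t \<in> {0..1}" by simp
    then have "g t \<in> \<phi> ` cball 0 1" using g(2) unfolding path_image_def by blast
    then show "(\<phi> \<circ> (\<psi> \<circ> g)) t = g t" using homeomorphism_apply2[OF h] by simp
  qed
  ultimately show ?thesis by simp
qed

text \<open>A loop of ordered pairs of distinct points, moving one coordinate at a time. After three
  segments the pair \<open>(a,c)\<close> has become \<open>(c,a)\<close>; the last three segments
  repeat the first three with the coordinates exchanged.\<close>

definition swap_loop :: "complex \<Rightarrow> complex \<Rightarrow> complex \<Rightarrow> real \<Rightarrow> complex \<times> complex" where
  "swap_loop a b c = linepath (a,c) (b,c) +++ linepath (b,c) (b,a) +++ linepath (b,a) (c,a)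
     +++ linepath (c,a) (c,b) +++ linepath (c,b) (a,b) +++ linepath (a,b) (a,c)"

lemma swap_pieces:
  fixes \<phi> :: "complex \<Rightarrow> complex"
  assumes \<phi>: "continuous_on (cball 0 1) \<phi>" "inj_on \<phi> (cball 0 1)"
    and "a \<in> S1" "b \<in> S1" "c \<in> S1" "a \<noteq> c" "b \<noteq> c"
  defines "G \<equiv> \<lambda>(u,v). \<phi> u - \<phi> v"
  shows "path (G \<circ> linepath (a,c) (b,c))" "path (G \<circ> linepath (c,a) (c,b))"
    "0 \<notin> path_image (G \<circ> linepath (a,c) (b,c))" "0 \<notin> path_image (G \<circ> linepath (c,a) (c,b))"
    "winding_number (G \<circ> linepath (a,c) (b,c)) 0 = winding_number (\<phi> \<circ> linepath a b) (\<phi> c)"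
    "winding_number (G \<circ> linepath (c,a) (c,b)) 0 = winding_number (\<phi> \<circ> linepath a b) (\<phi> c)"
proof -
  have eq: "G \<circ> linepath (a,c) (b,c) = (\<lambda>t. (\<phi> \<circ> linepath a b) t - \<phi> c)"
    by (auto simp: G_def linepath_def fun_eq_iff algebra_simps simp flip: scaleR_left_distrib)
  have eq2: "G \<circ> linepath (c,a) (c,b) = (\<lambda>t. - ((\<phi> \<circ> linepath a b) t - \<phi> c))"
    by (auto simp: G_def linepath_def fun_eq_iff algebra_simps simp flip: scaleR_left_distrib)
  have seg: "closed_segment a b \<subseteq> cball 0 1 - {c}"
    by (rule segment_S1_avoids) (use assms in \<open>auto simp: S1_def\<close>)
  have p0: "path (\<phi> \<circ> linepath a b)"
    by (rule path_continuous_image) (use \<phi> seg in \<open>auto intro: continuous_on_subset\<close>)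
  then show p: "path (G \<circ> linepath (a,c) (b,c))"
    unfolding eq path_def by (intro continuous_on_diff continuous_on_const) simp
  have "\<phi> u \<noteq> \<phi> c" if "u \<in> closed_segment a b" for u
    using that seg \<phi> assms by (auto simp: inj_on_def S1_def)
  then have nz: "0 \<notin> path_image (\<lambda>t. (\<phi> \<circ> linepath a b) t - \<phi> c)"
    by (auto simp: path_image_def linepath_in_path)
  then show "0 \<notin> path_image (G \<circ> linepath (a,c) (b,c))" unfolding eq .
  show "0 \<notin> path_image (G \<circ> linepath (c,a) (c,b))"
    using nz unfolding eq2 by (auto simp: path_image_def)
  show "path (G \<circ> linepath (c,a) (c,b))"
    using p0 unfolding eq2 path_def by (intro continuous_on_minus continuous_on_diff continuous_on_const) simp
  show "winding_number (G \<circ> linepath (a,c) (b,c)) 0 = winding_number (\<phi> \<circ> linepath a b) (\<phi> c)"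
    unfolding eq using winding_number_offset by metis
  moreover have "winding_number (G \<circ> linepath (c,a) (c,b)) 0 = winding_number (G \<circ> linepath (a,c) (b,c)) 0"
    unfolding eq eq2 by (rule winding_number_uminus) (use p nz in \<open>auto simp: eq\<close>)
  ultimately show "winding_number (G \<circ> linepath (c,a) (c,b)) 0 = winding_number (\<phi> \<circ> linepath a b) (\<phi> c)"
    by simp
qed

text \<open>Exchanging the coordinates only negates \<open>\<phi> u - \<phi> v\<close>, so both
  halves of the loop contribute the same amount \<open>s\<close>. The first half carries a nonzero
  difference to its negative, which is the exponential identity: \<open>s\<close> is half an odd
  integer. This identity later rules out even values of \<open>2 * s\<close>.\<close>

lemma swap_loop_winding:
  fixes \<phi> :: "complex \<Rightarrow> complex"
  assumes \<phi>: "continuous_on (cball 0 1) \<phi>" "inj_on \<phi> (cball 0 1)"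
    and S: "a \<in> S1" "b \<in> S1" "c \<in> S1" "a \<noteq> b" "a \<noteq> c" "b \<noteq> c"
  defines "s \<equiv> winding_number (\<phi> \<circ> linepath a b) (\<phi> c) + winding_number (\<phi> \<circ> linepath b c) (\<phi> a)
     + winding_number (\<phi> \<circ> linepath c a) (\<phi> b)"
  shows "winding_number ((\<lambda>(u,v). \<phi> u - \<phi> v) \<circ> swap_loop a b c) 0 = 2 * s"
    "exp (2 * pi * \<i> * s) = -1"
proof -
  define G where "G = (\<lambda>(u,v). \<phi> u - \<phi> v)"
  note ab = swap_pieces[OF \<phi> S(1,2,3) S(5,6), folded G_def]
  note bc = swap_pieces[OF \<phi> S(2,3,1) S(4)[symmetric] S(5)[symmetric], folded G_def]
  note ca = swap_pieces[OF \<phi> S(3,1,2) S(6)[symmetric] S(4), folded G_def]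
  have st: "pathstart (G \<circ> linepath p q) = G p" "pathfinish (G \<circ> linepath p q) = G q" for p q
    by (auto simp: pathstart_compose pathfinish_compose)
  show "winding_number (G \<circ> swap_loop a b c) 0 = 2 * s"
    unfolding swap_loop_def path_compose_join
    using ab bc ca by (simp add: winding_number_join st not_in_path_image_join s_def)
  let ?h = "(G \<circ> linepath (a,c) (b,c)) +++ (G \<circ> linepath (b,c) (b,a)) +++ (G \<circ> linepath (b,a) (c,a))"
  have wh: "winding_number ?h 0 = s"
    using ab bc ca by (simp add: winding_number_join st not_in_path_image_join s_def)
  have "path ?h" "0 \<notin> path_image ?h"
    using ab bc ca by (auto simp add: st not_in_path_image_join)
  from winding_number_exp_2pi[OF this] have "G (c,a) = exp (2 * pi * \<i> * s) * G (a,c)"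
    unfolding wh by (simp add: st)
  moreover have "G (c,a) = - G (a,c)" by (simp add: G_def)
  moreover have "G (a,c) \<noteq> 0"
    using S \<phi>(2) by (auto simp: G_def inj_on_def S1_def)
  ultimately show "exp (2 * pi * \<i> * s) = -1"
    by (metis mult_minus_left mult_right_cancel mult.left_neutral)
qed

lemma linepath_winding_bounds:
  assumes "a \<in> S1" "b \<in> S1" "c \<in> S1" "ccw a b c"
  shows "0 < Re (winding_number (linepath a b) c)" "Re (winding_number (linepath a b) c) < 1/2"
proof -
  show "0 < Re (winding_number (linepath a b) c)"
    by (rule winding_number_linepath_pos_lt) (use assms(4) in \<open>simp add: ccw_def algebra_simps\<close>)
  have "c \<notin> closed_segment a b"
    using segment_S1_avoids[of a b c] assms ccw_distinct[OF assms(4)] by (auto simp: S1_def)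
  from winding_number_lt_half_linepath[OF this] show "Re (winding_number (linepath a b) c) < 1/2"
    by linarith
qed

lemma path_swap_loop: "path (swap_loop a b c)" "pathfinish (swap_loop a b c) = pathstart (swap_loop a b c)"
  by (auto simp: swap_loop_def)

lemma swap_loop_image:
  assumes "a \<in> S1" "b \<in> S1" "c \<in> S1" "a \<noteq> b" "a \<noteq> c" "b \<noteq> c"
  shows "path_image (swap_loop a b c) \<subseteq> {(u,v). u \<in> cball 0 1 \<and> v \<in> cball 0 1 \<and> u \<noteq> v}"
proof -
  have *: "closed_segment (a,c) (b,c) \<subseteq> {(u,v). u \<in> cball 0 1 \<and> v \<in> cball 0 1 \<and> u \<noteq> v}"
    "closed_segment (c,a) (c,b) \<subseteq> {(u,v). u \<in> cball 0 1 \<and> v \<in> cball 0 1 \<and> u \<noteq> v}"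
    if "a \<in> S1" "b \<in> S1" "c \<in> S1" "a \<noteq> c" "b \<noteq> c" for a b c :: complex
  proof -
    have seg: "closed_segment a b \<subseteq> cball 0 1 - {c}"
      by (rule segment_S1_avoids) (use that in \<open>auto simp: S1_def\<close>)
    have c: "c \<in> cball 0 1" using that by (simp add: S1_def)
    show "closed_segment (a,c) (b,c) \<subseteq> {(u,v). u \<in> cball 0 1 \<and> v \<in> cball 0 1 \<and> u \<noteq> v}"
    proof
      fix x assume "x \<in> closed_segment (a,c) (b,c)"
      then have x: "fst x \<in> closed_segment a b" "snd x = c"
        by (auto simp: in_segment simp flip: scaleR_left_distrib)
      then have "fst x \<in> cball 0 1" "fst x \<noteq> c" using seg by blast+
      with x c show "x \<in> {(u,v). u \<in> cball 0 1 \<and> v \<in> cball 0 1 \<and> u \<noteq> v}"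
        by (simp add: case_prod_unfold)
    qed
    show "closed_segment (c,a) (c,b) \<subseteq> {(u,v). u \<in> cball 0 1 \<and> v \<in> cball 0 1 \<and> u \<noteq> v}"
    proof
      fix x assume "x \<in> closed_segment (c,a) (c,b)"
      then have x: "snd x \<in> closed_segment a b" "fst x = c"
        by (auto simp: in_segment simp flip: scaleR_left_distrib)
      then have "snd x \<in> cball 0 1" "snd x \<noteq> c" using seg by blast+
      with x c show "x \<in> {(u,v). u \<in> cball 0 1 \<and> v \<in> cball 0 1 \<and> u \<noteq> v}"
        by (auto simp add: case_prod_unfold)
    qed
  qed
  show ?thesis
    unfolding swap_loop_def
    by (intro subset_path_image_join) (use *[of a b c] *[of b c a] *[of c a b] assms in auto)
qed

text \<open>Calibration for the identity embedding: each of the three angles has real part between 0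
  and 1/2, so the integer \<open>2 * s\<close> is 1 or 2, and 2 would give
  \<open>exp (2 * pi * \<i> * s) = 1\<close>. The factor 1/2 keeps differences of disk points inside
  the disk and does not affect the winding number.\<close>

lemma half_swap_winding:
  assumes S: "a \<in> S1" "b \<in> S1" "c \<in> S1" and ccw: "ccw a b c"
  shows "winding_number ((\<lambda>(u,v). (u - v) / 2) \<circ> swap_loop a b c) 0 = 1"
proof -
  note d = ccw_distinct[OF ccw]
  define s where "s = winding_number (linepath a b) c + winding_number (linepath b c) a
     + winding_number (linepath c a) b"
  have 1: "winding_number ((\<lambda>(u,v). u - v) \<circ> swap_loop a b c) 0 = 2 * s" "exp (2 * pi * \<i> * s) = -1"
    using swap_loop_winding[of "\<lambda>z. z", OF _ _ S] d by (auto simp: s_def o_def)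
  let ?p = "(\<lambda>(u,v). u - v) \<circ> swap_loop a b c"
  have pp: "path ?p"
    by (rule path_continuous_image[OF path_swap_loop(1)])
       (auto simp: case_prod_unfold intro!: continuous_intros)
  have p0: "0 \<notin> path_image ?p"
    using swap_loop_image[OF S] d by (force simp: path_image_def)
  have "2 * s \<in> \<int>"
    unfolding 1(1)[symmetric]
    by (rule integer_winding_number) (use pp p0 path_swap_loop in \<open>auto simp: pathfinish_compose pathstart_compose\<close>)
  then obtain n where n: "2 * s = of_int n" by (auto elim: Ints_cases)
  have "0 < Re s" "Re s < 3/2"
    using linepath_winding_bounds[OF S(1,2,3) ccw] linepath_winding_bounds[OF S(2,3,1) ccw_rotate[OF ccw]]
      linepath_winding_bounds[OF S(3,1,2) ccw_rotate[OF ccw_rotate[OF ccw]]]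
    by (auto simp: s_def)
  moreover have "2 * Re s = of_int n" using n by (metis Re_complex_of_real mult_2 of_real_of_int_eq plus_complex.sel(1))
  ultimately have "0 < n" "n < 3" by linarith+
  moreover have "n \<noteq> 2"
  proof
    assume "n = 2"
    then have "s = 1" using n by simp
    with 1(2) show False using exp_two_pi_i by (simp add: mult.commute)
  qed
  ultimately have "n = 1" by linarith
  then have "winding_number ?p 0 = 1" using 1(1) n by simp
  moreover have "winding_number (\<lambda>t. ?p t * (1/2)) 0 = winding_number ?p 0 + winding_number (\<lambda>t. 1/2) 0"
    by (rule winding_number_times) (use pp p0 in \<open>auto simp: path_def path_image_def\<close>)
  moreover have "(\<lambda>(u,v). (u - v) / 2) \<circ> swap_loop a b c = (\<lambda>t. ?p t * (1/2))"
    by (auto simp: fun_eq_iff case_prod_unfold)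
  ultimately show ?thesis by (simp add: winding_number_const)
qed

lemma circ_circlepath: "circ = circlepath 0 1"
  by (auto simp: circ_def circlepath fun_eq_iff cis_conv_exp mult_ac)

lemma path_circ: "path circ" "pathfinish circ = pathstart circ"
  by (simp_all add: circ_circlepath)

lemma path_image_circ: "path_image circ = S1"
  by (simp add: circ_circlepath S1_def sphere_def dist_norm)

text \<open>Equal winding numbers give a homotopy in the punctured plane only, where
  \<open>\<phi>\<close> is not controlled; composing it with \<open>sgn\<close> pushes it into the
  punctured disk.\<close>

lemma winding_number_loop_in_disk:
  fixes \<phi> :: "complex \<Rightarrow> complex"
  assumes \<phi>: "continuous_on (cball 0 1) \<phi>" "inj_on \<phi> (cball 0 1)"
    and \<delta>: "path \<delta>" "pathfinish \<delta> = pathstart \<delta>" "path_image \<delta> \<subseteq> cball 0 1 - {0}" "winding_number \<delta> 0 = 1"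
  shows "winding_number (\<phi> \<circ> \<delta>) (\<phi> 0) = winding_number (\<phi> \<circ> circ) (\<phi> 0)"
proof -
  have c0: "0 \<notin> path_image circ" by (simp add: path_image_circ S1_def)
  have "homotopic_loops (- {0}) \<delta> circ"
    using winding_number_homotopic_loops_eq[OF \<delta>(1) _ path_circ(1) c0 \<delta>(2) path_circ(2)] \<delta>
    by (auto simp: circ_circlepath winding_number_circlepath_centre)
  then have "homotopic_loops (cball 0 1 - {0}) (sgn \<circ> \<delta>) (sgn \<circ> circ)"
    by (rule homotopic_loops_continuous_image) (auto intro!: continuous_intros simp: norm_sgn sgn_zero_iff)
  moreover have "sgn \<circ> circ = circ" by (auto simp: fun_eq_iff circ_def sgn_eq)
  moreover have "homotopic_loops (cball 0 1 - {0}) \<delta> (sgn \<circ> \<delta>)"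
  proof (rule homotopic_loops_linear)
    show "path (sgn \<circ> \<delta>)"
      by (rule path_continuous_image) (use \<delta> in \<open>auto intro!: continuous_intros\<close>)
    fix t :: real assume t: "t \<in> {0..1}"
    then have "\<delta> t \<in> cball 0 1 - {0}" using \<delta>(3) unfolding path_image_def by blast
    then have nz: "\<delta> t \<noteq> 0" "cmod (\<delta> t) \<le> 1" by auto
    show "closed_segment (\<delta> t) ((sgn \<circ> \<delta>) t) \<subseteq> cball 0 1 - {0}"
    proof
      fix x assume x: "x \<in> closed_segment (\<delta> t) ((sgn \<circ> \<delta>) t)"
      have "x \<in> cball 0 1"
        using x nz closed_segment_subset[OF _ _ convex_cball, of "\<delta> t" 0 1 "sgn (\<delta> t)"] by (auto simp: norm_sgn)
      moreover obtain u where u: "0 \<le> u" "u \<le> 1" "x = (1 - u) *\<^sub>R \<delta> t + u *\<^sub>R sgn (\<delta> t)"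
        using x by (auto simp: closed_segment_def)
      have "x = ((1 - u) + u / cmod (\<delta> t)) *\<^sub>R \<delta> t"
        using u by (simp add: sgn_div_norm algebra_simps divide_inverse)
      moreover have "(1 - u) + u / cmod (\<delta> t) > 0"
        using u nz by (cases "u = 0") (auto intro!: add_nonneg_pos)
      ultimately show "x \<in> cball 0 1 - {0}" using nz by auto
    qed
  qed (use \<delta> in \<open>auto simp: pathstart_compose pathfinish_compose\<close>)
  ultimately have "homotopic_loops (cball 0 1 - {0}) \<delta> circ"
    by (metis homotopic_loops_trans)
  then have "homotopic_loops (- {\<phi> 0}) (\<phi> \<circ> \<delta>) (\<phi> \<circ> circ)"
    by (rule homotopic_loops_continuous_image) (use \<phi> in \<open>auto intro: continuous_on_subset simp: inj_on_def\<close>)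
  then show ?thesis by (rule winding_number_homotopic_loops)
qed

text \<open>The pair \<open>(u, v)\<close> making the half turn \<open>(a,c) \<rightarrow> (b,c) \<rightarrow> (b,a) \<rightarrow> (c,a)\<close> sweeps out the three
  angles of the curvilinear triangle. Twice this half turn is a loop of pairs of distinct points,
  which contracts onto \<open>v = 0\<close> while \<open>u\<close> runs once around the circle.\<close>

lemma angle_sum_disk:
  fixes \<phi> :: "complex \<Rightarrow> complex"
  assumes \<phi>: "continuous_on (cball 0 1) \<phi>" "inj_on \<phi> (cball 0 1)"
    and S: "a \<in> S1" "b \<in> S1" "c \<in> S1" and ccw: "ccw a b c"
    and g1: "path g1" "path_image g1 \<subseteq> \<phi> ` cball 0 1 - {\<phi> c}" "pathstart g1 = \<phi> a" "pathfinish g1 = \<phi> b"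
    and g2: "path g2" "path_image g2 \<subseteq> \<phi> ` cball 0 1 - {\<phi> a}" "pathstart g2 = \<phi> b" "pathfinish g2 = \<phi> c"
    and g3: "path g3" "path_image g3 \<subseteq> \<phi> ` cball 0 1 - {\<phi> b}" "pathstart g3 = \<phi> c" "pathfinish g3 = \<phi> a"
  shows "2 * (winding_number g1 (\<phi> c) + winding_number g2 (\<phi> a) + winding_number g3 (\<phi> b))
     = winding_number (\<phi> \<circ> circ) (\<phi> 0)"
proof -
  note d = ccw_distinct[OF ccw]
  define C where "C = {(u::complex,v). u \<in> cball 0 1 \<and> v \<in> cball 0 1 \<and> u \<noteq> v}"
  let ?L = "swap_loop a b c" and ?G = "\<lambda>(u,v). \<phi> u - \<phi> v" and ?H = "\<lambda>(u,v). ((u - v) / 2, 0::complex)"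
  have cb: "a \<in> cball 0 1" "b \<in> cball 0 1" "c \<in> cball 0 1" using S by (auto simp: S1_def)
  have sg: "closed_segment a b \<subseteq> cball 0 1 - {c}" "closed_segment b c \<subseteq> cball 0 1 - {a}"
    "closed_segment c a \<subseteq> cball 0 1 - {b}"
    using cb S d by (intro segment_S1_avoids; blast)+
  have *: "winding_number g1 (\<phi> c) = winding_number (\<phi> \<circ> linepath a b) (\<phi> c)"
    "winding_number g2 (\<phi> a) = winding_number (\<phi> \<circ> linepath b c) (\<phi> a)"
    "winding_number g3 (\<phi> b) = winding_number (\<phi> \<circ> linepath c a) (\<phi> b)"
    using sg by (intro winding_number_in_disk[OF \<phi>]; simp add: S g1 g2 g3)+
  have L: "path_image ?L \<subseteq> C" using swap_loop_image[OF S] d by (simp add: C_def)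
  have "homotopic_loops C ?L (?H \<circ> ?L)"
  proof (rule homotopic_loops_linear)
    show "path (?H \<circ> ?L)"
      by (rule path_continuous_image[OF path_swap_loop(1)]) (auto simp: case_prod_unfold intro!: continuous_intros)
    fix t :: real assume t: "t \<in> {0..1}"
    obtain u v where uv: "?L t = (u,v)" "u \<in> cball 0 1" "v \<in> cball 0 1" "u \<noteq> v"
      using L t by (force simp: path_image_def C_def)
    show "closed_segment (?L t) ((?H \<circ> ?L) t) \<subseteq> C"
    proof
      fix x assume "x \<in> closed_segment (?L t) ((?H \<circ> ?L) t)"
      then obtain r where r: "0 \<le> r" "r \<le> 1" "x = (1 - r) *\<^sub>R (u,v) + r *\<^sub>R ((u - v) / 2, 0)"
        using uv by (auto simp: closed_segment_def)
      have "fst x = (1 - r) *\<^sub>R u + r *\<^sub>R ((u - v) / 2)" "snd x = (1 - r) *\<^sub>R v" using r by auto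
      moreover have "(u - v) / 2 \<in> cball 0 1"
        using uv norm_triangle_ineq4[of u v] by (simp add: norm_divide)
      \<comment> \<open>The contraction keeps the two points distinct: it scales their difference by
        \<open>1 - r / 2\<close>, which stays at least 1/2.\<close>
      moreover have "fst x - snd x = (1 - r / 2) *\<^sub>R (u - v)"
        using r by (simp add: scaleR_conv_of_real field_simps)
      ultimately have "fst x \<in> cball 0 1" "snd x \<in> cball 0 1" "fst x \<noteq> snd x"
        using uv r convexD[OF convex_cball, of u 0 1 "(u - v) / 2" "1 - r" r]
          convexD[OF convex_cball, of v 0 1 "0" "1 - r" r] by auto
      then show "x \<in> C" by (auto simp: C_def case_prod_unfold)
    qed
  qed (use path_swap_loop in \<open>auto simp: pathstart_compose pathfinish_compose\<close>)
  then have "homotopic_loops (- {0}) (?G \<circ> ?L) (?G \<circ> (?H \<circ> ?L))"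
  proof (rule homotopic_loops_continuous_image)
    show "continuous_on C ?G"
      unfolding case_prod_unfold
      by (intro continuous_intros continuous_on_compose2[OF \<phi>(1)]) (auto simp: C_def)
    show "?G \<in> C \<rightarrow> - {0}"
      using \<phi>(2) by (auto simp: C_def inj_on_def)
  qed
  then have "winding_number (?G \<circ> ?L) 0 = winding_number (?G \<circ> (?H \<circ> ?L)) 0"
    by (rule winding_number_homotopic_loops)
  also have "?G \<circ> (?H \<circ> ?L) = (\<lambda>t. (\<phi> \<circ> ((\<lambda>(u,v). (u - v) / 2) \<circ> ?L)) t - \<phi> 0)"
    by (auto simp: fun_eq_iff case_prod_unfold)
  also have "winding_number \<dots> 0 = winding_number (\<phi> \<circ> ((\<lambda>(u,v). (u - v) / 2) \<circ> ?L)) (\<phi> 0)"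
    using winding_number_offset by metis
  also have "\<dots> = winding_number (\<phi> \<circ> circ) (\<phi> 0)"
  proof (rule winding_number_loop_in_disk[OF \<phi>])
    show "path ((\<lambda>(u,v). (u - v) / 2) \<circ> ?L)"
      by (rule path_continuous_image[OF path_swap_loop(1)]) (auto simp: case_prod_unfold intro!: continuous_intros)
    show "path_image ((\<lambda>(u,v). (u - v) / 2) \<circ> ?L) \<subseteq> cball 0 1 - {0}"
    proof -
      have "(u - v) / 2 \<in> cball 0 1 - {0}" if "(u,v) \<in> C" for u v
        using that norm_triangle_ineq4[of u v] by (auto simp: norm_divide C_def)
      then show ?thesis using L unfolding path_image_compose by fastforce
    qed
  qed (use half_swap_winding[OF S ccw] path_swap_loop in \<open>auto simp: pathstart_compose pathfinish_compose\<close>)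
  finally show ?thesis
    using swap_loop_winding(1)[OF \<phi> S] d by (simp add: * o_def)
qed

text \<open>The same three paths, running in the smaller disk, serve for both angle sums. If the
  order in the larger disk were reversed, the reversed paths would also have angle sum 1/2, but
  their winding numbers are the negatives of the first ones.\<close>

lemma ccw_nested_disks:
  fixes \<phi>1 \<phi>2 :: "complex \<Rightarrow> complex"
  assumes \<phi>1: "continuous_on (cball 0 1) \<phi>1" "inj_on \<phi>1 (cball 0 1)" "winding_number (\<phi>1 \<circ> circ) (\<phi>1 0) = 1"
    and \<phi>2: "continuous_on (cball 0 1) \<phi>2" "inj_on \<phi>2 (cball 0 1)" "winding_number (\<phi>2 \<circ> circ) (\<phi>2 0) = 1"
    and sub: "\<phi>1 ` cball 0 1 \<subseteq> \<phi>2 ` cball 0 1"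
    and S: "a1 \<in> S1" "b1 \<in> S1" "c1 \<in> S1" "a2 \<in> S1" "b2 \<in> S1" "c2 \<in> S1"
    and eq: "\<phi>1 a1 = \<phi>2 a2" "\<phi>1 b1 = \<phi>2 b2" "\<phi>1 c1 = \<phi>2 c2"
    and ccw: "ccw a1 b1 c1"
  shows "ccw a2 b2 c2"
proof (rule ccontr)
  assume "\<not> ccw a2 b2 c2"
  note d = ccw_distinct[OF ccw]
  have cb: "a1 \<in> cball 0 1" "b1 \<in> cball 0 1" "c1 \<in> cball 0 1" using S by (auto simp: S1_def)
  have "a2 \<noteq> b2" "b2 \<noteq> c2" "a2 \<noteq> c2"
    using d eq inj_onD[OF \<phi>1(2)] cb by metis+
  then have ccw2: "ccw a2 c2 b2"
    using ccw_total[of a2 b2 c2] S \<open>\<not> ccw a2 b2 c2\<close> by blast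
  have sg: "closed_segment a1 b1 \<subseteq> cball 0 1 - {c1}" "closed_segment b1 c1 \<subseteq> cball 0 1 - {a1}"
    "closed_segment c1 a1 \<subseteq> cball 0 1 - {b1}"
    using cb S d by (intro segment_S1_avoids; blast)+
  define g where "g p q = \<phi>1 \<circ> linepath p q" for p q
  have gp: "path (g p q)" if "p \<in> cball 0 1" "q \<in> cball 0 1" for p q
    unfolding g_def
    by (rule path_continuous_image) (use that closed_segment_subset[OF that convex_cball] \<phi>1 in \<open>auto intro: continuous_on_subset\<close>)
  have ge: "pathstart (g p q) = \<phi>1 p" "pathfinish (g p q) = \<phi>1 q" for p q
    by (auto simp: g_def pathstart_compose pathfinish_compose)
  have gi: "path_image (g p q) \<subseteq> \<phi>1 ` cball 0 1 - {\<phi>1 r}" if "closed_segment p q \<subseteq> cball 0 1 - {r}" "r \<in> cball 0 1" for p q r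
  proof
    fix y assume "y \<in> path_image (g p q)"
    then obtain x where x: "x \<in> closed_segment p q" "y = \<phi>1 x"
      by (auto simp: g_def path_image_compose)
    with that have "x \<in> cball 0 1" "x \<noteq> r" by blast+
    with x that inj_onD[OF \<phi>1(2)] show "y \<in> \<phi>1 ` cball 0 1 - {\<phi>1 r}" by blast
  qed
  have G1: "path_image (g a1 b1) \<subseteq> \<phi>1 ` cball 0 1 - {\<phi>1 c1}" "path_image (g b1 c1) \<subseteq> \<phi>1 ` cball 0 1 - {\<phi>1 a1}"
    "path_image (g c1 a1) \<subseteq> \<phi>1 ` cball 0 1 - {\<phi>1 b1}"
    using gi[OF sg(1) cb(3)] gi[OF sg(2) cb(1)] gi[OF sg(3) cb(2)] by auto
  then have G2: "path_image (g a1 b1) \<subseteq> \<phi>2 ` cball 0 1 - {\<phi>2 c2}" "path_image (g b1 c1) \<subseteq> \<phi>2 ` cball 0 1 - {\<phi>2 a2}"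
    "path_image (g c1 a1) \<subseteq> \<phi>2 ` cball 0 1 - {\<phi>2 b2}"
    using sub eq by auto
  have P: "path (g a1 b1)" "path (g b1 c1)" "path (g c1 a1)" using gp cb by blast+
  have 1: "2 * (winding_number (g a1 b1) (\<phi>1 c1) + winding_number (g b1 c1) (\<phi>1 a1) + winding_number (g c1 a1) (\<phi>1 b1)) = 1"
    unfolding \<phi>1(3)[symmetric]
    by (rule angle_sum_disk[OF \<phi>1(1,2) S(1,2,3) ccw]; rule P G1 ge)
  have 2: "2 * (winding_number (reversepath (g c1 a1)) (\<phi>2 b2) + winding_number (reversepath (g b1 c1)) (\<phi>2 a2)
        + winding_number (reversepath (g a1 b1)) (\<phi>2 c2)) = 1"
    unfolding \<phi>2(3)[symmetric]
    by (rule angle_sum_disk[OF \<phi>2(1,2) S(4,6,5) ccw2];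
        simp only: path_reversepath path_image_reversepath pathstart_reversepath pathfinish_reversepath P G2 ge eq)
  have n: "\<phi>2 c2 \<notin> path_image (g a1 b1)" "\<phi>2 a2 \<notin> path_image (g b1 c1)" "\<phi>2 b2 \<notin> path_image (g c1 a1)"
    using G2 by auto
  have "winding_number (reversepath (g c1 a1)) (\<phi>2 b2) = - winding_number (g c1 a1) (\<phi>1 b1)"
    "winding_number (reversepath (g b1 c1)) (\<phi>2 a2) = - winding_number (g b1 c1) (\<phi>1 a1)"
    "winding_number (reversepath (g a1 b1)) (\<phi>2 c2) = - winding_number (g a1 b1) (\<phi>1 c1)"
    using n P eq by (simp_all add: winding_number_reversepath)
  note r = this
  have "(2::complex) = 2 * (winding_number (g a1 b1) (\<phi>1 c1) + winding_number (g b1 c1) (\<phi>1 a1) + winding_number (g c1 a1) (\<phi>1 b1))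
     + 2 * (- winding_number (g c1 a1) (\<phi>1 b1) + - winding_number (g b1 c1) (\<phi>1 a1) + - winding_number (g a1 b1) (\<phi>1 c1))"
    unfolding 1 2[unfolded r] by simp
  also have "\<dots> = 0" by (simp add: algebra_simps)
  finally show False by simp
qed

text \<open>The radii to three common boundary points form a theta graph.\<close>

lemma ccw_adjacent_disks:
  fixes \<phi>1 \<phi>2 :: "complex \<Rightarrow> complex"
  assumes \<phi>1: "continuous_on (cball 0 1) \<phi>1" "inj_on \<phi>1 (cball 0 1)" "winding_number (\<phi>1 \<circ> circ) (\<phi>1 0) = 1"
    and \<phi>2: "continuous_on (cball 0 1) \<phi>2" "inj_on \<phi>2 (cball 0 1)" "winding_number (\<phi>2 \<circ> circ) (\<phi>2 0) = 1"
    and dis: "\<And>u v. u \<in> cball 0 1 \<Longrightarrow> v \<in> cball 0 1 \<Longrightarrow> \<phi>1 u = \<phi>2 v \<Longrightarrow> u \<in> S1 \<and> v \<in> S1"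
    and S: "a1 \<in> S1" "b1 \<in> S1" "c1 \<in> S1" "a2 \<in> S1" "b2 \<in> S1" "c2 \<in> S1"
    and eq: "\<phi>1 a1 = \<phi>2 a2" "\<phi>1 b1 = \<phi>2 b2" "\<phi>1 c1 = \<phi>2 c2"
    and ccw: "ccw a1 b1 c1"
  shows "\<not> ccw a2 b2 c2"
proof
  assume ccw2: "ccw a2 b2 c2"
  have arc_r: "Path_Connected.arc (\<phi> \<circ> linepath 0 p)" "path (\<phi> \<circ> linepath 0 p)"
      "pathstart (\<phi> \<circ> linepath 0 p) = \<phi> 0" "pathfinish (\<phi> \<circ> linepath 0 p) = \<phi> p"
      "path_image (\<phi> \<circ> linepath 0 p) = \<phi> ` closed_segment 0 p"
    if "continuous_on (cball 0 1) \<phi>" "inj_on \<phi> (cball 0 1)" "p \<in> S1" for \<phi> :: "complex \<Rightarrow> complex" and p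
  proof -
    have s: "closed_segment 0 p \<subseteq> cball 0 1"
      by (rule closed_segment_subset) (use that in \<open>auto simp: S1_def\<close>)
    have "0 \<noteq> p" using that by (auto simp: S1_def)
    have c: "continuous_on (path_image (linepath 0 p)) \<phi>"
      using that s by (auto intro: continuous_on_subset)
    show "path (\<phi> \<circ> linepath 0 p)" by (rule path_continuous_image[OF _ c]) simp
    then show "Path_Connected.arc (\<phi> \<circ> linepath 0 p)"
      unfolding Path_Connected.arc_def
      using inj_on_subset[OF that(2) s] inj_on_linepath[OF \<open>0 \<noteq> p\<close>]
      by (intro conjI comp_inj_on) (simp_all only: linepath_image_01)
    show "path_image (\<phi> \<circ> linepath 0 p) = \<phi> ` closed_segment 0 p" by (simp add: path_image_compose)
  qed (auto simp: pathstart_compose pathfinish_compose)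
  have cb: "p \<in> cball 0 1" if "p \<in> S1" for p using that by (auto simp: S1_def)
  have segcb: "closed_segment 0 p \<subseteq> cball 0 1" if "p \<in> S1" for p
    by (rule closed_segment_subset) (use that in \<open>auto simp: S1_def\<close>)
  have segS: "closed_segment 0 p \<inter> S1 = {p}" if "p \<in> S1" for p
  proof (intro equalityI subsetI)
    fix x assume x: "x \<in> closed_segment 0 p \<inter> S1"
    then obtain u where u: "0 \<le> u" "x = u *\<^sub>R p" by (auto simp: in_segment)
    with x \<open>p \<in> S1\<close> have "u = 1" by (simp add: S1_def)
    with u show "x \<in> {p}" by simp
  qed (use that in auto)
  have seg2: "closed_segment 0 p \<inter> closed_segment 0 q = {0}" if "p \<in> S1" "q \<in> S1" "p \<noteq> q" for p q
  proof (intro equalityI subsetI)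
    fix x assume "x \<in> closed_segment 0 p \<inter> closed_segment 0 q"
    then have x: "x \<in> closed_segment 0 p" "x \<in> closed_segment 0 q" by auto
    from x(1) obtain u where u: "0 \<le> u" "x = u *\<^sub>R p" by (auto simp: in_segment)
    from x(2) obtain v where v: "0 \<le> v" "x = v *\<^sub>R q" by (auto simp: in_segment)
    have "norm x = u" unfolding u(2) using u(1) that by (simp add: S1_def)
    moreover have "norm x = v" unfolding v(2) using v(1) that by (simp add: S1_def)
    ultimately have "u = v" by simp
    then have "u *\<^sub>R (p - q) = 0" using u(2) v(2) by (auto simp: scaleR_diff_right)
    then show "x \<in> {0}" using u that by auto
  qed simp
  define r1 where "r1 p = \<phi>1 \<circ> linepath 0 p" for p
  define r2 where "r2 p = \<phi>2 \<circ> linepath 0 p" for p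
  note R1 = arc_r[OF \<phi>1(1,2), folded r1_def] and R2 = arc_r[OF \<phi>2(1,2), folded r2_def]
  \<comment> \<open>An arc of the theta graph: from the centre of one disk to that of the other,
    through a common boundary point.\<close>
  define \<alpha> where "\<alpha> p q = r1 p +++ reversepath (r2 q)" for p q
  have inj1: "\<phi>1 u = \<phi>1 v \<longleftrightarrow> u = v" "\<phi>2 u = \<phi>2 v \<longleftrightarrow> u = v" if "u \<in> cball 0 1" "v \<in> cball 0 1" for u v
    using \<phi>1(2) \<phi>2(2) that by (auto simp: inj_on_def)
  have r12: "path_image (r1 p) \<inter> path_image (r2 q) \<subseteq> {\<phi>1 p} \<inter> {\<phi>2 q}" if pq: "p \<in> S1" "q \<in> S1" for p q
  proof
    fix x assume "x \<in> path_image (r1 p) \<inter> path_image (r2 q)"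
    then obtain u v where uv: "u \<in> closed_segment 0 p" "v \<in> closed_segment 0 q" "x = \<phi>1 u" "x = \<phi>2 v"
      using R1(5)[OF pq(1)] R2(5)[OF pq(2)] by auto
    then have "u \<in> cball 0 1" "v \<in> cball 0 1" using segcb pq by blast+
    then have "u \<in> S1" "v \<in> S1" using dis[of u v] uv by auto
    then have "u = p" "v = q" using segS pq uv by blast+
    then show "x \<in> {\<phi>1 p} \<inter> {\<phi>2 q}" using uv by blast
  qed
  have r11: "path_image (r1 p) \<inter> path_image (r1 q) = {\<phi>1 0}" if "p \<in> S1" "q \<in> S1" "p \<noteq> q" for p q
    unfolding R1(5)[OF that(1)] R1(5)[OF that(2)]
    using seg2[OF that] inj_on_image_Int[OF \<phi>1(2) segcb segcb, of p q] that by simp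
  have r22: "path_image (r2 p) \<inter> path_image (r2 q) = {\<phi>2 0}" if "p \<in> S1" "q \<in> S1" "p \<noteq> q" for p q
    unfolding R2(5)[OF that(1)] R2(5)[OF that(2)]
    using seg2[OF that] inj_on_image_Int[OF \<phi>2(2) segcb segcb, of p q] that by simp
  have o12: "\<phi>1 0 \<noteq> \<phi>2 0" using dis[of 0 0] by (auto simp: S1_def)
  have A: "simple_path (\<alpha> p q)" "pathstart (\<alpha> p q) = \<phi>1 0" "pathfinish (\<alpha> p q) = \<phi>2 0"
    "path_image (\<alpha> p q) = path_image (r1 p) \<union> path_image (r2 q)"
    "\<phi>1 p \<in> path_image (\<alpha> p q) - {\<phi>1 0, \<phi>2 0}"
    "\<And>z. z \<notin> path_image (\<alpha> p q) \<Longrightarrow> winding_number (\<alpha> p q) z = winding_number (r1 p) z - winding_number (r2 q) z"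
    if pq: "p \<in> S1" "q \<in> S1" "\<phi>1 p = \<phi>2 q" for p q
  proof -
    have j: "pathfinish (r1 p) = pathstart (reversepath (r2 q))" using R1(4) R2(4) pq by simp
    show im: "path_image (\<alpha> p q) = path_image (r1 p) \<union> path_image (r2 q)"
      unfolding \<alpha>_def using j by (simp add: path_image_join)
    show "pathstart (\<alpha> p q) = \<phi>1 0" "pathfinish (\<alpha> p q) = \<phi>2 0"
      using R1(3)[OF pq(1)] R2(3)[OF pq(2)] by (simp_all add: \<alpha>_def)
    show "simple_path (\<alpha> p q)"
      unfolding \<alpha>_def
      by (rule arc_imp_simple_path, rule arc_join)
         (use R1[OF pq(1)] R2[OF pq(2)] j r12[OF pq(1,2)] in \<open>auto simp: arc_reversepath\<close>)
    have "\<phi>1 p \<in> path_image (\<alpha> p q)" using im R1(5)[OF pq(1)] by simp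
    moreover have "\<phi>1 p \<noteq> \<phi>1 0" "\<phi>2 q \<noteq> \<phi>2 0"
      using inj1[of p 0] inj1[of q 0] cb pq by (auto simp: S1_def)
    ultimately show "\<phi>1 p \<in> path_image (\<alpha> p q) - {\<phi>1 0, \<phi>2 0}" using pq by auto
    show "winding_number (\<alpha> p q) z = winding_number (r1 p) z - winding_number (r2 q) z"
      if "z \<notin> path_image (\<alpha> p q)" for z
      using that im j R1(2)[OF pq(1)] R2(2)[OF pq(2)] unfolding \<alpha>_def
      by (simp add: winding_number_join winding_number_reversepath)
  qed
  have A2: "path_image (\<alpha> p q) \<inter> path_image (\<alpha> p' q') = {\<phi>1 0, \<phi>2 0}"
    if pq: "p \<in> S1" "q \<in> S1" "\<phi>1 p = \<phi>2 q" "p' \<in> S1" "q' \<in> S1" "\<phi>1 p' = \<phi>2 q'" "p \<noteq> p'" "q \<noteq> q'" for p q p' q'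
  proof -
    have ne: "\<phi>1 p \<noteq> \<phi>2 q'" "\<phi>1 p' \<noteq> \<phi>2 q"
      using pq inj1(1)[OF cb cb, of p p'] by auto
    have "path_image (r1 p) \<inter> path_image (r2 q') = {}" "path_image (r1 p') \<inter> path_image (r2 q) = {}"
      using r12[OF pq(1,5)] r12[OF pq(4,2)] ne by auto
    then show ?thesis
      unfolding A(4)[OF pq(1,2,3)] A(4)[OF pq(4,5,6)]
      using r11[OF pq(1,4,7)] r22[OF pq(2,5,8)] by blast
  qed
  note d = ccw_distinct[OF ccw] and d2 = ccw_distinct[OF ccw2]
  have dd: "a1 \<noteq> b1" "b1 \<noteq> a1" "b1 \<noteq> c1" "c1 \<noteq> b1" "a1 \<noteq> c1" "c1 \<noteq> a1"
    and dd2: "a2 \<noteq> b2" "b2 \<noteq> a2" "b2 \<noteq> c2" "c2 \<noteq> b2" "a2 \<noteq> c2" "c2 \<noteq> a2"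
    using d d2 by auto
  have th: "(winding_number (\<alpha> a1 a2) (\<phi>1 c1) - winding_number (\<alpha> b1 b2) (\<phi>1 c1))
     + (winding_number (\<alpha> b1 b2) (\<phi>1 a1) - winding_number (\<alpha> c1 c2) (\<phi>1 a1))
     + (winding_number (\<alpha> c1 c2) (\<phi>1 b1) - winding_number (\<alpha> a1 a2) (\<phi>1 b1)) \<noteq> 0"
    by (rule theta_winding_sum[of _ "\<phi>1 0" "\<phi>2 0"];
        rule A(1,2,3,5)[OF S(1,4) eq(1)] A(1,2,3,5)[OF S(2,5) eq(2)] A(1,2,3,5)[OF S(3,6) eq(3)] o12
          A2[OF S(1,4) eq(1) S(2,5) eq(2) dd(1) dd2(1)] A2[OF S(1,4) eq(1) S(3,6) eq(3) dd(5) dd2(5)]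
          A2[OF S(2,5) eq(2) S(3,6) eq(3) dd(3) dd2(3)])
  have out1: "\<phi>1 q \<notin> path_image (r1 p)" if "p \<in> S1" "q \<in> S1" "p \<noteq> q" for p q
    using that segS[OF that(1)] inj1(1)[of q] segcb[OF that(1)] cb[OF that(2)] unfolding R1(5)[OF that(1)] by blast
  have out2: "\<phi>2 q \<notin> path_image (r2 p)" if "p \<in> S1" "q \<in> S1" "p \<noteq> q" for p q
    using that segS[OF that(1)] inj1(2)[of q] segcb[OF that(1)] cb[OF that(2)] unfolding R2(5)[OF that(1)] by blast
  have J1: "path (reversepath (r1 p) +++ r1 q)" "pathstart (reversepath (r1 p) +++ r1 q) = \<phi>1 p"
      "pathfinish (reversepath (r1 p) +++ r1 q) = \<phi>1 q"
      "path_image (reversepath (r1 p) +++ r1 q) \<subseteq> \<phi>1 ` cball 0 1 - {\<phi>1 s}"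
    if "p \<in> S1" "q \<in> S1" "s \<in> S1" "p \<noteq> s" "q \<noteq> s" for p q s
  proof -
    show "path_image (reversepath (r1 p) +++ r1 q) \<subseteq> \<phi>1 ` cball 0 1 - {\<phi>1 s}"
      using out1[of p s] out1[of q s] that R1[OF that(1)] R1[OF that(2)] segcb[OF that(1)] segcb[OF that(2)]
      by (simp add: path_image_join) blast
  qed (use R1[OF that(1)] R1[OF that(2)] in simp_all)
  have J2: "path (reversepath (r2 p) +++ r2 q)" "pathstart (reversepath (r2 p) +++ r2 q) = \<phi>2 p"
      "pathfinish (reversepath (r2 p) +++ r2 q) = \<phi>2 q"
      "path_image (reversepath (r2 p) +++ r2 q) \<subseteq> \<phi>2 ` cball 0 1 - {\<phi>2 s}"
    if "p \<in> S1" "q \<in> S1" "s \<in> S1" "p \<noteq> s" "q \<noteq> s" for p q s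
  proof -
    show "path_image (reversepath (r2 p) +++ r2 q) \<subseteq> \<phi>2 ` cball 0 1 - {\<phi>2 s}"
      using out2[of p s] out2[of q s] that R2[OF that(1)] R2[OF that(2)] segcb[OF that(1)] segcb[OF that(2)]
      by (simp add: path_image_join) blast
  qed (use R2[OF that(1)] R2[OF that(2)] in simp_all)
  have sum1: "2 * (winding_number (reversepath (r1 a1) +++ r1 b1) (\<phi>1 c1)
      + winding_number (reversepath (r1 b1) +++ r1 c1) (\<phi>1 a1)
      + winding_number (reversepath (r1 c1) +++ r1 a1) (\<phi>1 b1)) = 1"
    unfolding \<phi>1(3)[symmetric]
    by (rule angle_sum_disk[OF \<phi>1(1,2) S(1,2,3) ccw];
        rule J1[OF S(1,2,3) dd(5) dd(3)] J1[OF S(2,3,1) dd(2) dd(6)] J1[OF S(3,1,2) dd(4) dd(1)])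
  have sum2: "2 * (winding_number (reversepath (r2 a2) +++ r2 b2) (\<phi>2 c2)
      + winding_number (reversepath (r2 b2) +++ r2 c2) (\<phi>2 a2)
      + winding_number (reversepath (r2 c2) +++ r2 a2) (\<phi>2 b2)) = 1"
    unfolding \<phi>2(3)[symmetric]
    by (rule angle_sum_disk[OF \<phi>2(1,2) S(4,5,6) ccw2];
        rule J2[OF S(4,5,6) dd2(5) dd2(3)] J2[OF S(5,6,4) dd2(2) dd2(6)] J2[OF S(6,4,5) dd2(4) dd2(1)])
  have w1: "winding_number (reversepath (r1 p) +++ r1 q) (\<phi>1 s) = winding_number (r1 q) (\<phi>1 s) - winding_number (r1 p) (\<phi>1 s)"
    if "p \<in> S1" "q \<in> S1" "s \<in> S1" "s \<noteq> p" "s \<noteq> q" for p q s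
    using that R1[OF that(1)] R1[OF that(2)] out1[of p s] out1[of q s]
    by (simp add: winding_number_join winding_number_reversepath)
  have w2: "winding_number (reversepath (r2 p) +++ r2 q) (\<phi>2 s) = winding_number (r2 q) (\<phi>2 s) - winding_number (r2 p) (\<phi>2 s)"
    if "p \<in> S1" "q \<in> S1" "s \<in> S1" "s \<noteq> p" "s \<noteq> q" for p q s
    using that R2[OF that(1)] R2[OF that(2)] out2[of p s] out2[of q s]
    by (simp add: winding_number_join winding_number_reversepath)
  have wA: "winding_number (\<alpha> p q) (\<phi>1 s) = winding_number (r1 p) (\<phi>1 s) - winding_number (r2 q) (\<phi>2 t)"
    if "p \<in> S1" "q \<in> S1" "\<phi>1 p = \<phi>2 q" "s \<in> S1" "t \<in> S1" "\<phi>1 s = \<phi>2 t" "p \<noteq> s" "q \<noteq> t" for p q s t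
    using A(6)[OF that(1,2,3), of "\<phi>1 s"] A(4)[OF that(1,2,3)] out1[OF that(1,4,7)] out2[OF that(2,5,8)] that by auto
  have s1: "(winding_number (r1 b1) (\<phi>1 c1) - winding_number (r1 a1) (\<phi>1 c1))
      + (winding_number (r1 c1) (\<phi>1 a1) - winding_number (r1 b1) (\<phi>1 a1))
      + (winding_number (r1 a1) (\<phi>1 b1) - winding_number (r1 c1) (\<phi>1 b1)) = 1/2" (is "?s1 = _")
    using sum1 S dd by (simp add: w1 field_simps)
  have s2: "(winding_number (r2 b2) (\<phi>2 c2) - winding_number (r2 a2) (\<phi>2 c2))
      + (winding_number (r2 c2) (\<phi>2 a2) - winding_number (r2 b2) (\<phi>2 a2))
      + (winding_number (r2 a2) (\<phi>2 b2) - winding_number (r2 c2) (\<phi>2 b2)) = 1/2" (is "?s2 = _")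
    using sum2 S dd2 by (simp add: w2 field_simps)
  have e: "winding_number (\<alpha> a1 a2) (\<phi>1 c1) = winding_number (r1 a1) (\<phi>1 c1) - winding_number (r2 a2) (\<phi>2 c2)"
    "winding_number (\<alpha> b1 b2) (\<phi>1 c1) = winding_number (r1 b1) (\<phi>1 c1) - winding_number (r2 b2) (\<phi>2 c2)"
    "winding_number (\<alpha> b1 b2) (\<phi>1 a1) = winding_number (r1 b1) (\<phi>1 a1) - winding_number (r2 b2) (\<phi>2 a2)"
    "winding_number (\<alpha> c1 c2) (\<phi>1 a1) = winding_number (r1 c1) (\<phi>1 a1) - winding_number (r2 c2) (\<phi>2 a2)"
    "winding_number (\<alpha> c1 c2) (\<phi>1 b1) = winding_number (r1 c1) (\<phi>1 b1) - winding_number (r2 c2) (\<phi>2 b2)"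
    "winding_number (\<alpha> a1 a2) (\<phi>1 b1) = winding_number (r1 a1) (\<phi>1 b1) - winding_number (r2 a2) (\<phi>2 b2)"
    by (rule wA; rule S eq dd dd2)+
  \<comment> \<open>Each arc winds like its first radius minus its second one, so the theta sum is
    the difference of the two angle sums. With equal orders both are 1/2 and the sum would
    vanish.\<close>
  have "(winding_number (\<alpha> a1 a2) (\<phi>1 c1) - winding_number (\<alpha> b1 b2) (\<phi>1 c1))
     + (winding_number (\<alpha> b1 b2) (\<phi>1 a1) - winding_number (\<alpha> c1 c2) (\<phi>1 a1))
     + (winding_number (\<alpha> c1 c2) (\<phi>1 b1) - winding_number (\<alpha> a1 a2) (\<phi>1 b1)) = ?s2 - ?s1"
    unfolding e by (simp add: algebra_simps)
  with th s1 s2 show False by simp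
qed

subsection \<open>Stereographic charts and disks in the sphere\<close>

lemma dot_cross_cross:
  fixes a b c d :: "real^3"
  shows "cross3 a b \<bullet> cross3 c d = (a \<bullet> c) * (b \<bullet> d) - (a \<bullet> d) * (b \<bullet> c)"
  by (simp add: cross3_simps)

lemma cross_cross_left:
  fixes a b c :: "real^3"
  shows "cross3 (cross3 a b) c = (a \<bullet> c) *\<^sub>R b - (b \<bullet> c) *\<^sub>R a"
  by (simp add: cross3_simps forall_3)

text \<open>Gram determinant of \<open>x, a, b\<close> against \<open>y, a, b\<close>. For
  orthonormal \<open>a\<close> and \<open>b\<close> it expands \<open>x \<bullet> y\<close> in the
  frame \<open>a\<close>, \<open>b\<close>, \<open>cross3 a b\<close>.\<close>

lemma dot_cross_square:
  fixes x y a b :: "real^3"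
  shows "(x \<bullet> cross3 a b) * (y \<bullet> cross3 a b)
    = (x \<bullet> y) * ((a \<bullet> a) * (b \<bullet> b) - (a \<bullet> b)\<^sup>2)
      - (x \<bullet> a) * ((y \<bullet> a) * (b \<bullet> b) - (y \<bullet> b) * (a \<bullet> b))
      + (x \<bullet> b) * ((y \<bullet> a) * (a \<bullet> b) - (y \<bullet> b) * (a \<bullet> a))"
  unfolding power2_eq_square by (simp add: cross3_simps)

lemma pos_chart_frame:
  assumes "pos_chart N u v"
  shows "norm N = 1" "u \<bullet> u = 1" "v \<bullet> v = 1" "N \<bullet> N = 1" "u \<bullet> v = 0" "u \<bullet> N = 0" "v \<bullet> N = 0"
    "cross3 v u = N" "cross3 N v = u" "cross3 u N = v"
    "\<And>x y. x \<bullet> y = (x \<bullet> u) * (y \<bullet> u) + (x \<bullet> v) * (y \<bullet> v) + (x \<bullet> N) * (y \<bullet> N)"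
proof -
  show 1: "norm N = 1" "u \<bullet> u = 1" "v \<bullet> v = 1" "N \<bullet> N = 1" "u \<bullet> v = 0" "u \<bullet> N = 0" "v \<bullet> N = 0"
    "cross3 v u = N"
    using assms by (auto simp: pos_chart_def S2_def dot_square_norm)
  show "cross3 N v = u"
    using cross_cross_left[of v u v] 1 by simp
  show "cross3 u N = v"
    using cross_cross_left[of v u u] cross_skew[of u N] 1 by (simp add: inner_commute)
  show "x \<bullet> y = (x \<bullet> u) * (y \<bullet> u) + (x \<bullet> v) * (y \<bullet> v) + (x \<bullet> N) * (y \<bullet> N)" for x y
    using dot_cross_square[of x v u y] 1 by (simp add: inner_commute algebra_simps)
qed

lemma inner_S2_eq_1:
  fixes x N :: "real^3"
  assumes "x \<in> S2" "N \<in> S2" "x \<noteq> N"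
  shows "x \<bullet> N < 1"
proof -
  have n: "x \<bullet> x = 1" "N \<bullet> N = 1" using assms by (simp_all add: S2_def dot_square_norm)
  have "0 < (x - N) \<bullet> (x - N)" using assms by simp
  also have "(x - N) \<bullet> (x - N) = 2 - 2 * (x \<bullet> N)"
    using n by (simp add: inner_diff_left inner_diff_right inner_commute)
  finally show ?thesis by simp
qed

lemma stereo_eq_complex:
  "stereo N u v x = (complex_of_real (x \<bullet> u) + \<i> * complex_of_real (x \<bullet> v)) / complex_of_real (1 - x \<bullet> N)"
  by (simp add: stereo_def complex_eq_iff)

lemma continuous_on_stereo:
  assumes "N \<in> S2" "D \<subseteq> S2 - {N}"
  shows "continuous_on D (stereo N u v)"
  unfolding stereo_eq_complex
  by (intro continuous_intros) (use inner_S2_eq_1 assms in force)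

lemma inj_on_stereo:
  assumes c: "pos_chart N u v"
  shows "inj_on (stereo N u v) (S2 - {N})"
proof (rule inj_onI)
  fix x y assume x: "x \<in> S2 - {N}" and y: "y \<in> S2 - {N}" and eq: "stereo N u v x = stereo N u v y"
  note F = pos_chart_frame[OF c]
  have NS: "N \<in> S2" using c by (simp add: pos_chart_def)
  define a b where "a = 1 - x \<bullet> N" and "b = 1 - y \<bullet> N"
  have ab: "a > 0" "b > 0" using inner_S2_eq_1[of _ N] x y NS by (auto simp: a_def b_def)
  have e: "(x \<bullet> u) * b = (y \<bullet> u) * a" "(x \<bullet> v) * b = (y \<bullet> v) * a"
    using eq ab by (simp_all add: stereo_def a_def b_def field_simps)
  have "x \<bullet> x = 1" "y \<bullet> y = 1" using x y by (auto simp: S2_def dot_square_norm)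
  then have q: "(x \<bullet> u)\<^sup>2 + (x \<bullet> v)\<^sup>2 = a * (2 - a)" "(y \<bullet> u)\<^sup>2 + (y \<bullet> v)\<^sup>2 = b * (2 - b)"
    using F(11)[of x x] F(11)[of y y] by (auto simp: a_def b_def power2_eq_square algebra_simps)
  have "a * (2 - a) * b\<^sup>2 = ((x \<bullet> u) * b)\<^sup>2 + ((x \<bullet> v) * b)\<^sup>2"
    unfolding q(1)[symmetric] by (simp add: power_mult_distrib algebra_simps)
  also have "\<dots> = b * (2 - b) * a\<^sup>2"
    unfolding e q(2)[symmetric] by (simp add: power_mult_distrib algebra_simps)
  finally have "(2 - a) * b = (2 - b) * a" using ab by (simp add: power2_eq_square)
  then have "a = b" by (simp add: algebra_simps)
  with e ab have "x \<bullet> u = y \<bullet> u" "x \<bullet> v = y \<bullet> v" "x \<bullet> N = y \<bullet> N" by (auto simp: a_def b_def)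
  then have "(x - y) \<bullet> (x - y) = 0" unfolding F(11)[of "x - y" "x - y"] by (simp add: inner_diff_left)
  then show "x = y" by simp
qed

text \<open>The transition between two positive charts is a Moebius map: it becomes affine after an
  inversion at the image of the second pole. No complex conjugate occurs, because both frames are
  positively oriented.\<close>

lemma stereo_transition:
  assumes c: "pos_chart N u v" and c': "pos_chart N' u' v'" and ne: "N \<noteq> N'"
  obtains A B where "\<And>x. x \<in> S2 - {N,N'} \<Longrightarrow>
      1 / (stereo N u v x - stereo N u v N') = A * stereo N' u' v' x + B"
proof
  note F = pos_chart_frame[OF c] and F' = pos_chart_frame[OF c']
  have NS: "N \<in> S2" "N' \<in> S2" using c c' by (auto simp: pos_chart_def)
  define n1 n2 n3 where "n1 = N' \<bullet> u" and "n2 = N' \<bullet> v" and "n3 = N' \<bullet> N"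
  have n3: "n3 < 1" using inner_S2_eq_1[of N' N] NS ne by (auto simp: n3_def)
  have nn: "n1\<^sup>2 + n2\<^sup>2 = (1 - n3) * (1 + n3)"
    using F(11)[of N' N'] F'(4) by (simp add: n1_def n2_def n3_def power2_eq_square algebra_simps)
  let ?Pu = "Complex ((u \<bullet> u') * (1 - n3) + n1 * (N \<bullet> u')) (- (v \<bullet> u') * (1 - n3) - n2 * (N \<bullet> u'))"
  fix x assume x: "x \<in> S2 - {N,N'}"
  define x1 x2 x3 where "x1 = x \<bullet> u" and "x2 = x \<bullet> v" and "x3 = x \<bullet> N"
  define y1 y2 y3 where "y1 = x \<bullet> u'" and "y2 = x \<bullet> v'" and "y3 = x \<bullet> N'"
  have x3: "x3 < 1" and y3: "y3 < 1"
    using inner_S2_eq_1[of x N] inner_S2_eq_1[of x N'] NS x by (auto simp: x3_def y3_def)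
  have xx: "x1\<^sup>2 + x2\<^sup>2 = (1 - x3) * (1 + x3)"
    using F(11)[of x x] x by (simp add: x1_def x2_def x3_def power2_eq_square S2_def dot_square_norm algebra_simps)
  have xy: "y3 = x1 * n1 + x2 * n2 + x3 * n3"
    using F(11)[of x N'] by (simp add: x1_def x2_def x3_def n1_def n2_def n3_def y3_def)
  have exp: "x1 = y1 * (u \<bullet> u') + y2 * (u \<bullet> v') + y3 * n1" "x2 = y1 * (v \<bullet> u') + y2 * (v \<bullet> v') + y3 * n2"
    "x3 = y1 * (N \<bullet> u') + y2 * (N \<bullet> v') + y3 * n3"
    using F'(11)[of x u] F'(11)[of x v] F'(11)[of x N]
    by (simp_all add: x1_def x2_def x3_def y1_def y2_def y3_def n1_def n2_def n3_def inner_commute)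
  \<comment> \<open>The scalar products between the two frames form a rotation matrix, and its
    entries equal their cofactors. Here the orientation of the two charts enters.\<close>
  have cof: "v \<bullet> u' = n1 * (N \<bullet> v') - (u \<bullet> v') * n3" "u \<bullet> v' = (N \<bullet> u') * n2 - n3 * (v \<bullet> u')"
     "u \<bullet> u' = n3 * (v \<bullet> v') - (N \<bullet> v') * n2" "v \<bullet> v' = (u \<bullet> u') * n3 - n1 * (N \<bullet> u')"
    using dot_cross_cross[of u N N' v'] dot_cross_cross[of N v u' N'] dot_cross_cross[of N v N' v'] dot_cross_cross[of u N u' N']
    unfolding F(9,10) F'(9,10) n1_def n2_def n3_def by (simp_all only: inner_commute mult.commute)
  \<comment> \<open>The numerator of the difference of the two chart values. Its squared modulus is
    real and factors, so that its reciprocal is its conjugate over a real multiple of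
    \<open>1 - y3\<close>.\<close>
  define num where "num = Complex (x1 * (1 - n3) - n1 * (1 - x3)) (x2 * (1 - n3) - n2 * (1 - x3))"
  have w: "stereo N u v x - stereo N u v N' = num / complex_of_real ((1 - x3) * (1 - n3))"
    using x3 n3 by (simp add: stereo_def num_def complex_eq_iff x1_def[symmetric] x2_def[symmetric] x3_def[symmetric]
        n1_def[symmetric] n2_def[symmetric] n3_def[symmetric] field_simps)
  have "(cmod num)\<^sup>2 = (x1\<^sup>2 + x2\<^sup>2) * (1 - n3)\<^sup>2 + (n1\<^sup>2 + n2\<^sup>2) * (1 - x3)\<^sup>2 - 2 * (1 - n3) * (1 - x3) * (x1 * n1 + x2 * n2)"
    unfolding cmod_power2 num_def by (simp add: power2_eq_square algebra_simps)
  also have "\<dots> = 2 * (1 - x3) * (1 - n3) * (1 - y3)"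
    unfolding xx nn xy by (simp add: power2_eq_square algebra_simps)
  finally have nsq: "num * cnj num = complex_of_real (2 * (1 - x3) * (1 - n3) * (1 - y3))"
    by (simp add: complex_norm_square[symmetric] del: of_real_mult)
  have n0: "num \<noteq> 0" using nsq x3 n3 y3 by auto
  have "1 / (stereo N u v x - stereo N u v N') = complex_of_real ((1 - x3) * (1 - n3)) * cnj num / (num * cnj num)"
    unfolding w using n0 by simp
  also have "\<dots> = cnj num / complex_of_real (2 * (1 - y3))"
  proof -
    have "complex_of_real (2 * (1 - x3) * (1 - n3) * (1 - y3))
        = complex_of_real ((1 - x3) * (1 - n3)) * complex_of_real (2 * (1 - y3))"
      by (simp only: of_real_mult[symmetric] mult_ac)
    moreover have "complex_of_real ((1 - x3) * (1 - n3)) \<noteq> 0" using x3 n3 by simp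
    ultimately show ?thesis unfolding nsq by (metis nonzero_mult_divide_mult_cancel_left)
  qed
  also have "cnj num = ?Pu * Complex y1 y2 - Complex n1 (-n2) * complex_of_real (1 - y3)"
  proof -
    \<comment> \<open>\<open>a1\<close> and \<open>a2\<close> are Cauchy-Riemann relations: they
      allow the coefficients of \<open>y1\<close> and \<open>y2\<close> to be collected into
      multiplication by one complex number.\<close>
    have a1: "(u \<bullet> v') * (1 - n3) + n1 * (N \<bullet> v') = (v \<bullet> u') * (1 - n3) + n2 * (N \<bullet> u')"
    proof -
      have "(u \<bullet> v') * (1 - n3) = u \<bullet> v' - (u \<bullet> v') * n3" "(v \<bullet> u') * (1 - n3) = v \<bullet> u' - n3 * (v \<bullet> u')"
        by (simp_all add: algebra_simps)
      then show ?thesis using cof(1,2) mult.commute[of n2 "N \<bullet> u'"] by linarith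
    qed
    have a2: "- (v \<bullet> v') * (1 - n3) - n2 * (N \<bullet> v') = (u \<bullet> u') * (1 - n3) + n1 * (N \<bullet> u')"
    proof -
      have "- (v \<bullet> v') * (1 - n3) = - (v \<bullet> v') + n3 * (v \<bullet> v')" "(u \<bullet> u') * (1 - n3) = u \<bullet> u' - (u \<bullet> u') * n3"
        by (simp_all add: algebra_simps)
      then show ?thesis using cof(3,4) mult.commute[of n2 "N \<bullet> v'"] by linarith
    qed
    have "x1 * (1 - n3) - n1 * (1 - x3)
       = y1 * ((u \<bullet> u') * (1 - n3) + n1 * (N \<bullet> u')) + y2 * ((u \<bullet> v') * (1 - n3) + n1 * (N \<bullet> v')) - n1 * (1 - y3)"
      unfolding exp by (simp add: algebra_simps)
    moreover have "- (x2 * (1 - n3) - n2 * (1 - x3))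
       = y1 * (- (v \<bullet> u') * (1 - n3) - n2 * (N \<bullet> u')) + y2 * (- (v \<bullet> v') * (1 - n3) - n2 * (N \<bullet> v')) + n2 * (1 - y3)"
      unfolding exp by (simp add: algebra_simps)
    ultimately show ?thesis
      unfolding num_def complex_eq_iff a1 a2 by (simp add: algebra_simps)
  qed
  also have "(?Pu * Complex y1 y2 - Complex n1 (-n2) * complex_of_real (1 - y3)) / complex_of_real (2 * (1 - y3))
     = ?Pu / 2 * (Complex y1 y2 / complex_of_real (1 - y3)) + - Complex n1 (-n2) / 2"
    using y3 by (simp add: field_simps)
  also have "Complex y1 y2 / complex_of_real (1 - y3) = stereo N' u' v' x"
    by (simp add: stereo_def y1_def y2_def y3_def complex_eq_iff)
  finally show "1 / (stereo N u v x - stereo N u v N') = ?Pu / 2 * stereo N' u' v' x + - Complex n1 (-n2) / 2" .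
qed

lemma pos_chart_exists:
  assumes "N \<in> S2"
  obtains u v where "pos_chart N u v"
proof -
  obtain y :: "real^3" where y: "y \<noteq> 0" "orthogonal N y"
    using orthogonal_to_vector_exists[of N] by auto
  define u where "u = y /\<^sub>R norm y"
  have u: "norm u = 1" "u \<bullet> N = 0" "u \<bullet> u = 1"
    using y by (auto simp: u_def orthogonal_def inner_commute dot_square_norm)
  have N: "N \<bullet> N = 1" using assms by (simp add: S2_def dot_square_norm)
  define v where "v = cross3 u N"
  have "v \<bullet> v = 1" unfolding v_def dot_cross_cross using u N by (simp add: inner_commute)
  then have "norm v = 1" by (simp add: norm_eq_1)
  moreover have "u \<bullet> v = 0" "v \<bullet> N = 0" unfolding v_def by (simp_all add: dot_cross_self)
  moreover have "cross3 v u = N" unfolding v_def cross_cross_left using u by (simp add: inner_commute)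
  ultimately have "pos_chart N u v" using assms u by (simp add: pos_chart_def)
  then show ?thesis by (rule that)
qed

definition disk :: "(real^3) set \<Rightarrow> bool" where
  "disk D \<longleftrightarrow> D \<subseteq> S2 \<and> D homeomorphic cball (0::complex) 1"

lemma chart_disk:
  assumes "homeomorphism (cball 0 1) D h g" "D \<subseteq> S2" "pos_chart N u v" "N \<notin> D"
  shows "continuous_on (cball 0 1) (stereo N u v \<circ> h)" "inj_on (stereo N u v \<circ> h) (cball 0 1)"
proof -
  have NS: "N \<in> S2" using assms by (simp add: pos_chart_def)
  have h: "h ` cball 0 1 = D" "continuous_on (cball 0 1) h" "inj_on h (cball 0 1)"
    using assms(1) inj_on_inverseI[of _ g h] by (auto simp: homeomorphism_def)
  have sub: "D \<subseteq> S2 - {N}" using assms by auto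
  show "continuous_on (cball 0 1) (stereo N u v \<circ> h)"
    by (rule continuous_on_compose[OF h(2)]) (use continuous_on_stereo[OF NS sub] h in simp)
  show "inj_on (stereo N u v \<circ> h) (cball 0 1)"
    by (rule comp_inj_on[OF h(3)]) (use inj_on_subset[OF inj_on_stereo[OF assms(3)] sub] h in simp)
qed

lemma winding_number_disk_outside:
  assumes "continuous_on (cball 0 1) \<phi>" "z \<notin> \<phi> ` cball 0 1"
  shows "winding_number (\<phi> \<circ> circ) z = 0"
proof -
  have "homotopic_loops (cball 0 1) circ (\<lambda>t. 0)"
  proof (rule homotopic_loops_linear)
    show "closed_segment (circ t) 0 \<subseteq> cball 0 1" for t
      by (rule closed_segment_subset) (auto simp: circ_def)
  qed (use path_circ in \<open>simp_all add: pathstart_def pathfinish_def path_def\<close>)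
  then have "homotopic_loops (-{z}) (\<phi> \<circ> circ) (\<phi> \<circ> (\<lambda>t. 0))"
    by (rule homotopic_loops_continuous_image) (use assms in auto)
  then have "winding_number (\<phi> \<circ> circ) z = winding_number (\<phi> \<circ> (\<lambda>t. 0)) z"
    by (rule winding_number_homotopic_loops)
  also have "\<dots> = 0" unfolding o_def using assms by (intro winding_number_const) auto
  finally show ?thesis .
qed

text \<open>By the transition formula \<open>\<phi> x - \<phi> 0\<close> is a constant times
  \<open>(\<psi> x - \<psi> 0) * (\<phi> x - n)\<close>, where \<open>n\<close> is the image of the
  other pole. Winding numbers add, and the last factor contributes 0 because \<open>n\<close> lies
  outside the image of the disk.\<close>

lemma chart_independence_ne:
  assumes h: "homeomorphism (cball 0 1) D h g" and D: "D \<subseteq> S2"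
    and c: "pos_chart N u v" "N \<notin> D" and c': "pos_chart N' u' v'" "N' \<notin> D" and ne: "N \<noteq> N'"
  shows "winding_number (stereo N u v \<circ> h \<circ> circ) (stereo N u v (h 0))
       = winding_number (stereo N' u' v' \<circ> h \<circ> circ) (stereo N' u' v' (h 0))"
proof -
  define \<phi> \<psi> where "\<phi> = stereo N u v \<circ> h" and "\<psi> = stereo N' u' v' \<circ> h"
  note C = chart_disk[OF h D c, folded \<phi>_def] and C' = chart_disk[OF h D c', folded \<psi>_def]
  obtain A B where AB: "\<And>x. x \<in> S2 - {N,N'} \<Longrightarrow> 1 / (stereo N u v x - stereo N u v N') = A * stereo N' u' v' x + B"
    using stereo_transition[OF c(1) c'(1) ne] by blast
  define n where "n = stereo N u v N'"
  have hD: "h x \<in> D" if "x \<in> cball 0 1" for x using h that by (auto simp: homeomorphism_def)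
  have N': "N' \<in> S2" using c' by (simp add: pos_chart_def)
  have n: "\<phi> x \<noteq> n" if "x \<in> cball 0 1" for x
    using inj_onD[OF inj_on_stereo[OF c(1)], of "h x" N'] hD[OF that] D c c' N' ne
    by (auto simp: \<phi>_def n_def)
  have T: "1 / (\<phi> x - n) = A * \<psi> x + B" if "x \<in> cball 0 1" for x
    using AB[of "h x"] hD[OF that] D c c' by (auto simp: \<phi>_def \<psi>_def n_def)
  have T2: "(\<phi> 0 - \<phi> x) = A * (\<psi> x - \<psi> 0) * ((\<phi> x - n) * (\<phi> 0 - n))" if x: "x \<in> cball 0 1" for x
  proof -
    have "A * (\<psi> x - \<psi> 0) = 1 / (\<phi> x - n) - 1 / (\<phi> 0 - n)"
      using T[OF x] T[of 0] by (simp add: algebra_simps)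
    also have "\<dots> = (\<phi> 0 - \<phi> x) / ((\<phi> x - n) * (\<phi> 0 - n))"
      using n[OF x] n[of 0] by (simp add: field_simps)
    finally show ?thesis using n[OF x] n[of 0] by simp
  qed
  have S1cb: "circ t \<in> cball 0 1" "circ t \<noteq> 0" for t by (auto simp: circ_def)
  have A: "A \<noteq> 0"
    using T2[of 1] inj_onD[OF C(2), of 0 1] by auto
  have p1: "path (\<lambda>t. \<phi> (circ t) - n)" "path (\<lambda>t. \<psi> (circ t) - \<psi> 0)" "path (\<lambda>t. \<phi> (circ t) - \<phi> 0)"
    using path_circ(1) unfolding path_def
    by (intro continuous_intros continuous_on_compose2[OF C(1)] continuous_on_compose2[OF C'(1)]; use S1cb in auto)+
  have nz: "\<phi> (circ t) - n \<noteq> 0" "\<psi> (circ t) - \<psi> 0 \<noteq> 0" for t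
    using n[OF S1cb(1)] inj_onD[OF C'(2), of "circ t" 0] S1cb by auto
  let ?k = "- A * (\<phi> 0 - n)"
  have k: "?k \<noteq> 0" using A n[of 0] by simp
  have "winding_number (\<lambda>t. \<phi> (circ t) - \<phi> 0) 0 = winding_number (\<lambda>t. ?k * ((\<psi> (circ t) - \<psi> 0) * (\<phi> (circ t) - n))) 0"
  proof (rule winding_number_cong)
    fix t :: real
    show "\<phi> (circ t) - \<phi> 0 = ?k * ((\<psi> (circ t) - \<psi> 0) * (\<phi> (circ t) - n))"
      using T2[OF S1cb(1), of t] by (simp add: algebra_simps)
  qed
  also have "\<dots> = winding_number (\<lambda>t. ?k) 0 + winding_number (\<lambda>t. (\<psi> (circ t) - \<psi> 0) * (\<phi> (circ t) - n)) 0"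
    by (rule winding_number_times) (use k nz p1 in \<open>auto simp: path_image_def path_def intro!: continuous_intros\<close>)
  also have "\<dots> = winding_number (\<lambda>t. \<psi> (circ t) - \<psi> 0) 0 + winding_number (\<lambda>t. \<phi> (circ t) - n) 0"
    using winding_number_times[OF p1(2,1)] nz k by (simp add: winding_number_const path_image_def image_iff)
  also have "winding_number (\<lambda>t. \<phi> (circ t) - n) 0 = winding_number (\<phi> \<circ> circ) n"
    unfolding o_def using winding_number_offset by metis
  also have "\<dots> = 0"
    by (rule winding_number_disk_outside[OF C(1)]) (use n in blast)
  finally have "winding_number (\<phi> \<circ> circ) (\<phi> 0) = winding_number (\<psi> \<circ> circ) (\<psi> 0)"
    unfolding o_def using winding_number_offset by (metis add.right_neutral)
  then show ?thesis by (simp add: \<phi>_def \<psi>_def)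
qed

section \<open>Topology of closed disks in the sphere\<close>

lemma compact_disk: "disk D \<Longrightarrow> compact D"
  unfolding disk_def using homeomorphic_compactness compact_cball by blast

lemma disk_param: "disk D \<Longrightarrow> \<exists>h g. homeomorphism (cball (0::complex) 1) D h g"
  unfolding disk_def using homeomorphic_sym[of D] homeomorphic_def by blast

lemma connected_S2: "connected S2"
  unfolding S2_def by (rule connected_sphere) simp

lemma two_outside:
  assumes "compact D" "D \<subseteq> S2" "N \<in> S2" "N \<notin> D" "D \<noteq> {}"
  obtains N' where "N' \<in> S2" "N' \<notin> D" "N' \<noteq> N"
proof (rule ccontr)
  assume "\<not> thesis"
  then have "S2 = D \<union> {N}" using that assms by blast
  moreover have "closed D" "closed {N}" using assms compact_imp_closed by auto
  moreover have "connected S2" by (rule connected_S2)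
  ultimately show False
    using connected_closedD[of S2 D "{N}"] assms by auto
qed

text \<open>The transition formula needs different poles; two charts with the same pole are compared
  through a chart with another pole outside \<open>D\<close>.\<close>

lemma chart_independence:
  assumes h: "homeomorphism (cball 0 1) D h g" and D: "D \<subseteq> S2"
    and c: "pos_chart N u v" "N \<notin> D" and c': "pos_chart N' u' v'" "N' \<notin> D"
  shows "winding_number (stereo N u v \<circ> h \<circ> circ) (stereo N u v (h 0))
       = winding_number (stereo N' u' v' \<circ> h \<circ> circ) (stereo N' u' v' (h 0))"
proof (cases "N = N'")
  case False
  then show ?thesis using chart_independence_ne[OF h D c c'] by simp
next
  case True
  have "compact D" using h compact_cball homeomorphic_compactness homeomorphic_def by metis
  moreover have "D \<noteq> {}" using h by (auto simp: homeomorphism_def)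
  ultimately obtain M where M: "M \<in> S2" "M \<notin> D" "M \<noteq> N"
    using two_outside[of D N] D c by (auto simp: pos_chart_def)
  obtain a b where "pos_chart M a b" using pos_chart_exists[OF M(1)] .
  with M show ?thesis
    using chart_independence_ne[OF h D c, of M a b] chart_independence_ne[OF h D c', of M a b] True by simp
qed

text \<open>Invariance of domain is used twice. In a chart it makes the image of the open disk open
  in the sphere. Applied to \<open>g\<close>, it shows that the image of a circle point has no
  neighbourhood inside \<open>D\<close>: \<open>g\<close> would map one onto an open subset of the
  closed unit disk, hence into the open disk.\<close>

lemma disk_structure:
  fixes h :: "complex \<Rightarrow> real^3"
  assumes h: "homeomorphism (cball 0 1) D h g" and D: "D \<subseteq> S2"
  shows "sbd D = h ` S1" "D - sbd D = h ` ball 0 1" "openin (top_of_set S2) (h ` ball 0 1)"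
proof -
  have hD: "h ` cball 0 1 = D" and ch: "continuous_on (cball 0 1) h" and cg: "continuous_on D g"
    and gh: "\<And>x. x \<in> cball 0 1 \<Longrightarrow> g (h x) = x" and hg: "\<And>y. y \<in> D \<Longrightarrow> h (g y) = y"
    and gD: "g ` D = cball 0 1"
    using h by (auto simp: homeomorphism_def)
  have inj: "inj_on h (cball 0 1)" using gh by (rule inj_on_inverseI)
  show op: "openin (top_of_set S2) (h ` ball 0 1)"
    unfolding openin_subopen[of _ "h ` ball 0 1"]
  proof
    fix x assume "x \<in> h ` ball 0 1"
    then obtain c where c: "c \<in> ball 0 1" "x = h c" by auto
    have xS: "x \<in> S2" using c hD D by auto
    \<comment> \<open>With the antipode as pole \<open>x\<close> lies in the chart. This pole may
      itself belong to \<open>D\<close>, so its preimage is left out of \<open>U\<close>.\<close>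
    define N where "N = - x"
    have "N \<noteq> x"
    proof
      assume "N = x"
      then have "x + x = 0" unfolding N_def by (metis add.left_inverse)
      then have "2 *\<^sub>R x = 0" by (simp only: scaleR_2)
      then have "x = 0" by simp
      with xS show False by (simp add: S2_def)
    qed
    with xS have N: "N \<in> S2" "N \<noteq> x" by (auto simp: N_def S2_def)
    obtain u v where ch: "pos_chart N u v" using pos_chart_exists[OF N(1)] .
    define U where "U = {z \<in> ball 0 1. h z \<noteq> N}"
    have cU: "continuous_on (ball 0 1) h" using \<open>continuous_on (cball 0 1) h\<close> by (rule continuous_on_subset) auto
    have "open U"
      unfolding U_def using continuous_open_preimage[OF cU open_ball, of "- {N}"]
      by (simp add: vimage_def Int_def open_Compl)
    have hU: "h ` U \<subseteq> S2 - {N}" using hD D by (auto simp: U_def)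
    have "open ((stereo N u v \<circ> h) ` U)"
    proof (rule invariance_of_domain[OF _ \<open>open U\<close>])
      show "continuous_on U (stereo N u v \<circ> h)"
        by (rule continuous_on_compose)
           (use cU continuous_on_stereo[OF N(1) hU] in \<open>auto simp: U_def intro: continuous_on_subset\<close>)
      show "inj_on (stereo N u v \<circ> h) U"
      proof (rule comp_inj_on)
        show "inj_on h U" using inj by (rule inj_on_subset) (auto simp: U_def)
        show "inj_on (stereo N u v) (h ` U)" using inj_on_stereo[OF ch] hU by (rule inj_on_subset)
      qed
    qed
    then have "openin (top_of_set (S2 - {N})) ((S2 - {N}) \<inter> stereo N u v -` ((stereo N u v \<circ> h) ` U))"
      using continuous_on_stereo[OF N(1), of "S2 - {N}"] by (simp add: continuous_openin_preimage_gen)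
    moreover have "(S2 - {N}) \<inter> stereo N u v -` ((stereo N u v \<circ> h) ` U) = h ` U"
      using hU inj_onD[OF inj_on_stereo[OF ch]] by (auto simp: image_iff)
    moreover have "openin (top_of_set S2) (S2 - {N})"
      by (simp add: openin_delete)
    ultimately have "openin (top_of_set S2) (h ` U)"
      using openin_trans by metis
    moreover have "x \<in> h ` U" using c N by (auto simp: U_def)
    moreover have "h ` U \<subseteq> h ` ball 0 1" by (auto simp: U_def)
    ultimately show "\<exists>T. openin (top_of_set S2) T \<and> x \<in> T \<and> T \<subseteq> h ` ball 0 1" by blast
  qed
  have split: "cball (0::complex) 1 = S1 \<union> ball 0 1" "S1 \<inter> ball 0 1 = {}" by (auto simp: S1_def)
  then have Deq: "D = h ` S1 \<union> h ` ball 0 1" using hD by auto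
  have dis: "h ` S1 \<inter> h ` ball 0 1 = {}"
    using inj_on_image_Int[OF inj, of S1 "ball 0 1"] split by auto
  have "sbd D \<subseteq> h ` S1"
  proof
    fix x assume x: "x \<in> sbd D"
    then have "x \<in> closure (S2 - D)" by (simp add: sbd_def)
    moreover obtain T where T: "open T" "h ` ball 0 1 = T \<inter> S2"
      using op unfolding openin_open by (auto simp: Int_commute)
    then have "T \<inter> (S2 - D) = {}" using Deq by blast
    ultimately have "x \<notin> T" using T(1) open_Int_closure_eq_empty[of T "S2 - D"] by auto
    then have "x \<notin> h ` ball 0 1" using T by auto
    then show "x \<in> h ` S1" using x Deq by (auto simp: sbd_def)
  qed
  moreover have "h ` S1 \<subseteq> sbd D"
  proof
    fix x assume "x \<in> h ` S1"
    then obtain c where c: "c \<in> S1" "x = h c" by auto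
    have xD: "x \<in> D" using c Deq by auto
    show "x \<in> sbd D"
    proof (rule ccontr)
      assume "x \<notin> sbd D"
      define V where "V = S2 \<inter> (- closure (S2 - D))"
      have xV: "x \<in> V" using \<open>x \<notin> sbd D\<close> xD D by (auto simp: V_def sbd_def)
      have VD: "V \<subseteq> D" using closure_subset[of "S2 - D"] by (auto simp: V_def)
      have "openin (top_of_set S2) V" unfolding V_def by (intro openin_open_Int) auto
      then have "openin (top_of_set (UNIV::complex set)) (g ` V)"
      proof (intro invariance_of_domain_sphere_affine_set[of V g UNIV 1 0])
        show "continuous_on V g" using cg VD by (rule continuous_on_subset)
        show "inj_on g V" using hg VD by (intro inj_on_inverseI[of _ h]) auto
      qed (auto simp: S2_def aff_dim_UNIV)
      then have "open (g ` V)" by (metis open_openin subtopology_UNIV)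
      moreover have "g ` V \<subseteq> cball 0 1" using gD VD by auto
      ultimately have "g ` V \<subseteq> ball 0 1"
        using interior_maximal[of "g ` V" "cball 0 1"] by (simp add: interior_cball)
      moreover have "g x = c" using gh c by (auto simp: S1_def)
      ultimately show False using xV c by (auto simp: S1_def)
    qed
  qed
  ultimately show s: "sbd D = h ` S1" by auto
  show "D - sbd D = h ` ball 0 1" using Deq dis s by auto
qed

lemma disk_facts:
  assumes "disk D"
  shows "closed D" "sbd D \<subseteq> D" "sbd D \<noteq> {}" "D - sbd D \<noteq> {}" "connected (D - sbd D)"
    "openin (top_of_set S2) (D - sbd D)" "S2 - D \<noteq> {}" "D \<subseteq> S2"
    "\<And>x. x \<in> sbd D \<Longrightarrow> connected (sbd D - {x}) \<and> sbd D - {x} \<noteq> {}"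
proof -
  obtain h g where h: "homeomorphism (cball (0::complex) 1) D h g" using disk_param[OF assms] by blast
  have D: "D \<subseteq> S2" using assms by (simp add: disk_def)
  note st = disk_structure[OF h D]
  have ch: "continuous_on (cball 0 1) h" using h by (simp add: homeomorphism_def)
  show "closed D" using compact_disk[OF assms] by (rule compact_imp_closed)
  show "D \<subseteq> S2" by fact
  show "sbd D \<subseteq> D" by (auto simp: sbd_def)
  have one: "1 \<in> S1" by (simp add: S1_def)
  then show ne: "sbd D \<noteq> {}" using st by auto
  show "D - sbd D \<noteq> {}" using st by auto
  show "openin (top_of_set S2) (D - sbd D)" using st by simp
  show "connected (D - sbd D)" unfolding st(2)
    by (intro connected_continuous_image continuous_on_subset[OF ch]) auto
  show "S2 - D \<noteq> {}" using ne unfolding sbd_def by (metis Int_empty_right closure_empty)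
  fix x assume x: "x \<in> sbd D"
  then obtain c where c: "c \<in> S1" "x = h c" using st by auto
  have inj: "inj_on h S1"
    using homeomorphism_apply1[OF h] by (intro inj_on_inverseI[of _ g]) (auto simp: S1_def)
  have eq: "sbd D - {x} = h ` (S1 - {c})"
    using inj c st by (auto simp: inj_on_def)
  have "connected (sbd D - {x})" unfolding eq
    by (intro connected_continuous_image continuous_on_subset[OF ch] connected_S1_delete c) (auto simp: S1_def)
  moreover have "- c \<in> S1 - {c}" using c S1_nz[of c] by (auto simp: S1_def)
  ultimately show "connected (sbd D - {x}) \<and> sbd D - {x} \<noteq> {}" unfolding eq by blast
qed

text \<open>If a point \<open>w\<close> of the larger circle were missed, the argument measured from
  \<open>w\<close> would embed the smaller circle in the real line.\<close>

lemma sbd_subset_eq: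
  assumes "disk D" "disk D'" "sbd D \<subseteq> sbd D'"
  shows "sbd D = sbd D'"
proof (rule ccontr)
  assume "sbd D \<noteq> sbd D'"
  then obtain w where w: "w \<in> sbd D'" "w \<notin> sbd D" using assms by auto
  obtain h g where h: "homeomorphism (cball (0::complex) 1) D h g" using disk_param[OF assms(1)] by blast
  obtain h' g' where h': "homeomorphism (cball (0::complex) 1) D' h' g'" using disk_param[OF assms(2)] by blast
  have D: "D \<subseteq> S2" "D' \<subseteq> S2" using assms by (auto simp: disk_def)
  note st = disk_structure[OF h D(1)] and st' = disk_structure[OF h' D(2)]
  have gS: "g' y \<in> S1" if "y \<in> sbd D'" for y
    using that st' homeomorphism_apply1[OF h'] by (auto simp: S1_def)
  have ginj: "y = y'" if "y \<in> sbd D'" "y' \<in> sbd D'" "g' y = g' y'" for y y'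
    using that homeomorphism_apply2[OF h'] disk_facts(2)[OF assms(2)] by (metis subsetD)
  have hS: "h z \<in> sbd D'" "h z \<noteq> w" if "z \<in> S1" for z using that st assms w by auto
  have hinj: "z = z'" if "z \<in> S1" "z' \<in> S1" "h z = h z'" for z z'
    using that homeomorphism_apply1[OF h] by (metis S1_iff mem_cball_0 order_refl)
  define k where "k z = Arg2pi (g' (h z) / g' w)" for z
  have q: "g' (h z) / g' w \<in> S1" "g' (h z) / g' w \<noteq> 1" if "z \<in> S1" for z
    using gS[OF hS(1)[OF that]] gS[OF w(1)] ginj[OF hS(1)[OF that] w(1)] hS(2)[OF that] S1_nz[of "g' w"]
    by (auto simp: S1_iff norm_divide)
  have "continuous_on (sphere 0 1) k"
  proof -
    have "continuous_on S1 (\<lambda>z. g' (h z) / g' w)"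
    proof (intro continuous_intros)
      show "continuous_on S1 (\<lambda>z. g' (h z))"
      proof (rule continuous_on_compose2[of D' g'])
        show "continuous_on D' g'" using h' by (simp add: homeomorphism_def)
        show "continuous_on S1 h" using h by (auto simp: homeomorphism_def S1_def intro: continuous_on_subset)
        show "h ` S1 \<subseteq> D'" using hS disk_facts(2)[OF assms(2)] by auto
      qed
    qed (use S1_nz[OF gS[OF w(1)]] in auto)
    moreover have "continuous_on {z. z \<notin> \<real>\<^sub>\<ge>\<^sub>0} Arg2pi"
      by (intro continuous_at_imp_continuous_on ballI continuous_at_Arg2pi) auto
    moreover have "g' (h z) / g' w \<notin> \<real>\<^sub>\<ge>\<^sub>0" if "z \<in> S1" for z
      using q[OF that] by (auto simp: nonneg_Reals_def S1_iff)
    ultimately show ?thesis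
      unfolding k_def S1_def[symmetric] by (intro continuous_on_compose2[of _ Arg2pi S1 "\<lambda>z. g' (h z) / g' w"]) auto
  qed
  moreover have "inj_on k (sphere 0 1)"
  proof (rule inj_onI, fold S1_def)
    fix z z' assume z: "z \<in> S1" "z' \<in> S1" "k z = k z'"
    then have "g' (h z) / g' w = g' (h z') / g' w"
      unfolding k_def using Arg2pi_S1_inj q(1) by metis
    then have "g' (h z) = g' (h z')" using S1_nz[OF gS[OF w(1)]] by simp
    then show "z = z'" using ginj hS z hinj by metis
  qed
  ultimately have "DIM(complex) \<le> DIM(real)"
    by (rule no_embedding_sphere_lowdim) simp
  then show False by simp
qed

subsection \<open>Boundary orientation\<close>

lemma circ_cnj: "cnj (circ t) = circ (1 - t)"
proof -
  have "circ (1 - t) = cis (2 * pi) * cis (- (2 * pi * t))"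
    unfolding circ_def cis_mult by (simp add: algebra_simps)
  then show ?thesis by (simp add: circ_def cis_cnj)
qed

text \<open>The boundary loop has winding number -1, 0 or 1. It equals twice an angle sum
  \<open>s\<close> with \<open>exp (2 * pi * \<i> * s) = -1\<close>, which excludes 0; the value -1
  is repaired by precomposing with complex conjugation.\<close>

lemma pos_param_exists:
  assumes "disk D"
  obtains h g where "pos_param D h g"
proof -
  obtain h g where h: "homeomorphism (cball (0::complex) 1) D h g" using disk_param[OF assms] by blast
  have D: "D \<subseteq> S2" using assms by (simp add: disk_def)
  obtain N where N: "N \<in> S2" "N \<notin> D" using disk_facts(7)[OF assms] by auto
  obtain u v where ch: "pos_chart N u v" using pos_chart_exists[OF N(1)] .
  define \<phi> where "\<phi> = stereo N u v \<circ> h"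
  note C = chart_disk[OF h D ch N(2), folded \<phi>_def]
  have p: "path (\<phi> \<circ> circ)"
    by (rule path_continuous_image[OF path_circ(1)])
       (use C(1) in \<open>auto simp: path_image_circ S1_def intro: continuous_on_subset\<close>)
  have loop: "pathfinish (\<phi> \<circ> circ) = pathstart (\<phi> \<circ> circ)"
    using path_circ(2) by (simp add: pathstart_compose pathfinish_compose)
  have n0: "\<phi> 0 \<notin> path_image (\<phi> \<circ> circ)"
  proof
    assume "\<phi> 0 \<in> path_image (\<phi> \<circ> circ)"
    then obtain s where "s \<in> S1" "\<phi> 0 = \<phi> s" by (auto simp: path_image_compose path_image_circ)
    then show False using inj_onD[OF C(2), of 0 s] by (auto simp: S1_def)
  qed
  have "simple_path circ" by (simp add: circ_circlepath simple_path_circlepath)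
  then have sp: "simple_path (\<phi> \<circ> circ)"
  proof (rule simple_path_continuous_image)
    show "continuous_on (path_image circ) \<phi>" "inj_on \<phi> (path_image circ)"
      using continuous_on_subset[OF C(1)] inj_on_subset[OF C(2)] by (simp_all add: path_image_circ S1_def)
  qed
  define w where "w = winding_number (\<phi> \<circ> circ) (\<phi> 0)"
  have cases: "w \<in> {-1, 0, 1}"
    unfolding w_def by (rule simple_closed_path_winding_number_cases[OF sp loop n0])
  have "w \<noteq> 0"
  proof -
    obtain a b c where abc: "a \<in> S1" "b \<in> S1" "c \<in> S1" "ccw a b c"
    proof -
      have 1: "1 \<in> S1" "-1 \<in> S1" "(1::complex) \<noteq> -1" by (auto simp: S1_def)
      obtain s where "s \<in> S1" "ccw 1 s (-1)" using ccw_arc_nonempty[OF 1] .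
      then show ?thesis using that 1 by blast
    qed
    note dd = ccw_distinct[OF abc(4)]
    have cb: "a \<in> cball 0 1" "b \<in> cball 0 1" "c \<in> cball 0 1" using abc by (auto simp: S1_def)
    have sg: "closed_segment a b \<subseteq> cball 0 1 - {c}" "closed_segment b c \<subseteq> cball 0 1 - {a}"
      "closed_segment c a \<subseteq> cball 0 1 - {b}"
      using cb abc dd by (intro segment_S1_avoids; blast)+
    have pl: "path (\<phi> \<circ> linepath p q)" if "p \<in> cball 0 1" "q \<in> cball 0 1" for p q
      by (rule path_continuous_image)
         (use closed_segment_subset[OF that convex_cball] C(1) in \<open>auto intro: continuous_on_subset\<close>)
    have il: "path_image (\<phi> \<circ> linepath p q) \<subseteq> \<phi> ` cball 0 1 - {\<phi> r}"
      if "closed_segment p q \<subseteq> cball 0 1 - {r}" "r \<in> cball 0 1" for p q r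
    proof
      fix y assume "y \<in> path_image (\<phi> \<circ> linepath p q)"
      then obtain x where x: "x \<in> closed_segment p q" "y = \<phi> x" by (auto simp: path_image_compose)
      with that have "x \<in> cball 0 1" "x \<noteq> r" by blast+
      with x that inj_onD[OF C(2)] show "y \<in> \<phi> ` cball 0 1 - {\<phi> r}" by blast
    qed
    define s where "s = winding_number (\<phi> \<circ> linepath a b) (\<phi> c) + winding_number (\<phi> \<circ> linepath b c) (\<phi> a)
       + winding_number (\<phi> \<circ> linepath c a) (\<phi> b)"
    have "2 * s = w"
      unfolding w_def s_def
      by (rule angle_sum_disk[OF C abc pl[OF cb(1,2)] il[OF sg(1) cb(3)] _ _ pl[OF cb(2,3)] il[OF sg(2) cb(1)] _ _ pl[OF cb(3,1)] il[OF sg(3) cb(2)]])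
         (simp_all add: pathstart_compose pathfinish_compose)
    moreover have "exp (2 * pi * \<i> * s) = -1"
      unfolding s_def by (rule swap_loop_winding(2)[OF C abc(1-3)]) (use dd in auto)
    ultimately show "w \<noteq> 0" by auto
  qed
  show ?thesis
  proof (cases "w = 1")
    case True
    have "pos_param D h g"
      unfolding pos_param_def using h ch N True unfolding w_def \<phi>_def by auto
    then show ?thesis by (rule that)
  next
    case False
    then have wm: "w = -1" using cases \<open>w \<noteq> 0\<close> by auto
    have "homeomorphism (cball 0 1) (cball 0 1) cnj cnj"
      by (auto simp: homeomorphism_def image_iff intro!: continuous_intros bexI[of _ "cnj _"])
    then have hc: "homeomorphism (cball 0 1) D (h \<circ> cnj) (cnj \<circ> g)"
      using h homeomorphism_compose by blast
    have "stereo N u v \<circ> (h \<circ> cnj) \<circ> circ = reversepath (\<phi> \<circ> circ)"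
      by (auto simp: fun_eq_iff \<phi>_def reversepath_def circ_cnj)
    moreover have "winding_number (reversepath (\<phi> \<circ> circ)) (\<phi> 0) = 1"
      using winding_number_reversepath[OF p n0] wm by (simp add: w_def)
    ultimately have calculation: "stereo N u v \<circ> (h \<circ> cnj) \<circ> circ = reversepath (\<phi> \<circ> circ)"
      "winding_number (reversepath (\<phi> \<circ> circ)) (\<phi> 0) = 1" by auto
    have "pos_param D (h \<circ> cnj) (cnj \<circ> g)"
      unfolding pos_param_def
    proof (intro conjI hc)
      have "pos_chart N u v \<and> N \<notin> D \<and>
          winding_number (stereo N u v \<circ> (h \<circ> cnj) \<circ> circ) (stereo N u v ((h \<circ> cnj) 0)) = 1"
        using ch N calculation by (simp add: \<phi>_def)
      then show "\<exists>N u v. pos_chart N u v \<and> N \<notin> D \<and>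
          winding_number (stereo N u v \<circ> (h \<circ> cnj) \<circ> circ) (stereo N u v ((h \<circ> cnj) 0)) = 1"
        by blast
    qed
    then show ?thesis by (rule that)
  qed
qed

lemma pos_param_any_chart:
  assumes "pos_param D h g" "D \<subseteq> S2" "pos_chart N u v" "N \<notin> D"
  shows "winding_number (stereo N u v \<circ> h \<circ> circ) ((stereo N u v \<circ> h) 0) = 1"
  using assms chart_independence[of D h g] unfolding pos_param_def by (metis comp_apply)

lemma pos_param_sbd:
  assumes "pos_param D h g" "D \<subseteq> S2"
  shows "homeomorphism (cball 0 1) D h g" "x \<in> sbd D \<Longrightarrow> g x \<in> S1 \<and> h (g x) = x" "sbd D = h ` S1"
    "s \<in> S1 \<Longrightarrow> g (h s) = s \<and> h s \<in> sbd D" "x \<in> sbd D \<Longrightarrow> y \<in> sbd D \<Longrightarrow> g x = g y \<Longrightarrow> x = y"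
proof -
  show h: "homeomorphism (cball 0 1) D h g" using assms by (simp add: pos_param_def)
  show s: "sbd D = h ` S1" using disk_structure[OF h assms(2)] by simp
  show a: "x \<in> sbd D \<Longrightarrow> g x \<in> S1 \<and> h (g x) = x" for x
    using s homeomorphism_apply1[OF h] by (auto simp: S1_def)
  show "s \<in> S1 \<Longrightarrow> g (h s) = s \<and> h s \<in> sbd D"
    using s homeomorphism_apply1[OF h] by (auto simp: S1_def)
  show "x \<in> sbd D \<Longrightarrow> y \<in> sbd D \<Longrightarrow> g x = g y \<Longrightarrow> x = y" using a by metis
qed

text \<open>Positive cyclic order of three points on the oriented boundary of \<open>D\<close>. The
  choice of parametrization is immaterial for boundary points of a disk: apply nesting of
  \<open>D\<close> in itself.\<close>

definition orr :: "(real^3) set \<Rightarrow> real^3 \<Rightarrow> real^3 \<Rightarrow> real^3 \<Rightarrow> bool" where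
  "orr D x y z \<longleftrightarrow> (\<exists>h g. pos_param D h g \<and> ccw (g x) (g y) (g z))"

lemma pos_param_nested:
  assumes pB: "pos_param B h g" and pD: "pos_param D h' g'" and D: "disk D" and sub: "B \<subseteq> D"
    and x: "x \<in> sbd B \<inter> sbd D" "y \<in> sbd B \<inter> sbd D" "z \<in> sbd B \<inter> sbd D" and ccw: "ccw (g x) (g y) (g z)"
  shows "ccw (g' x) (g' y) (g' z)"
proof -
  have DS: "D \<subseteq> S2" "B \<subseteq> S2" using D sub by (auto simp: disk_def)
  obtain N where N: "N \<in> S2" "N \<notin> D" using disk_facts(7)[OF D] by auto
  then have NB: "N \<notin> B" using sub by auto
  obtain u v where ch: "pos_chart N u v" using pos_chart_exists[OF N(1)] .
  note P = pos_param_sbd[OF pB DS(2)] and P' = pos_param_sbd[OF pD DS(1)]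
  show ?thesis
  proof (rule ccw_nested_disks[OF chart_disk[OF P(1) DS(2) ch NB] pos_param_any_chart[OF pB DS(2) ch NB]
        chart_disk[OF P'(1) DS(1) ch N(2)] pos_param_any_chart[OF pD DS(1) ch N(2)] _ _ _ _ _ _ _ _ _ _ ccw])
    show "(stereo N u v \<circ> h) ` cball 0 1 \<subseteq> (stereo N u v \<circ> h') ` cball 0 1"
      using homeomorphism_image1[OF P(1)] homeomorphism_image1[OF P'(1)] sub
      unfolding image_comp[symmetric] by blast
  qed (use x P(2) P'(2) in auto)
qed

lemma orr_iff:
  assumes "pos_param D h g" "disk D" "x \<in> sbd D" "y \<in> sbd D" "z \<in> sbd D"
  shows "orr D x y z \<longleftrightarrow> ccw (g x) (g y) (g z)"
  using assms pos_param_nested[OF _ assms(1,2) order_refl] unfolding orr_def by blast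

lemma orr_swap:
  assumes "disk D" "x \<in> sbd D" "y \<in> sbd D" "z \<in> sbd D" "x \<noteq> y" "y \<noteq> z" "x \<noteq> z"
  shows "orr D x z y \<longleftrightarrow> \<not> orr D x y z"
proof -
  obtain h g where p: "pos_param D h g" using pos_param_exists[OF assms(1)] .
  have D: "D \<subseteq> S2" using assms by (simp add: disk_def)
  note P = pos_param_sbd[OF p D]
  have "g x \<noteq> g y" "g y \<noteq> g z" "g x \<noteq> g z" using P(5) assms by blast+
  then have "ccw (g x) (g y) (g z) \<or> ccw (g x) (g z) (g y)"
    using P(2) assms by (intro ccw_total) blast+
  then show ?thesis
    using orr_iff[OF p assms(1)] assms ccw_asym by blast
qed

lemma orr_rotate: "orr D x y z \<Longrightarrow> orr D y z x"
  unfolding orr_def using ccw_rotate by blast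

lemma orr_distinct: "orr D x y z \<Longrightarrow> x \<noteq> y \<and> y \<noteq> z \<and> x \<noteq> z"
  unfolding orr_def using ccw_distinct by blast

lemma orr_nested:
  assumes B: "disk B" and D: "disk D" and sub: "B \<subseteq> D"
    and x: "x \<in> sbd B \<inter> sbd D" "y \<in> sbd B \<inter> sbd D" "z \<in> sbd B \<inter> sbd D"
  shows "orr B x y z \<longleftrightarrow> orr D x y z"
proof -
  obtain h g where p: "pos_param B h g" using pos_param_exists[OF B] .
  obtain h' g' where p': "pos_param D h' g'" using pos_param_exists[OF D] .
  have 1: "orr B x y z \<Longrightarrow> orr D x y z" if "x \<in> sbd B \<inter> sbd D" "y \<in> sbd B \<inter> sbd D" "z \<in> sbd B \<inter> sbd D" for x y z
    using pos_param_nested[OF p p' D sub that] orr_iff[OF p B] orr_iff[OF p' D] that by auto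
  show ?thesis
  proof
    assume o: "orr D x y z"
    then have "\<not> orr D x z y" using orr_swap[OF D] orr_distinct[OF o] x by auto
    then have "\<not> orr B x z y" using 1 x by blast
    then show "orr B x y z" using orr_swap[OF B] orr_distinct[OF o] x by auto
  qed (use 1 x in blast)
qed

text \<open>The point \<open>N\<close> outside both disks supplies one chart showing the two of them
  side by side in the plane, where the theta graph argument applies.\<close>

lemma orr_adjacent:
  assumes B: "disk B" and D: "disk D" and dis: "B \<inter> D \<subseteq> sbd B \<inter> sbd D" and N: "N \<in> S2" "N \<notin> B" "N \<notin> D"
    and x: "x \<in> B \<inter> D" "y \<in> B \<inter> D" "z \<in> B \<inter> D" and ne: "x \<noteq> y" "y \<noteq> z" "x \<noteq> z"
  shows "orr B x y z \<longleftrightarrow> \<not> orr D x y z"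
proof -
  obtain h g where p: "pos_param B h g" using pos_param_exists[OF B] .
  obtain h' g' where p': "pos_param D h' g'" using pos_param_exists[OF D] .
  have S: "B \<subseteq> S2" "D \<subseteq> S2" using B D by (auto simp: disk_def)
  obtain u v where ch: "pos_chart N u v" using pos_chart_exists[OF N(1)] .
  note P = pos_param_sbd[OF p S(1)] and P' = pos_param_sbd[OF p' S(2)]
  note st = disk_structure[OF P(1) S(1)] and st' = disk_structure[OF P'(1) S(2)]
  have 1: "orr B x y z \<Longrightarrow> \<not> orr D x y z" if m: "x \<in> B \<inter> D" "y \<in> B \<inter> D" "z \<in> B \<inter> D" for x y z
  proof -
    assume "orr B x y z"
    have m': "x \<in> sbd B \<inter> sbd D" "y \<in> sbd B \<inter> sbd D" "z \<in> sbd B \<inter> sbd D" using m dis by auto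
    have ccw: "ccw (g x) (g y) (g z)" using \<open>orr B x y z\<close> orr_iff[OF p B] m' by auto
    have "\<not> ccw (g' x) (g' y) (g' z)"
    proof (rule ccw_adjacent_disks[OF chart_disk[OF P(1) S(1) ch N(2)] pos_param_any_chart[OF p S(1) ch N(2)]
        chart_disk[OF P'(1) S(2) ch N(3)] pos_param_any_chart[OF p' S(2) ch N(3)] _ _ _ _ _ _ _ _ _ _ ccw])
      fix a b assume ab: "a \<in> cball 0 1" "b \<in> cball 0 1" "(stereo N u v \<circ> h) a = (stereo N u v \<circ> h') b"
      have "h a \<in> B" "h' b \<in> D" using ab homeomorphism_image1[OF P(1)] homeomorphism_image1[OF P'(1)] by auto
      moreover from this have "h a = h' b"
        using ab S N inj_onD[OF inj_on_stereo[OF ch], of "h a" "h' b"] by auto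
      ultimately have "h a \<in> sbd B" "h' b \<in> sbd D" using dis by auto
      then have "g (h a) \<in> S1" "g' (h' b) \<in> S1" using P(2) P'(2) by blast+
      then show "a \<in> S1 \<and> b \<in> S1" using ab homeomorphism_apply1[OF P(1)] homeomorphism_apply1[OF P'(1)] by auto
    qed (use m' P(2) P'(2) in auto)
    then show "\<not> orr D x y z" using orr_iff[OF p' D] m' by auto
  qed
  show ?thesis
  proof
    assume "\<not> orr D x y z"
    have m: "x \<in> sbd B \<inter> sbd D" "y \<in> sbd B \<inter> sbd D" "z \<in> sbd B \<inter> sbd D" using x dis by blast+
    then have "orr D x z y" using \<open>\<not> orr D x y z\<close> orr_swap[OF D] ne by blast
    then have "\<not> orr B x z y" using 1 x by blast
    then show "orr B x y z" using orr_swap[OF B] ne m by blast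
  qed (use 1 x in blast)
qed

subsection \<open>Three disks tiling the sphere\<close>

text \<open>All boundaries are given as intersections of tiles, so the triple points
  \<open>A \<inter> B \<inter> E\<close> carry the combinatorics, and the notion is symmetric in the
  three tiles.\<close>

definition tri :: "(real^3) set \<Rightarrow> (real^3) set \<Rightarrow> (real^3) set \<Rightarrow> bool" where
  "tri A B E \<longleftrightarrow> disk A \<and> disk B \<and> disk E \<and> disk (A \<union> B) \<and> disk (B \<union> E) \<and> disk (A \<union> E) \<and>
     A \<union> B \<union> E = S2 \<and> sbd A = A \<inter> (B \<union> E) \<and> sbd B = B \<inter> (A \<union> E) \<and> sbd E = E \<inter> (A \<union> B) \<and>
     sbd (A \<union> B) = sbd E \<and> sbd (B \<union> E) = sbd A \<and> sbd (A \<union> E) = sbd B"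

lemma tri_swap: "tri A B E \<Longrightarrow> tri B A E"
  unfolding tri_def by (simp add: Un_commute)

lemma tri_rotate: "tri A B E \<Longrightarrow> tri B E A"
  unfolding tri_def by (simp add: Un_commute Un_left_commute Un_assoc)

text \<open>The circle \<open>sbd E\<close> would lie in the circle \<open>sbd B\<close> and hence
  equal it. The interior of \<open>B\<close> would then be open and relatively closed in the
  connected set \<open>S2 - E\<close>, so \<open>B\<close> and \<open>E\<close> would cover the
  sphere and leave \<open>A\<close> without interior.\<close>

lemma tri_boundary_not_subset:
  assumes t: "tri A B E"
  shows "\<not> sbd E \<subseteq> B"
proof
  assume sub: "sbd E \<subseteq> B"
  note T = t[unfolded tri_def]
  have "sbd E \<subseteq> sbd B" using sub T by auto
  then have eq: "sbd E = sbd B" using sbd_subset_eq[of E B] T by blast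
  define U where "U = S2 - E"
  have U: "U = (A \<union> B) - sbd (A \<union> B)" using T by (auto simp: U_def)
  have con: "connected U" unfolding U by (rule disk_facts(5)) (use T in blast)
  have BU: "B - sbd B = U \<inter> B" using eq T by (auto simp: U_def disk_def)
  obtain V where V: "open V" "B - sbd B = S2 \<inter> V"
    using disk_facts(6)[of B] T unfolding openin_open by blast
  have "U \<inter> V \<subseteq> B" using V by (auto simp: U_def)
  have clB: "closed B" using T disk_facts(1) by blast
  have "U \<inter> V \<inter> - B = {}" using \<open>U \<inter> V \<subseteq> B\<close> by auto
  moreover have "U \<subseteq> V \<union> - B"
  proof
    fix x assume "x \<in> U"
    then show "x \<in> V \<union> - B" using BU V by (cases "x \<in> B") (auto simp: U_def)
  qed
  moreover have "V \<inter> U \<noteq> {}"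
  proof -
    have "B - sbd B \<noteq> {}" using T disk_facts(4) by blast
    then show ?thesis using BU V by (auto simp: U_def)
  qed
  ultimately have "- B \<inter> U = {}"
    using connectedD[OF con V(1), of "- B"] clB by (auto simp: open_Compl Int_ac)
  then have "A \<subseteq> B \<union> E" using T by (auto simp: U_def disk_def)
  then have "A - sbd A = {}" using T by auto
  then show False using T disk_facts(4) by blast
qed

lemma connected_two_closed:
  assumes "connected C" "closed A" "closed B" "C \<subseteq> A \<union> B" "A \<inter> B \<inter> C = {}"
  shows "C \<subseteq> A \<or> C \<subseteq> B"
proof -
  have "A \<inter> C = {} \<or> B \<inter> C = {}"
    using connected_closedD[of C A B] assms by auto
  then show ?thesis using assms(4) by blast
qed

text \<open>With one triple point \<open>x\<close> only, the connected set
  \<open>sbd E - {x}\<close> would be covered by \<open>A\<close> and \<open>B\<close> without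
  overlap, so all of \<open>sbd E\<close> would lie in one of them.\<close>

lemma tri_second_point:
  assumes t: "tri A B E" and x: "x \<in> A \<inter> B \<inter> E"
  obtains y where "y \<noteq> x" "y \<in> A \<inter> B \<inter> E"
proof (rule ccontr)
  assume "\<not> thesis"
  then have only: "A \<inter> B \<inter> E \<subseteq> {x}" using that by blast
  note T = t[unfolded tri_def]
  have xs: "x \<in> sbd E" using T x by auto
  have E: "disk E" using T by blast
  have "sbd E - {x} \<subseteq> A \<or> sbd E - {x} \<subseteq> B"
  proof (rule connected_two_closed)
    show "connected (sbd E - {x})" using disk_facts(9)[OF E xs] by blast
    show "closed A" "closed B" using T disk_facts(1) by blast+
    show "sbd E - {x} \<subseteq> A \<union> B" "A \<inter> B \<inter> (sbd E - {x}) = {}" using T only by auto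
  qed
  then have "sbd E \<subseteq> A \<or> sbd E \<subseteq> B" using x by blast
  then show False using tri_boundary_not_subset[OF t] tri_boundary_not_subset[OF tri_swap[OF t]] by blast
qed

lemma tri_third_interior:
  assumes "tri A B E"
  obtains N where "N \<in> S2" "N \<notin> A" "N \<notin> B"
proof -
  note T = assms[unfolded tri_def]
  have "E - sbd E \<noteq> {}" using T disk_facts(4) by blast
  then obtain N where "N \<in> E" "N \<notin> sbd E" by blast
  then show ?thesis using T that[of N] by auto
qed

lemma tri_orr_opposite:
  assumes t: "tri A B E" and x: "x \<in> A \<inter> B" "y \<in> A \<inter> B" "z \<in> A \<inter> B" and ne: "x \<noteq> y" "y \<noteq> z" "x \<noteq> z"
  shows "orr A x y z \<longleftrightarrow> \<not> orr B x y z"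
proof -
  obtain N where "N \<in> S2" "N \<notin> A" "N \<notin> B" using tri_third_interior[OF t] .
  then show ?thesis using t[unfolded tri_def] x ne by (intro orr_adjacent) auto
qed

text \<open>Three triple points would be ordered oppositely by any two of the three tiles, and a
  two-valued order cannot alternate around a cycle of length three.\<close>

lemma tri_at_most_two:
  assumes t: "tri A B E" and x: "x \<in> A \<inter> B \<inter> E" "y \<in> A \<inter> B \<inter> E" "x \<noteq> y" and z: "z \<in> A \<inter> B \<inter> E"
  shows "z = x \<or> z = y"
proof (rule ccontr)
  assume "\<not> ?thesis"
  then have ne: "x \<noteq> y" "y \<noteq> z" "x \<noteq> z" using x by auto
  have "orr A x y z \<longleftrightarrow> \<not> orr B x y z"
    by (rule tri_orr_opposite[OF t _ _ _ ne]) (use x z in auto)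
  moreover have "orr B x y z \<longleftrightarrow> \<not> orr E x y z"
    by (rule tri_orr_opposite[OF tri_rotate[OF t] _ _ _ ne]) (use x z in auto)
  moreover have "orr E x y z \<longleftrightarrow> \<not> orr A x y z"
    by (rule tri_orr_opposite[OF tri_rotate[OF tri_rotate[OF t]] _ _ _ ne]) (use x z in auto)
  ultimately show False by blast
qed

text \<open>The two triple points cut the circle \<open>sbd E\<close> into two arcs. Each is free of
  triple points, hence lies in a single tile \<open>A\<close> or \<open>B\<close>, and they cannot
  lie in the same one. The truth value \<open>s\<close> records which arc belongs to
  \<open>A\<close>. The disk \<open>X\<close> that measures the order may be \<open>E\<close> or the
  disk on the other side of the same circle.\<close>

lemma tri_split:
  assumes t: "tri A B E" and x: "x \<in> A \<inter> B \<inter> E" "y \<in> A \<inter> B \<inter> E" "x \<noteq> y"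
    and X: "disk X" "sbd X = sbd E"
  obtains s where "\<forall>z \<in> A \<inter> E - {x,y}. orr X x y z \<longleftrightarrow> s"
    "\<forall>z \<in> B \<inter> E - {x,y}. orr X x y z \<longleftrightarrow> \<not> s"
    "A \<inter> E - {x,y} \<noteq> {}" "B \<inter> E - {x,y} \<noteq> {}"
proof -
  note T = t[unfolded tri_def]
  obtain h g where p: "pos_param X h g" using pos_param_exists[OF X(1)] .
  have XS: "X \<subseteq> S2" using X by (simp add: disk_def)
  note P = pos_param_sbd[OF p XS]
  have ch: "continuous_on S1 h" using P(1) by (auto simp: homeomorphism_def S1_def intro: continuous_on_subset)
  have xs: "x \<in> sbd X" "y \<in> sbd X" using X T x by auto
  have g: "g x \<in> S1" "g y \<in> S1" "g x \<noteq> g y" using P(2,5) xs x by blast+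
  have arc: "connected (h ` {s \<in> S1. ccw a s b}) \<and> h ` {s \<in> S1. ccw a s b} \<noteq> {} \<and>
      h ` {s \<in> S1. ccw a s b} \<subseteq> sbd X - {h a, h b}"
    if "a \<in> S1" "b \<in> S1" "a \<noteq> b" for a b
  proof -
    have "connected (h ` {s \<in> S1. ccw a s b})"
      by (intro connected_continuous_image connected_ccw_arc that continuous_on_subset[OF ch]) auto
    moreover have "{s \<in> S1. ccw a s b} \<noteq> {}" using ccw_arc_nonempty[OF that] by blast
    moreover have "h s \<in> sbd X - {h a, h b}" if "s \<in> S1" "ccw a s b" for s
      using P(4)[OF that(1)] P(4)[OF \<open>a \<in> S1\<close>] P(4)[OF \<open>b \<in> S1\<close>] ccw_distinct[OF that(2)] by force
    ultimately show ?thesis by (intro conjI) (assumption | simp add: image_subset_iff)+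
  qed
  define U where "U = h ` {s \<in> S1. ccw (g x) s (g y)}"
  define V where "V = h ` {s \<in> S1. ccw (g y) s (g x)}"
  have hg: "h (g x) = x" "h (g y) = y" using P(2) xs by blast+
  have U: "connected U" "U \<noteq> {}" "U \<subseteq> sbd X - {x,y}" and V: "connected V" "V \<noteq> {}" "V \<subseteq> sbd X - {x,y}"
    using arc[OF g] arc[OF g(2,1) g(3)[symmetric]] hg unfolding U_def V_def by auto
  have UV: "sbd X - {x,y} \<subseteq> U \<union> V"
  proof
    fix z assume z: "z \<in> sbd X - {x,y}"
    then have gz: "g z \<in> S1" "h (g z) = z" "g z \<noteq> g x" "g z \<noteq> g y" using P(2,5) xs by blast+
    then have "ccw (g x) (g z) (g y) \<or> ccw (g y) (g z) (g x)"
      using ccw_total[of "g x" "g z" "g y"] g ccw_rotate by metis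
    then show "z \<in> U \<union> V" using gz unfolding U_def V_def by (auto simp: image_iff)
  qed
  have Uo: "\<not> orr X x y z" if "z \<in> U" for z
  proof -
    have zX: "z \<in> sbd X" using that U by auto
    have "ccw (g x) (g z) (g y)" using that P(4) by (auto simp: U_def)
    then show ?thesis using orr_iff[OF p X(1) xs zX] ccw_asym by blast
  qed
  have Vo: "orr X x y z" if "z \<in> V" for z
  proof -
    have zX: "z \<in> sbd X" using that V by auto
    have "ccw (g y) (g z) (g x)" using that P(4) by (auto simp: V_def)
    then show ?thesis using orr_iff[OF p X(1) xs zX] ccw_rotate by blast
  qed
  have none: "z \<notin> A \<inter> B" if "z \<in> sbd X - {x,y}" for z
    using tri_at_most_two[OF t x, of z] that X T by auto
  have cl: "closed A" "closed B" using T disk_facts(1) by blast+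
  have cov: "sbd X \<subseteq> A \<union> B" and XE: "sbd X \<subseteq> E" using X T by auto
  have "U \<subseteq> A \<or> U \<subseteq> B"
    by (rule connected_two_closed[OF U(1) cl]) (use U cov none in auto)
  moreover have "V \<subseteq> A \<or> V \<subseteq> B"
    by (rule connected_two_closed[OF V(1) cl]) (use V cov none in auto)
  moreover have "\<not> (U \<subseteq> A \<and> V \<subseteq> A)"
    using tri_boundary_not_subset[OF tri_swap[OF t]] UV x X by auto
  moreover have "\<not> (U \<subseteq> B \<and> V \<subseteq> B)"
    using tri_boundary_not_subset[OF t] UV x X by auto
  ultimately consider "U \<subseteq> A" "V \<subseteq> B" | "U \<subseteq> B" "V \<subseteq> A" by blast
  then show ?thesis
  proof cases
    case 1
    show ?thesis
    proof (rule that[of False]; (rule ballI)?)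
      fix z assume z: "z \<in> A \<inter> E - {x,y}"
      then have zz: "z \<in> sbd X - {x,y}" using X T by auto
      then have "z \<in> U" using UV none[OF zz] 1 z by blast
      then show "orr X x y z \<longleftrightarrow> False" using Uo by blast
    next
      fix z assume z: "z \<in> B \<inter> E - {x,y}"
      then have zz: "z \<in> sbd X - {x,y}" using X T by auto
      then have "z \<in> V" using UV none[OF zz] 1 z by blast
      then show "orr X x y z \<longleftrightarrow> \<not> False" using Vo by blast
    next
      show "A \<inter> E - {x,y} \<noteq> {}" "B \<inter> E - {x,y} \<noteq> {}" using U(2,3) V(2,3) 1 XE by blast+
    qed
  next
    case 2
    show ?thesis
    proof (rule that[of True]; (rule ballI)?)
      fix z assume z: "z \<in> A \<inter> E - {x,y}"
      then have zz: "z \<in> sbd X - {x,y}" using X T by auto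
      then have "z \<in> V" using UV none[OF zz] 2 z by blast
      then show "orr X x y z \<longleftrightarrow> True" using Vo by blast
    next
      fix z assume z: "z \<in> B \<inter> E - {x,y}"
      then have zz: "z \<in> sbd X - {x,y}" using X T by auto
      then have "z \<in> U" using UV none[OF zz] 2 z by blast
      then show "orr X x y z \<longleftrightarrow> \<not> True" using Uo by blast
    next
      show "A \<inter> E - {x,y} \<noteq> {}" "B \<inter> E - {x,y} \<noteq> {}" using U(2,3) V(2,3) 2 XE by blast+
    qed
  qed
qed

text \<open>The point is taken on the arc between \<open>P\<close> and \<open>Q\<close> that avoids
  \<open>y\<close>: cut at \<open>y\<close> and \<open>P\<close> it lies with \<open>Q\<close>, and
  cut at \<open>y\<close> and \<open>Q\<close> it lies with \<open>P\<close>.\<close>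

lemma orr_between:
  assumes X: "disk X" and m: "y \<in> sbd X" "P \<in> sbd X" "Q \<in> sbd X" and ne: "y \<noteq> P" "P \<noteq> Q" "y \<noteq> Q"
  obtains y' where "y' \<in> sbd X" "y' \<noteq> y" "y' \<noteq> P" "y' \<noteq> Q"
    "orr X y P y' \<longleftrightarrow> orr X y P Q" "orr X y Q y' \<longleftrightarrow> orr X y Q P"
proof -
  obtain h g where p: "pos_param X h g" using pos_param_exists[OF X] .
  have XS: "X \<subseteq> S2" using X by (simp add: disk_def)
  note G = pos_param_sbd[OF p XS]
  have main: thesis if m: "y \<in> sbd X" "P \<in> sbd X" "Q \<in> sbd X" and c: "ccw (g y) (g P) (g Q)"
     and th: "\<And>y'. y' \<in> sbd X \<Longrightarrow> y' \<noteq> y \<Longrightarrow> y' \<noteq> P \<Longrightarrow> y' \<noteq> Q \<Longrightarrow> (orr X y P y' \<longleftrightarrow> orr X y P Q) \<Longrightarrow>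
      (orr X y Q y' \<longleftrightarrow> orr X y Q P) \<Longrightarrow> thesis" for P Q
  proof -
    have gS: "g y \<in> S1" "g P \<in> S1" "g Q \<in> S1" using G(2) m by blast+
    obtain s where s: "s \<in> S1" "ccw (g P) s (g Q)"
      using ccw_arc_nonempty[OF gS(2,3)] ccw_distinct[OF c] by blast
    define y' where "y' = h s"
    have y': "y' \<in> sbd X" "g y' = s" using G(4)[OF s(1)] by (auto simp: y'_def)
    have c1: "ccw (g P) (g Q) (g y)" using ccw_rotate[OF c] .
    have c2: "ccw (g P) s (g y)" "ccw s (g Q) (g y)"
      using ccw_trans[OF gS(2) s(1) gS(3,1) s(2) c1] by auto
    have "orr X y P y'" using orr_iff[OF p X m(1,2) y'(1)] c2(1) y'(2) ccw_rotate by metis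
    moreover have "orr X y P Q" using orr_iff[OF p X m(1,2,3)] c by blast
    moreover have "\<not> orr X y Q y'" using orr_iff[OF p X m(1,3) y'(1)] c2(2) y'(2) ccw_rotate ccw_asym by metis
    moreover have "\<not> orr X y Q P" using orr_iff[OF p X m(1,3,2)] c ccw_asym by blast
    moreover have "y' \<noteq> y" "y' \<noteq> P" "y' \<noteq> Q" using ccw_distinct[OF c2(1)] ccw_distinct[OF c2(2)] y' by blast+
    ultimately show thesis using th y' by blast
  qed
  have "g y \<noteq> g P" "g P \<noteq> g Q" "g y \<noteq> g Q" using G(5) m ne by blast+
  then have "ccw (g y) (g P) (g Q) \<or> ccw (g y) (g Q) (g P)"
    using ccw_total[of "g y" "g P" "g Q"] G(2) m by metis
  then show thesis
  proof
    assume "ccw (g y) (g P) (g Q)"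
    from main[OF m this] that show thesis by blast
  next
    assume "ccw (g y) (g Q) (g P)"
    from main[OF m(1,3,2) this] that show thesis by blast
  qed
qed

subsection \<open>Signs of degenerate intervals\<close>

locale wheel =
  fixes f :: "complex \<Rightarrow> real^3"
  assumes cw: "catherine_wheel f"
begin

definition J :: "complex \<Rightarrow> complex \<Rightarrow> (real^3) set" where "J p q = f ` arc p q"

lemma cont_f: "continuous_on S1 f" and image_f: "f ` S1 = S2"
  using cw by (auto simp: catherine_wheel_def)

lemma J_disk:
  assumes "p \<in> S1" "q \<in> S1" "p \<noteq> q"
  shows "disk (J p q)" "f p \<in> sbd (J p q)" "f q \<in> sbd (J p q)"
proof -
  have "J p q \<subseteq> S2" unfolding J_def using arc_sub_S1 image_f by blast
  then show "disk (J p q)" "f p \<in> sbd (J p q)" "f q \<in> sbd (J p q)"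
    using cw assms unfolding catherine_wheel_def J_def disk_def by auto
qed

lemma J_Un: "p \<in> S1 \<Longrightarrow> q \<in> S1 \<Longrightarrow> p \<noteq> q \<Longrightarrow> J p q \<union> J q p = S2"
  unfolding J_def image_f[symmetric] using arc_Un_arc by (metis image_Un)

lemma J_split: "p \<in> S1 \<Longrightarrow> s \<in> S1 \<Longrightarrow> q \<in> S1 \<Longrightarrow> ccw p s q \<Longrightarrow> J p q = J p s \<union> J s q"
  unfolding J_def using arc_split by (metis image_Un)

lemma in_J: "p \<in> S1 \<Longrightarrow> q \<in> S1 \<Longrightarrow> f p \<in> J p q \<and> f q \<in> J p q"
  unfolding J_def using arc_ends by blast

lemma in_J_between: "p \<in> S1 \<Longrightarrow> q \<in> S1 \<Longrightarrow> s \<in> S1 \<Longrightarrow> ccw p s q \<Longrightarrow> f s \<in> J p q"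
  unfolding J_def using mem_arc_iff by blast

lemma J_E:
  assumes "y \<in> J p q" "p \<in> S1" "q \<in> S1" "y \<noteq> f p" "y \<noteq> f q"
  obtains s where "s \<in> S1" "ccw p s q" "f s = y"
proof -
  obtain s where "s \<in> arc p q" "f s = y" using assms by (auto simp: J_def)
  then show ?thesis using assms that[of s] by (auto simp: mem_arc_iff)
qed

text \<open>The hard inclusion enlarges the interval: a common value is \<open>f t\<close> for some
  \<open>t\<close> in the complementary arc, so it is an end value of \<open>[t,q]\<close> and thus
  on the boundary of that larger image. The complement of the larger image lies in that of the
  smaller one, so the point is a limit of the latter as well.\<close>

lemma sbd_J:
  assumes pq: "p \<in> S1" "q \<in> S1" "p \<noteq> q"
  shows "sbd (J p q) = J p q \<inter> J q p"
proof
  have cl: "closed (J q p)" using J_disk[of q p] pq disk_facts(1) by metis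
  have "S2 - J p q \<subseteq> J q p" using J_Un[OF pq] by auto
  then have "closure (S2 - J p q) \<subseteq> J q p" using cl by (rule closure_minimal)
  then show "sbd (J p q) \<subseteq> J p q \<inter> J q p" by (auto simp: sbd_def)
next
  show "J p q \<inter> J q p \<subseteq> sbd (J p q)"
  proof
    fix x assume x: "x \<in> J p q \<inter> J q p"
    show "x \<in> sbd (J p q)"
    proof (cases "x = f p \<or> x = f q")
      case True
      then show ?thesis using J_disk[OF pq] by auto
    next
      case False
      then obtain t where t: "t \<in> S1" "ccw q t p" "f t = x"
        using J_E[of x q p] x pq by blast
      have c: "ccw t p q" using ccw_rotate[OF t(2)] .
      have "x \<in> sbd (J t q)" using J_disk(2)[of t q] t pq ccw_distinct[OF t(2)] by metis
      then have "x \<in> closure (S2 - J t q)" by (simp add: sbd_def)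
      moreover have "J p q \<subseteq> J t q" using J_split[OF t(1) pq(1,2) c] by auto
      then have "S2 - J t q \<subseteq> S2 - J p q" by auto
      ultimately have "x \<in> closure (S2 - J p q)" using closure_mono by blast
      then show ?thesis using x by (simp add: sbd_def)
    qed
  qed
qed

lemma tri_arcs:
  assumes S: "a \<in> S1" "b \<in> S1" "c \<in> S1" and ccw: "ccw a b c"
  shows "tri (J a b) (J b c) (J c a)"
proof -
  note d = ccw_distinct[OF ccw]
  have s1: "J a c = J a b \<union> J b c" using J_split[OF S(1,2,3) ccw] .
  have s2: "J b a = J b c \<union> J c a" using J_split[OF S(2,3,1) ccw_rotate[OF ccw]] .
  have s3: "J c b = J a b \<union> J c a" using J_split[OF S(3,1,2) ccw_rotate[OF ccw_rotate[OF ccw]]] by auto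
  have D: "disk (J a b)" "disk (J b c)" "disk (J c a)" "disk (J a c)" "disk (J b a)" "disk (J c b)"
    using J_disk(1) S d by metis+
  have B: "sbd (J a b) = J a b \<inter> J b a" "sbd (J b c) = J b c \<inter> J c b" "sbd (J c a) = J c a \<inter> J a c"
    "sbd (J a c) = J a c \<inter> J c a" "sbd (J b a) = J b a \<inter> J a b" "sbd (J c b) = J c b \<inter> J b c"
    using sbd_J S d by metis+
  have "J a b \<union> J b c \<union> J c a = S2" using J_Un[of a c] S d s1 by auto
  then show ?thesis
    unfolding tri_def s1[symmetric] s2[symmetric] s3[symmetric] using D B by (simp add: Int_commute)
qed

text \<open>Cutting a degenerate interval at a parameter with a boundary value produces a tiling
  whose triple points are the common end value and \<open>f u\<close>. The disk \<open>J p q\<close>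
  has the boundary of the third tile, so it may serve as measuring disk in
  \<open>tri_split\<close>.\<close>

lemma deg_tri:
  assumes S: "p \<in> S1" "u \<in> S1" "q \<in> S1" and c: "ccw p u q" and x: "f p = x" "f q = x"
    and fu: "f u \<in> sbd (J p q)" "f u \<noteq> x"
  shows "tri (J p u) (J u q) (J q p)" "x \<in> J p u \<inter> J u q \<inter> J q p" "f u \<in> J p u \<inter> J u q \<inter> J q p"
    "disk (J p q)" "sbd (J p q) = sbd (J q p)" "sbd (J p q) \<subseteq> J q p"
proof -
  note d = ccw_distinct[OF c]
  show "tri (J p u) (J u q) (J q p)" using tri_arcs[OF S c] .
  show "disk (J p q)" using J_disk S d by metis
  have s: "sbd (J p q) = J p q \<inter> J q p" "sbd (J q p) = J q p \<inter> J p q" using sbd_J S d by metis+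
  then show "sbd (J p q) = sbd (J q p)" "sbd (J p q) \<subseteq> J q p" by auto
  show "x \<in> J p u \<inter> J u q \<inter> J q p" using in_J[of p u] in_J[of u q] in_J[of q p] S x by auto
  show "f u \<in> J p u \<inter> J u q \<inter> J q p" using in_J[of p u] in_J[of u q] S fu s by auto
qed

text \<open>A test pair for the sign of a degenerate interval: the order of the single triple
  \<open>f p\<close>, \<open>f u\<close>, \<open>f v\<close> will decide it.\<close>

definition pr :: "complex \<Rightarrow> complex \<Rightarrow> complex \<Rightarrow> complex \<Rightarrow> bool" where
  "pr p q u v \<longleftrightarrow> u \<in> S1 \<and> v \<in> S1 \<and> ccw p u v \<and> ccw p v q \<and>
     f u \<in> sbd (J p q) - {f p} \<and> f v \<in> sbd (J p q) - {f p} \<and> f u \<noteq> f v"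

text \<open>One parameter is exchanged at a time, passing through the pair \<open>u\<close>,
  \<open>v'\<close>. In the tiling cut at the parameter that stays, both candidates for the other
  one have their values in the same tile, hence on the same boundary arc. The assumption on
  \<open>u\<close> and \<open>u'\<close> puts \<open>u\<close> before \<open>v'\<close>.\<close>

lemma pr_orr_same:
  assumes S: "p \<in> S1" "q \<in> S1" "p \<noteq> q" "f p = f q" and pr: "pr p q u v" "pr p q u' v'"
    and le: "u = u' \<or> ccw p u u'"
  shows "orr (J p q) (f p) (f u) (f v) \<longleftrightarrow> orr (J p q) (f p) (f u') (f v')"
proof -
  define D x where "D = J p q" and "x = f p"
  have x: "f p = x" "f q = x" using S by (auto simp: x_def)
  note P = pr(1)[unfolded pr_def, folded D_def x_def] and P' = pr(2)[unfolded pr_def, folded D_def x_def]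
  have Dd: "disk D" using J_disk S by (auto simp: D_def)
  have xD: "x \<in> sbd D" using J_disk(2)[OF S(1-3)] by (simp add: D_def x_def)
  have tr: "ccw p u q \<and> ccw u v q" if "u \<in> S1" "v \<in> S1" "ccw p u v" "ccw p v q" for u v
    using ccw_trans[OF S(1) that(1,2) S(2) that(3,4)] by blast
  have step1: "orr D x (f u) (f v) \<longleftrightarrow> orr D x (f u) (f v')" if a: "pr p q u v" "pr p q u v'" for u v v'
  proof -
    note A = a(1)[unfolded pr_def, folded D_def x_def] and A' = a(2)[unfolded pr_def, folded D_def x_def]
    have t: "ccw p u q" "ccw u v q" "ccw u v' q" using tr A A' by blast+
    note T = deg_tri[OF S(1) _ S(2) t(1) x, folded D_def]
    have fu: "u \<in> S1" "f u \<in> sbd D" "f u \<noteq> x" using A by auto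
    note T = T[OF fu]
    obtain s where s: "\<forall>z \<in> J p u \<inter> J q p - {x, f u}. orr D x (f u) z \<longleftrightarrow> s"
        "\<forall>z \<in> J u q \<inter> J q p - {x, f u}. orr D x (f u) z \<longleftrightarrow> \<not> s"
        "J p u \<inter> J q p - {x, f u} \<noteq> {}" "J u q \<inter> J q p - {x, f u} \<noteq> {}"
      using tri_split[OF T(1-3) fu(3)[symmetric] T(4,5)] .
    have "f v \<in> J u q" "f v' \<in> J u q" using in_J_between fu S A A' t by blast+
    then have "f v \<in> J u q \<inter> J q p - {x, f u}" "f v' \<in> J u q \<inter> J q p - {x, f u}"
      using A A' T(6) by auto
    then show ?thesis using s by blast
  qed
  have step2: "orr D x (f u) (f v) \<longleftrightarrow> orr D x (f u') (f v)" if a: "pr p q u v" "pr p q u' v" for u u' v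
  proof -
    note A = a(1)[unfolded pr_def, folded D_def x_def] and A' = a(2)[unfolded pr_def, folded D_def x_def]
    have fv: "v \<in> S1" "ccw p v q" "f v \<in> sbd D" "f v \<noteq> x" using A by auto
    note T = deg_tri[OF S(1) fv(1) S(2) fv(2) x, folded D_def, OF fv(3,4)]
    obtain s where s: "\<forall>z \<in> J p v \<inter> J q p - {x, f v}. orr D x (f v) z \<longleftrightarrow> s"
        "\<forall>z \<in> J v q \<inter> J q p - {x, f v}. orr D x (f v) z \<longleftrightarrow> \<not> s"
        "J p v \<inter> J q p - {x, f v} \<noteq> {}" "J v q \<inter> J q p - {x, f v} \<noteq> {}"
      using tri_split[OF T(1-3) fv(4)[symmetric] T(4,5)] .
    have "f u \<in> J p v" "f u' \<in> J p v" using in_J_between fv S A A' by blast+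
    then have "f u \<in> J p v \<inter> J q p - {x, f v}" "f u' \<in> J p v \<inter> J q p - {x, f v}"
      using A A' T(6) by auto
    then have "orr D x (f v) (f u) \<longleftrightarrow> orr D x (f v) (f u')" using s by blast
    then show ?thesis using orr_swap[OF Dd xD] A A' by auto
  qed
  \<comment> \<open>The intermediate pair must have two different values; otherwise
    \<open>f u\<close> would be a third triple point of the tiling cut at \<open>u'\<close>.\<close>
  have "f u \<noteq> f v'"
  proof
    assume eq: "f u = f v'"
    then have "u \<noteq> u'" using P' by auto
    then have c: "ccw p u u'" using le by blast
    have t: "ccw p u' q" "ccw u' v' q" using tr P' by blast+
    have fu: "u' \<in> S1" "f u' \<in> sbd D" "f u' \<noteq> x" using P' by auto
    note T = deg_tri[OF S(1) fu(1) S(2) t(1) x, folded D_def, OF fu(2,3)]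
    have "f u \<in> J p u'" using in_J_between[of p u' u] S fu P c by blast
    moreover have "f u \<in> J u' q" using in_J_between[of u' q v'] S fu P' t eq by auto
    moreover have "f u \<in> J q p" using T(6) P by auto
    ultimately have "f u \<in> J p u' \<inter> J u' q \<inter> J q p" by blast
    from tri_at_most_two[OF T(1-3) fu(3)[symmetric] this] show False using P P' eq by auto
  qed
  moreover have "ccw p u v'"
    using le ccw_trans(1)[of p u u' v'] S P P' by blast
  ultimately have "pr p q u v'"
    using P P' unfolding pr_def by (auto simp: D_def x_def)
  then have "orr D x (f u) (f v) \<longleftrightarrow> orr D x (f u') (f v')"
    using step1[OF pr(1)] step2[OF _ pr(2)] by blast
  then show ?thesis by (simp add: D_def x_def)
qed

lemma pr_orr:
  assumes S: "p \<in> S1" "q \<in> S1" "p \<noteq> q" "f p = f q" and pr: "pr p q u v" "pr p q u' v'"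
  shows "orr (J p q) (f p) (f u) (f v) \<longleftrightarrow> orr (J p q) (f p) (f u') (f v')"
proof -
  have m: "u \<in> S1" "u' \<in> S1" "p \<noteq> u" "p \<noteq> u'" using pr ccw_distinct by (auto simp: pr_def)
  have "u = u' \<or> ccw p u u' \<or> ccw p u' u"
    using ccw_total[OF S(1) m(1,2)] m by blast
  then show ?thesis
    using pr_orr_same[OF S pr] pr_orr_same[OF S pr(2,1)] by blast
qed

text \<open>The boundary minus the single end value is connected, so only one component has to be
  considered. All test pairs agree by \<open>pr_orr\<close>, so monotonicity on the whole interval
  follows from one of them.\<close>

lemma Zplus_iff:
  assumes S: "p \<in> S1" "q \<in> S1" "p \<noteq> q" "f p = f q" and pr: "pr p q u v"
  shows "Zplus_nonempty f p q \<longleftrightarrow> orr (J p q) (f p) (f u) (f v)"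
proof -
  define D x Y where "D = J p q" and "x = f p" and "Y = sbd D - {x}"
  have Dd: "disk D" using J_disk S by (auto simp: D_def)
  have xD: "x \<in> sbd D" using J_disk(2)[OF S(1-3)] by (simp add: D_def x_def)
  have "f ` {p,q} = {x}" using S by (auto simp: x_def)
  moreover have "components Y = {Y}"
    using disk_facts(9)[OF Dd xD] by (simp add: components_eq_sing_iff Y_def)
  ultimately have Z: "Zplus_nonempty f p q \<longleftrightarrow> agrees f p q Y"
    unfolding Zplus_nonempty_def D_def[unfolded J_def, symmetric] Y_def by simp
  \<comment> \<open>The base point \<open>e\<close> in \<open>agrees\<close> ranges over this
    singleton: the boundary is cut open at the common end value.\<close>
  have sY: "sbd D - Y = {x}" using xD by (auto simp: Y_def)
  have ag: "agrees f p q Y \<longleftrightarrow> (\<exists>h g. pos_param D h g \<and>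
      (\<forall>s\<in>arc p q \<inter> f -` Y. \<forall>t\<in>arc p q \<inter> f -` Y. arc_le p s t \<longrightarrow> bd_le g x (f s) (f t)))"
    unfolding agrees_def D_def[unfolded J_def, symmetric] sY by blast
  have DS: "D \<subseteq> S2" using Dd by (simp add: disk_def)
  have bd: "bd_le g x y z \<longleftrightarrow> y = x \<or> y = z \<or> orr D x y z"
    if p: "pos_param D h g" and yz: "y \<in> sbd D" "z \<in> sbd D" for h g y z
  proof -
    note G = pos_param_sbd[OF p DS]
    have gS: "g x \<in> S1" "g y \<in> S1" "g z \<in> S1" using G(2) xD yz by blast+
    have "bd_le g x y z \<longleftrightarrow> g y = g x \<or> g y = g z \<or> ccw (g x) (g y) (g z)"
      unfolding bd_le_def arc_le_def[symmetric] using arc_le_iff[OF gS] .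
    then show ?thesis using orr_iff[OF p Dd xD yz] G(5) xD yz by metis
  qed
  have P: "u \<in> S1" "v \<in> S1" "ccw p u v" "ccw p v q" "f u \<in> sbd D" "f v \<in> sbd D" "f u \<noteq> x" "f v \<noteq> x" "f u \<noteq> f v"
    using pr by (auto simp: pr_def D_def x_def)
  have uq: "ccw p u q" using ccw_trans(1)[OF S(1) P(1,2) S(2) P(3,4)] .
  show ?thesis
  proof
    assume "Zplus_nonempty f p q"
    then obtain h g where hg: "pos_param D h g"
      and mono: "\<forall>s\<in>arc p q \<inter> f -` Y. \<forall>t\<in>arc p q \<inter> f -` Y. arc_le p s t \<longrightarrow> bd_le g x (f s) (f t)"
      using Z ag by blast
    have "u \<in> arc p q \<inter> f -` Y" "v \<in> arc p q \<inter> f -` Y"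
      using P uq S by (auto simp: mem_arc_iff Y_def)
    moreover have "arc_le p u v" using P S by (simp add: arc_le_iff)
    ultimately have "bd_le g x (f u) (f v)" using mono by blast
    then show "orr (J p q) (f p) (f u) (f v)" using bd[OF hg P(5,6)] P by (auto simp: D_def x_def)
  next
    assume o: "orr (J p q) (f p) (f u) (f v)"
    obtain h g where hg: "pos_param D h g" using pos_param_exists[OF Dd] .
    have "bd_le g x (f s) (f t)"
      if s: "s \<in> arc p q \<inter> f -` Y" and t: "t \<in> arc p q \<inter> f -` Y" and st: "arc_le p s t" for s t
    proof -
      have m: "s \<in> S1" "t \<in> S1" "f s \<in> sbd D" "f t \<in> sbd D" "f s \<noteq> x" "f t \<noteq> x"
        using s t arc_sub_S1 by (auto simp: Y_def)
      have "orr D x (f s) (f t)" if ne: "f s \<noteq> f t"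
      proof -
        have "ccw p s t" using st m S ne by (auto simp: arc_le_iff x_def)
        moreover have "ccw p t q" using t S m by (auto simp: mem_arc_iff x_def)
        ultimately have "pr p q s t" using m ne by (auto simp: pr_def D_def x_def)
        from pr_orr[OF S this pr] o show ?thesis by (simp add: D_def x_def)
      qed
      then show ?thesis using bd[OF hg m(3,4)] by blast
    qed
    then show "Zplus_nonempty f p q" using Z ag hg by blast
  qed
qed

text \<open>Cut the circle at \<open>s\<close>, \<open>q\<close>, \<open>t\<close>; both values
  \<open>x\<close> and \<open>y\<close> are triple points. The sign of \<open>p\<close>,
  \<open>q\<close> is the order of \<open>x, y, z\<close> in the tile \<open>B\<close>, and that of
  \<open>s\<close>, \<open>t\<close> is the order of \<open>y, x, w\<close> in the adjacent tile
  \<open>E1\<close>, with \<open>z\<close> and \<open>w\<close> on different boundary arcs of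
  \<open>E1\<close>. Passing from one to the other makes three reversals: change of tile, change of
  arc, exchange of \<open>x\<close> and \<open>y\<close>.\<close>

lemma linked_opposite:
  assumes S: "p \<in> S1" "s \<in> S1" "q \<in> S1" "t \<in> S1" and c: "ccw p s q" "ccw q t p"
    and eq: "f p = f q" "f s = f t" and ne: "f p \<noteq> f s"
  shows "Zplus_nonempty f s t \<longleftrightarrow> \<not> Zplus_nonempty f p q"
proof -
  define x y where "x = f p" and "y = f s"
  have xy: "x \<noteq> y" "f p = x" "f q = x" "f s = y" "f t = y" using eq ne by (auto simp: x_def y_def)
  note d1 = ccw_distinct[OF c(1)] and d2 = ccw_distinct[OF c(2)]
  have c3: "ccw s q t" and c4: "ccw t p s" and c5: "ccw p s t"
    using ccw_trans[OF S(3,4,1,2) c(2) ccw_rotate[OF ccw_rotate[OF c(1)]]]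
      ccw_rotate by blast+
  have st: "s \<noteq> t" using xy eq ccw_distinct[OF c3] by auto
  define B E1 G where "B = J s q" and "E1 = J q t" and "G = J t s"
  have t2: "tri B E1 G" unfolding B_def E1_def G_def by (rule tri_arcs[OF S(2,3,4) c3])
  note T2 = t2[unfolded tri_def]
  have inG: "J t p \<subseteq> G" "J p s \<subseteq> G" using J_split[OF S(4,1,2) c4] by (auto simp: G_def)
  have xB: "x \<in> B" "x \<in> E1" "x \<in> G" "y \<in> B" "y \<in> E1" "y \<in> G"
    using in_J[of s q] in_J[of q t] in_J[of t p] in_J[of p s] S xy inG by (auto simp: B_def E1_def)
  have rB: "tri E1 G B" and rE: "tri G B E1" using tri_rotate[OF t2] tri_rotate[OF tri_rotate[OF t2]] by auto
  obtain sB where sB: "E1 \<inter> B - {x,y} \<noteq> {}"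
    using tri_split[OF rB _ _ xy(1), of B] xB T2 by blast
  then obtain z where z: "z \<in> E1" "z \<in> B" "z \<noteq> x" "z \<noteq> y" by blast
  have tG: "x \<in> G \<inter> B \<inter> E1" "y \<in> G \<inter> B \<inter> E1" "disk E1" using xB T2 by auto
  obtain sE where sE: "\<forall>w \<in> G \<inter> E1 - {x,y}. orr E1 x y w \<longleftrightarrow> sE"
    "\<forall>w \<in> B \<inter> E1 - {x,y}. orr E1 x y w \<longleftrightarrow> \<not> sE" "G \<inter> E1 - {x,y} \<noteq> {}"
    "B \<inter> E1 - {x,y} \<noteq> {}"
    using tri_split[OF rE tG(1,2) xy(1) tG(3) refl] .
  obtain w where w: "w \<in> G" "w \<in> E1" "w \<noteq> x" "w \<noteq> y" using sE(3) by blast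
  have zw: "orr E1 x y w \<longleftrightarrow> \<not> orr E1 x y z" using sE z w by blast
  have sbdB: "x \<in> sbd B" "y \<in> sbd B" "z \<in> sbd B" and sbdE1: "x \<in> sbd E1" "y \<in> sbd E1" "z \<in> sbd E1" "w \<in> sbd E1"
    using T2 xB z w by auto
  have dB: "disk B" "disk E1" using T2 by auto
  have zBE: "orr B x y z \<longleftrightarrow> \<not> orr E1 x y z"
    by (rule tri_orr_opposite[OF t2]) (use xB z xy in auto)
  define D where "D = J p q"
  have Dpq: "D = J p s \<union> B" unfolding D_def B_def by (rule J_split[OF S(1,2,3) c(1)])
  have Dd: "disk D" using J_disk[of p q] S d1 by (auto simp: D_def)
  have sD: "sbd D = D \<inter> J q p" unfolding D_def by (rule sbd_J) (use S d1 in auto)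
  have Eqp: "J q p = E1 \<union> J t p" unfolding E1_def by (rule J_split[OF S(3,4,1) c(2)])
  have mD: "x \<in> sbd D" "y \<in> sbd D" "z \<in> sbd D" using sD Dpq Eqp xB z by auto
  obtain v where v: "v \<in> S1" "ccw s v q" "f v = z"
    using J_E[of z s q] z S xy unfolding B_def by auto
  have cv: "ccw p s v" "ccw p v q"
    using ccw_trans[OF S(2) v(1) S(3,1) v(2) ccw_rotate[OF c(1)]] ccw_rotate by blast+
  have "pr p q s v"
    unfolding pr_def D_def[symmetric] using S v cv mD xy z by auto
  then have Zpq: "Zplus_nonempty f p q \<longleftrightarrow> orr D x y z"
    using Zplus_iff[of p q s v] S d1 eq xy v by (simp add: D_def)
  have "orr B x y z \<longleftrightarrow> orr D x y z"
    by (rule orr_nested[OF dB(1) Dd]) (use Dpq sbdB mD in auto)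
  define D' where "D' = J s t"
  have Dst: "D' = B \<union> E1" unfolding D'_def B_def E1_def by (rule J_split[OF S(2,3,4) c3])
  have Dd': "disk D'" using J_disk[of s t] S st by (auto simp: D'_def)
  have sD': "sbd D' = D' \<inter> G" unfolding D'_def G_def by (rule sbd_J) (use S st in auto)
  have mD': "x \<in> sbd D'" "y \<in> sbd D'" "w \<in> sbd D'" using sD' Dst xB w by auto
  obtain r where r: "r \<in> S1" "ccw q r t" "f r = w"
    using J_E[of w q t] w S xy unfolding E1_def by auto
  have cr: "ccw s q r" "ccw s r t"
    using ccw_trans[OF S(3) r(1) S(4,2) r(2) ccw_rotate[OF c3]] ccw_rotate by blast+
  have "pr s t q r"
    unfolding pr_def D'_def[symmetric] using S r cr mD' xy w by auto
  then have Zst: "Zplus_nonempty f s t \<longleftrightarrow> orr D' y x w"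
    using Zplus_iff[of s t q r] S st eq xy r by (simp add: D'_def)
  have "orr E1 y x w \<longleftrightarrow> orr D' y x w"
    by (rule orr_nested[OF dB(2) Dd']) (use Dst sbdE1 mD' in auto)
  moreover have "orr E1 y x w \<longleftrightarrow> \<not> orr E1 x y w"
    using orr_swap[OF dB(2) sbdE1(4,1,2)] orr_rotate xy w by metis
  ultimately show ?thesis
    using Zst Zpq zw zBE \<open>orr B x y z \<longleftrightarrow> orr D x y z\<close> by blast
qed

text \<open>The boundary of the image has a point other than the end value, and by
  \<open>sbd_J\<close> it is reached from both complementary arcs.\<close>

lemma degenerate_crossed:
  assumes S: "p \<in> S1" "q \<in> S1" "p \<noteq> q" "f p = f q"
  obtains s t where "s \<in> S1" "t \<in> S1" "ccw p s q" "ccw q t p" "f s = f t" "f s \<noteq> f p"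
    "Zplus_nonempty f s t \<longleftrightarrow> \<not> Zplus_nonempty f p q"
proof -
  have "disk (J p q)" "f p \<in> sbd (J p q)" using J_disk[OF S(1-3)] by auto
  then obtain y where y: "y \<in> sbd (J p q)" "y \<noteq> f p" using disk_facts(9)[of "J p q" "f p"] by blast
  then have "y \<in> J p q" "y \<in> J q p" using sbd_J[OF S(1-3)] by auto
  then obtain s t where st: "s \<in> S1" "ccw p s q" "f s = y" "t \<in> S1" "ccw q t p" "f t = y"
    using J_E[of y p q] J_E[of y q p] S y by metis
  then show ?thesis
    using that[of s t] linked_opposite[OF S(1) st(1) S(2) st(4) st(2,5) S(4)] y by auto
qed

text \<open>A pair from another fibre that crosses \<open>p\<close>, \<open>q\<close> is linked with
  both orderings of it, so both have the sign opposite to that pair.\<close>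

lemma Zplus_sym:
  assumes S: "p \<in> S1" "q \<in> S1" "p \<noteq> q" "f p = f q"
  shows "Zplus_nonempty f p q \<longleftrightarrow> Zplus_nonempty f q p"
proof -
  obtain s t where st: "s \<in> S1" "t \<in> S1" "ccw p s q" "ccw q t p" "f s = f t" "f s \<noteq> f p"
    "Zplus_nonempty f s t \<longleftrightarrow> \<not> Zplus_nonempty f p q"
    using degenerate_crossed[OF S] .
  have "ccw s q t" "ccw t p s"
    using ccw_trans[OF S(2) st(2) S(1) st(1) st(4) ccw_rotate[OF ccw_rotate[OF st(3)]]] ccw_rotate by blast+
  then have "Zplus_nonempty f q p \<longleftrightarrow> \<not> Zplus_nonempty f s t"
    using linked_opposite[of s q t p] S st by auto
  then show ?thesis using st by blast
qed

text \<open>The common value is a triple point of the three arcs, so there is a second one. Lifting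
  it to \<open>a\<close> between \<open>p\<close> and \<open>q\<close> and to \<open>b\<close>
  between \<open>q\<close> and \<open>r\<close> gives a pair linked with both given pairs.\<close>

lemma Zplus_fibre_ccw:
  assumes S: "p \<in> S1" "q \<in> S1" "r \<in> S1" "ccw p q r" "f p = f q" "f q = f r"
  shows "Zplus_nonempty f p q \<longleftrightarrow> Zplus_nonempty f q r"
proof -
  have t: "tri (J p q) (J q r) (J r p)" using tri_arcs[OF S(1-4)] .
  have "f p \<in> J p q \<inter> J q r \<inter> J r p" using in_J[of p q] in_J[of q r] in_J[of r p] S by auto
  then obtain y where y: "y \<noteq> f p" "y \<in> J p q \<inter> J q r \<inter> J r p" using tri_second_point[OF t] by blast
  obtain a where a: "a \<in> S1" "ccw p a q" "f a = y" using J_E[of y p q] S y by auto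
  obtain b where b: "b \<in> S1" "ccw q b r" "f b = y" using J_E[of y q r] S y by auto
  have "ccw q b p" using ccw_trans(1)[OF S(2) b(1) S(3,1) b(2) ccw_rotate[OF S(4)]] .
  then have 1: "Zplus_nonempty f a b \<longleftrightarrow> \<not> Zplus_nonempty f p q"
    using linked_opposite[of p a q b] S a b y by auto
  have "ccw a q r" using ccw_trans(2)[OF S(1) a(1) S(2,3) a(2) S(4)] .
  moreover have "ccw a q b" "ccw b r a"
    using ccw_trans[OF S(2) b(1) S(3) a(1) b(2) ccw_rotate[OF \<open>ccw a q r\<close>]] ccw_rotate by blast+
  ultimately have "Zplus_nonempty f q r \<longleftrightarrow> \<not> Zplus_nonempty f a b"
    using linked_opposite[of a q b r] S a b y by auto
  with 1 show ?thesis by blast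
qed

lemma Zplus_fibre:
  assumes S: "p \<in> S1" "q \<in> S1" "r \<in> S1" "p \<noteq> q" "q \<noteq> r" "p \<noteq> r" "f p = f q" "f q = f r"
  shows "Zplus_nonempty f p q \<longleftrightarrow> Zplus_nonempty f q r"
proof -
  have "ccw p q r \<or> ccw r q p" using ccw_total[OF S(1-6)] ccw_rotate by blast
  then show ?thesis
    using Zplus_fibre_ccw[OF S(1-3)] Zplus_fibre_ccw[OF S(3,2,1)] S
      Zplus_sym[of p q] Zplus_sym[of q r] by auto
qed

section \<open>Pairs with different values are crossed by both signs\<close>

definition opp_cross :: "complex \<Rightarrow> complex \<Rightarrow> bool \<Rightarrow> bool" where
  "opp_cross p q b \<longleftrightarrow> (\<exists>s\<in>S1. \<exists>t\<in>S1. ccw p s q \<and> ccw q t p \<and> f s = f t \<and> (Zplus_nonempty f s t \<longleftrightarrow> b))"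

lemma opp_cross_sym:
  assumes "p \<in> S1" "q \<in> S1" "opp_cross q p b"
  shows "opp_cross p q b"
proof -
  obtain s t where st: "s \<in> S1" "t \<in> S1" "ccw q s p" "ccw p t q" "f s = f t" "Zplus_nonempty f s t \<longleftrightarrow> b"
    using assms(3) unfolding opp_cross_def by blast
  have "s \<noteq> t" using st ccw_asym[of q s p] ccw_rotate by blast
  then have "Zplus_nonempty f t s \<longleftrightarrow> b" using Zplus_sym[OF st(1,2)] st by blast
  then show ?thesis unfolding opp_cross_def using st by metis
qed

text \<open>The tiling cut at \<open>p\<close>, \<open>s\<close>, \<open>q\<close> has a second
  triple point \<open>z\<close> besides \<open>f s\<close>. If \<open>z\<close> is a new value, it
  lifts to all three arcs, and two of the lifts form a crossing pair linked with \<open>s\<close>,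
  \<open>t\<close>. The two alternatives in the conclusion are the cases where \<open>z\<close> is
  \<open>f p\<close> or \<open>f q\<close>.\<close>

lemma cross_half:
  assumes S: "p \<in> S1" "q \<in> S1" "f p \<noteq> f q" and st: "s \<in> S1" "t \<in> S1" "ccw p s q" "ccw q t p" "f s = f t"
    and y: "f s \<noteq> f p" "f s \<noteq> f q"
  shows "opp_cross p q (\<not> Zplus_nonempty f s t) \<or>
    (\<exists>b\<in>S1. ccw s b q \<and> f b = f p) \<or> (\<exists>a\<in>S1. ccw p a s \<and> f a = f q)"
proof -
  have t: "tri (J p s) (J s q) (J q p)" using tri_arcs[OF S(1) st(1) S(2) st(3)] .
  have "f s \<in> J p s \<inter> J s q \<inter> J q p"
    using in_J[of p s] in_J[of s q] in_J_between[OF S(2,1) st(2,4)] S st by auto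
  then obtain z where z: "z \<noteq> f s" "z \<in> J p s" "z \<in> J s q" "z \<in> J q p" using tri_second_point[OF t] by blast
  consider "z = f p" | "z = f q" | "z \<noteq> f p" "z \<noteq> f q" by blast
  then show ?thesis
  proof cases
    case 1
    then obtain b where "b \<in> S1" "ccw s b q" "f b = z"
      using J_E[of z s q] z S st by metis
    then show ?thesis using 1 by blast
  next
    case 2
    then obtain a where "a \<in> S1" "ccw p a s" "f a = z"
      using J_E[of z p s] z S st by metis
    then show ?thesis using 2 by blast
  next
    case 3
    obtain a where a: "a \<in> S1" "ccw p a s" "f a = z" using J_E[of z p s] z S st 3 by metis
    obtain b where b: "b \<in> S1" "ccw s b q" "f b = z" using J_E[of z s q] z S st 3 by metis
    obtain e where e: "e \<in> S1" "ccw q e p" "f e = z" using J_E[of z q p] z S st 3 by metis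
    have ap: "ccw p a q" "ccw a s q" using ccw_trans[OF S(1) a(1) st(1) S(2) a(2) st(3)] by auto
    have bp: "ccw p b q" using ccw_trans[OF st(1) b(1) S(2,1) b(2) ccw_rotate[OF st(3)]] ccw_rotate by blast
    have "e \<noteq> t" using e z st by auto
    have "q \<noteq> e" "q \<noteq> t" using ccw_distinct[OF e(2)] ccw_distinct[OF st(4)] by auto
    \<comment> \<open>The position of \<open>e\<close> relative to \<open>t\<close> decides whether
      \<open>a\<close> or \<open>b\<close> is the partner making the pair linked with
      \<open>s\<close>, \<open>t\<close>.\<close>
    then consider "ccw q e t" | "ccw q t e" using ccw_total[OF S(2) e(1) st(2)] \<open>e \<noteq> t\<close> by blast
    then show ?thesis
    proof cases
      case 1
      have "ccw a s e \<and> ccw e t a"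
        using S(1,2) st(1-4) a(1,2) e(1,2) 1 by (simp add: ccw_iff_Arg2pi) (smt (verit))
      then have l: "ccw a s e" "ccw e t a" by auto
      have "Zplus_nonempty f a e \<longleftrightarrow> \<not> Zplus_nonempty f s t"
        using linked_opposite[OF a(1) st(1) e(1) st(2) l] a e st z by auto
      then have "opp_cross p q (\<not> Zplus_nonempty f s t)"
        unfolding opp_cross_def using a e ap by metis
      then show ?thesis ..
    next
      case 2
      have "ccw s b t \<and> ccw t e s"
        using S(1,2) st(1-4) b(1,2) e(1,2) 2 by (simp add: ccw_iff_Arg2pi) (smt (verit))
      then have l: "ccw s b t" "ccw t e s" by auto
      have "Zplus_nonempty f b e \<longleftrightarrow> \<not> Zplus_nonempty f s t"
        using linked_opposite[OF st(1) b(1) st(2) e(1) l] b e st z by auto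
      then have "opp_cross p q (\<not> Zplus_nonempty f s t)"
        unfolding opp_cross_def using b e bp by metis
      then show ?thesis ..
    qed
  qed
qed

text \<open>A boundary value \<open>y\<close> other than the two end values is reached from both
  arcs and gives a crossing pair \<open>s\<close>, \<open>t\<close> of some sign. For the other sign
  \<open>cross_half\<close> is applied to both arcs; if both applications fail, an end value recurs
  on each side, and each of the four combinations still yields a crossing pair of the missing
  sign.\<close>

lemma nondegenerate_crossed:
  assumes S: "p \<in> S1" "q \<in> S1" "f p \<noteq> f q"
  shows "opp_cross p q b"
proof -
  have pq: "p \<noteq> q" using S by auto
  define X where "X = J p q"
  have X: "disk X" "f p \<in> sbd X" "f q \<in> sbd X" using J_disk[OF S(1,2) pq] by (auto simp: X_def)
  have sX: "sbd X = J p q \<inter> J q p" "sbd X = sbd (J q p)"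
    using sbd_J[OF S(1,2) pq] sbd_J[OF S(2,1)] pq by (auto simp: X_def)
  obtain y where y: "y \<in> sbd X" "y \<noteq> f p" "y \<noteq> f q"
  proof -
    have "connected (sbd X - {f p})" "f q \<in> sbd X - {f p}" using disk_facts(9)[OF X(1,2)] X S by auto
    moreover have "sbd X - {f p} \<noteq> {f q}"
    proof
      assume eq: "sbd X - {f p} = {f q}"
      obtain h g where p: "pos_param X h g" using pos_param_exists[OF X(1)] .
      have XS: "X \<subseteq> S2" using X by (simp add: disk_def)
      note G = pos_param_sbd[OF p XS]
      have g: "g (f p) \<in> S1" "g (f q) \<in> S1" "g (f p) \<noteq> g (f q)" using G(2,5) X S by blast+
      obtain s where s: "s \<in> S1" "ccw (g (f p)) s (g (f q))" using ccw_arc_nonempty[OF g] .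
      have "h s \<in> sbd X" "g (h s) = s" using G(4)[OF s(1)] by auto
      then show False using eq ccw_distinct[OF s(2)] by (metis DiffI singletonD)
    qed
    ultimately have "\<not> sbd X - {f p} \<subseteq> {f q}" by (metis empty_iff subset_singletonD)
    then obtain y where "y \<in> sbd X - {f p}" "y \<noteq> f q" by blast
    then show ?thesis using that by blast
  qed
  obtain s where s: "s \<in> S1" "ccw p s q" "f s = y" using J_E[of y p q] y sX S by auto
  obtain t where t: "t \<in> S1" "ccw q t p" "f t = y" using J_E[of y q p] y sX S by auto
  have base: "opp_cross p q (Zplus_nonempty f s t)"
    unfolding opp_cross_def using s t by metis
  have st: "f s = f t" "f t = f s" "f s \<noteq> f p" "f s \<noteq> f q" "f t \<noteq> f p" "f t \<noteq> f q" "s \<noteq> t"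
    using s t y ccw_asym[of p s q] ccw_rotate by metis+
  have Zts: "Zplus_nonempty f t s \<longleftrightarrow> Zplus_nonempty f s t" using Zplus_sym[OF s(1) t(1) st(7,1)] by simp
  have "opp_cross p q (\<not> Zplus_nonempty f s t)"
  proof (rule ccontr)
    assume no: "\<not> ?thesis"
    then have no': "\<not> opp_cross q p (\<not> Zplus_nonempty f t s)"
      using opp_cross_sym[OF S(1,2)] Zts by auto
    have h1: "(\<exists>b\<in>S1. ccw s b q \<and> f b = f p) \<or> (\<exists>a\<in>S1. ccw p a s \<and> f a = f q)"
      using cross_half[OF S s(1) t(1) s(2) t(2) st(1,3,4)] no by blast
    have h2: "(\<exists>b\<in>S1. ccw t b p \<and> f b = f q) \<or> (\<exists>a\<in>S1. ccw q a t \<and> f a = f p)"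
      using cross_half[OF S(2,1) S(3)[symmetric] t(1) s(1) t(2) s(2) st(2,6,5)] no' by blast
    have linkedI: False if u: "u \<in> S1" "v \<in> S1" "f u = f v" "ccw p u q" "ccw q v p"
       "Zplus_nonempty f u v \<longleftrightarrow> \<not> Zplus_nonempty f s t" for u v
      using no u unfolding opp_cross_def by metis
    have t1: "tri (J p s) (J s q) (J q p)" by (rule tri_arcs[OF S(1) s(1) S(2) s(2)])
    have t2: "tri (J q t) (J t p) (J p q)" by (rule tri_arcs[OF S(2) t(1) S(1) t(2)])
    have ym: "y \<in> J p s \<inter> J s q \<inter> J q p" "y \<in> J q t \<inter> J t p \<inter> J p q"
      using in_J[of p s] in_J[of s q] in_J[of q t] in_J[of t p] S s t y sX by auto
    have pm: "f p \<in> J p s" "f p \<in> J q p" "f p \<in> J t p" "f p \<in> J p q" and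
      qm: "f q \<in> J s q" "f q \<in> J q p" "f q \<in> J q t" "f q \<in> J p q"
      using in_J S s t by auto
    \<comment> \<open>Needed when \<open>y\<close> and different end values are the triple points of
      the two tilings. Lying between \<open>f p\<close> and \<open>f q\<close> and away from
      \<open>y\<close>, the value \<open>y'\<close> shares a tile with the end value that is not the
      triple point, and this locates its two lifts \<open>u\<close> and \<open>v\<close>.\<close>
    obtain y' where y': "y' \<in> sbd X" "y' \<noteq> y" "y' \<noteq> f p" "y' \<noteq> f q"
      "orr X y (f p) y' \<longleftrightarrow> orr X y (f p) (f q)" "orr X y (f q) y' \<longleftrightarrow> orr X y (f q) (f p)"
      using orr_between[OF X(1) y(1) X(2,3) y(2) S(3) y(3)] .
    have y'm: "y' \<in> J p q" "y' \<in> J q p" using y' sX by auto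
    have Jpq: "J p q = J p s \<union> J s q" "J q p = J q t \<union> J t p"
      using J_split[OF S(1) s(1) S(2) s(2)] J_split[OF S(2) t(1) S(1) t(2)] by auto
    have X': "disk X" "sbd X = sbd (J p q)" using X(1) unfolding X_def by auto
    from h1 h2 show False
    proof (elim disjE bexE conjE)
      fix b b' assume b: "b \<in> S1" "ccw s b q" "f b = f p" and b': "b' \<in> S1" "ccw t b' p" "f b' = f q"
      have "f p \<in> J s q" using in_J_between[OF s(1) S(2) b(1,2)] b by simp
      then have pt: "f p \<in> J p s \<inter> J s q \<inter> J q p" using pm by auto
      have "f q \<in> J t p" using in_J_between[OF t(1) S(1) b'(1,2)] b' by simp
      then have qt: "f q \<in> J q t \<inter> J t p \<inter> J p q" using qm by auto
      obtain c1 where c1: "\<forall>z \<in> J p s \<inter> J q p - {y, f p}. orr X y (f p) z \<longleftrightarrow> c1"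
        "\<forall>z \<in> J s q \<inter> J q p - {y, f p}. orr X y (f p) z \<longleftrightarrow> \<not> c1"
        "J p s \<inter> J q p - {y, f p} \<noteq> {}" "J s q \<inter> J q p - {y, f p} \<noteq> {}"
        using tri_split[OF t1 ym(1) pt y(2) X(1) sX(2)] .
      have "y' \<in> J s q" using c1(1)[rule_format, of y'] c1(2)[rule_format, of "f q"] y' y'm qm y S Jpq by auto
      then obtain u where u: "u \<in> S1" "ccw s u q" "f u = y'" using J_E[of y' s q] S s y' by metis
      obtain c2 where c2: "\<forall>z \<in> J q t \<inter> J p q - {y, f q}. orr X y (f q) z \<longleftrightarrow> c2"
        "\<forall>z \<in> J t p \<inter> J p q - {y, f q}. orr X y (f q) z \<longleftrightarrow> \<not> c2"
        "J q t \<inter> J p q - {y, f q} \<noteq> {}" "J t p \<inter> J p q - {y, f q} \<noteq> {}"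
        using tri_split[OF t2 ym(2) qt y(3) X'] .
      have "y' \<in> J t p" using c2(1)[rule_format, of y'] c2(2)[rule_format, of "f p"] y' y'm pm y S Jpq by auto
      then obtain v where v: "v \<in> S1" "ccw t v p" "f v = y'" using J_E[of y' t p] S t y' by metis
      have "ccw s u t \<and> ccw t v s \<and> ccw p u q \<and> ccw q v p"
        using S(1,2) s(1,2) t(1,2) u(1,2) v(1,2) by (simp add: ccw_iff_Arg2pi) (smt (verit))
      then have l: "ccw s u t" "ccw t v s" "ccw p u q" "ccw q v p" by auto
      have "Zplus_nonempty f u v \<longleftrightarrow> \<not> Zplus_nonempty f s t"
        using linked_opposite[OF s(1) u(1) t(1) v(1) l(1,2)] s t u v y' by auto
      then show False using linkedI[OF u(1) v(1) _ l(3,4)] u v by auto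
    next
      fix b a' assume b: "b \<in> S1" "ccw s b q" "f b = f p" and a': "a' \<in> S1" "ccw q a' t" "f a' = f p"
      \<comment> \<open>Here \<open>p\<close>, \<open>b\<close>, \<open>a'\<close> have the same
        value. The pair \<open>p\<close>, \<open>b\<close> is linked with \<open>s\<close>,
        \<open>t\<close> and has the opposite sign; \<open>b\<close>, \<open>a'\<close> inherits
        that sign and crosses \<open>p\<close>, \<open>q\<close>. The next case is its mirror
        image.\<close>
      have "ccw p s b \<and> ccw b t p \<and> ccw p b q \<and> ccw q a' p \<and> ccw p b a'"
        using S(1,2) s(1,2) t(1,2) b(1,2) a'(1,2) by (simp add: ccw_iff_Arg2pi) (smt (verit))
      then have l: "ccw p s b" "ccw b t p" "ccw p b q" "ccw q a' p" "p \<noteq> b" "b \<noteq> a'" "p \<noteq> a'"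
        using ccw_distinct by blast+
      have "Zplus_nonempty f b a' \<longleftrightarrow> Zplus_nonempty f p b"
        using Zplus_fibre[OF S(1) b(1) a'(1) l(5,6,7)] b a' by auto
      moreover have "Zplus_nonempty f s t \<longleftrightarrow> \<not> Zplus_nonempty f p b"
        using linked_opposite[OF S(1) s(1) b(1) t(1) l(1,2) b(3)[symmetric] st(1) st(3)[symmetric]] .
      ultimately show False using linkedI[OF b(1) a'(1) _ l(3,4)] b a' by auto
    next
      fix a b' assume a: "a \<in> S1" "ccw p a s" "f a = f q" and b': "b' \<in> S1" "ccw t b' p" "f b' = f q"
      have "ccw a s q \<and> ccw q t a \<and> ccw p a q \<and> ccw q b' p \<and> ccw q b' a"
        using S(1,2) s(1,2) t(1,2) a(1,2) b'(1,2) by (simp add: ccw_iff_Arg2pi) (smt (verit))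
      then have l: "ccw a s q" "ccw q t a" "ccw p a q" "ccw q b' p" "q \<noteq> a" "a \<noteq> b'" "q \<noteq> b'"
        using ccw_distinct by blast+
      have "Zplus_nonempty f a b' \<longleftrightarrow> Zplus_nonempty f a q"
        using Zplus_fibre[OF S(2) a(1) b'(1) l(5,6,7)] Zplus_sym[OF S(2) a(1) l(5)] a b' by auto
      moreover have "Zplus_nonempty f s t \<longleftrightarrow> \<not> Zplus_nonempty f a q"
        using linked_opposite[OF a(1) s(1) S(2) t(1) l(1,2) a(3) st(1)] a(3) st(4) by metis
      ultimately show False using linkedI[OF a(1) b'(1) _ l(3,4)] a b' by auto
    next
      fix a a' assume a: "a \<in> S1" "ccw p a s" "f a = f q" and a': "a' \<in> S1" "ccw q a' t" "f a' = f p"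
      have "f q \<in> J p s" using in_J_between[OF S(1) s(1) a(1,2)] a by simp
      then have qt: "f q \<in> J p s \<inter> J s q \<inter> J q p" using qm by auto
      have "f p \<in> J q t" using in_J_between[OF S(2) t(1) a'(1,2)] a' by simp
      then have pt: "f p \<in> J q t \<inter> J t p \<inter> J p q" using pm by auto
      obtain c1 where c1: "\<forall>z \<in> J p s \<inter> J q p - {y, f q}. orr X y (f q) z \<longleftrightarrow> c1"
        "\<forall>z \<in> J s q \<inter> J q p - {y, f q}. orr X y (f q) z \<longleftrightarrow> \<not> c1"
        "J p s \<inter> J q p - {y, f q} \<noteq> {}" "J s q \<inter> J q p - {y, f q} \<noteq> {}"
        using tri_split[OF t1 ym(1) qt y(3) X(1) sX(2)] .
      have "y' \<in> J p s" using c1(2)[rule_format, of y'] c1(1)[rule_format, of "f p"] y' y'm pm y S Jpq by auto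
      then obtain u where u: "u \<in> S1" "ccw p u s" "f u = y'" using J_E[of y' p s] S s y' by metis
      obtain c2 where c2: "\<forall>z \<in> J q t \<inter> J p q - {y, f p}. orr X y (f p) z \<longleftrightarrow> c2"
        "\<forall>z \<in> J t p \<inter> J p q - {y, f p}. orr X y (f p) z \<longleftrightarrow> \<not> c2"
        "J q t \<inter> J p q - {y, f p} \<noteq> {}" "J t p \<inter> J p q - {y, f p} \<noteq> {}"
        using tri_split[OF t2 ym(2) pt y(2) X'] .
      have "y' \<in> J q t" using c2(2)[rule_format, of y'] c2(1)[rule_format, of "f q"] y' y'm qm y S Jpq by auto
      then obtain v where v: "v \<in> S1" "ccw q v t" "f v = y'" using J_E[of y' q t] S t y' by metis
      have "ccw u s v \<and> ccw v t u \<and> ccw p u q \<and> ccw q v p"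
        using S(1,2) s(1,2) t(1,2) u(1,2) v(1,2) by (simp add: ccw_iff_Arg2pi) (smt (verit))
      then have l: "ccw u s v" "ccw v t u" "ccw p u q" "ccw q v p" by auto
      have "Zplus_nonempty f u v \<longleftrightarrow> \<not> Zplus_nonempty f s t"
        using linked_opposite[OF u(1) s(1) v(1) t(1) l(1,2)] s t u v y' by auto
      then show False using linkedI[OF u(1) v(1) _ l(3,4)] u v by auto
    qed
  qed
  with base show ?thesis by (cases "b \<longleftrightarrow> Zplus_nonempty f s t") auto
qed

section \<open>The relation of one sign\<close>

definition R :: "bool \<Rightarrow> (complex \<times> complex) set" where
  "R b = {(p, q). p \<in> S1 \<and> q \<in> S1 \<and> (p = q \<or> f p = f q \<and> (Zplus_nonempty f p q \<longleftrightarrow> b))}"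

lemma R_eq: "(p,q) \<in> R b \<Longrightarrow> p \<in> S1 \<and> q \<in> S1 \<and> f p = f q"
  by (auto simp: R_def)

text \<open>The index of \<open>R\<close> is the truth value of \<open>Zplus_nonempty\<close>, which
  holds for negative degeneracy; hence \<open>False\<close> stands for the positive relation. One
  ordering of the pair suffices in \<open>R\<close> by \<open>Zplus_sym\<close>.\<close>

lemma Lplus_R: "Lplus_rel f = R False" and Lminus_R: "Lminus_rel f = R True"
  using Zplus_sym
  by (auto simp: Lplus_rel_def Lminus_rel_def R_def pos_degenerate_def neg_degenerate_def degenerate_def)

lemma equiv_R: "equiv S1 (R b)"
proof (rule equivI)
  show "R b \<subseteq> S1 \<times> S1" by (auto simp: R_def)
  show "refl_on S1 (R b)" by (auto simp: refl_on_def R_def)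
  show "sym (R b)" using Zplus_sym by (auto simp: sym_def R_def)
  show "trans (R b)"
  proof (rule transI)
    fix p q r assume a: "(p,q) \<in> R b" "(q,r) \<in> R b"
    show "(p,r) \<in> R b"
    proof (cases "p = q \<or> q = r \<or> p = r")
      case True
      then show ?thesis using a by (auto simp: R_def)
    next
      case False
      have m: "p \<in> S1" "q \<in> S1" "r \<in> S1" "f p = f q" "f q = f r" "Zplus_nonempty f p q \<longleftrightarrow> b"
        using a False by (auto simp: R_def)
      have "Zplus_nonempty f q p \<longleftrightarrow> Zplus_nonempty f p r"
        using Zplus_fibre[of q p r] m False by auto
      then show ?thesis using Zplus_sym[of p q] m False by (auto simp: R_def)
    qed
  qed
qed

lemma R_noncrossing:
  assumes "(p,q) \<in> R b" "(s,t) \<in> R b" "ccw p s q" "ccw q t p"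
  shows "(p,s) \<in> R b"
proof -
  have m: "p \<in> S1" "q \<in> S1" "s \<in> S1" "t \<in> S1" "f p = f q" "f s = f t" using assms R_eq by blast+
  have ne: "p \<noteq> q" "p \<noteq> s" "q \<noteq> s" using ccw_distinct[OF assms(3)] by auto
  have st: "s \<noteq> t" using assms(3,4) ccw_asym ccw_rotate by blast
  have Z: "Zplus_nonempty f p q \<longleftrightarrow> b" "Zplus_nonempty f s t \<longleftrightarrow> b" using assms ne st by (auto simp: R_def)
  have eq: "f p = f s"
    using linked_opposite[OF m(1,3,2,4) assms(3,4) m(5,6)] Z by blast
  have "Zplus_nonempty f q p \<longleftrightarrow> Zplus_nonempty f p s"
    using Zplus_fibre[of q p s] m ne eq by auto
  then show ?thesis using Zplus_sym[of p q] m ne eq Z by (auto simp: R_def)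
qed

text \<open>Pairs with different values are crossed by either sign; a pair with equal values outside
  \<open>R b\<close> has the other sign, so the opposite pair crossing it has sign
  \<open>b\<close>.\<close>

lemma R_maximal:
  assumes "p \<in> S1" "q \<in> S1" "(p,q) \<notin> R b"
  obtains s t where "(s,t) \<in> R b" "ccw p s q" "ccw q t p"
proof (cases "f p = f q")
  case False
  then obtain s t where "s \<in> S1" "t \<in> S1" "ccw p s q" "ccw q t p" "f s = f t" "Zplus_nonempty f s t \<longleftrightarrow> b"
    using nondegenerate_crossed[OF assms(1,2) False, of b] unfolding opp_cross_def by blast
  then show ?thesis using that[of s t] by (auto simp: R_def)
next
  case True
  have "p \<noteq> q" "Zplus_nonempty f p q \<longleftrightarrow> \<not> b" using assms True by (auto simp: R_def)
  then obtain s t where "s \<in> S1" "t \<in> S1" "ccw p s q" "ccw q t p" "f s = f t" "f s \<noteq> f p"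
      "Zplus_nonempty f s t \<longleftrightarrow> \<not> Zplus_nonempty f p q"
    using degenerate_crossed[OF assms(1,2) _ True] by metis
  then show ?thesis using that[of s t] \<open>Zplus_nonempty f p q \<longleftrightarrow> \<not> b\<close> by (simp add: R_def)
qed

text \<open>A limit of related pairs has equal values by continuity. If it had the wrong sign, a
  pair \<open>s\<close>, \<open>t\<close> of sign \<open>b\<close> from another fibre would cross
  it. Crossing is an open condition, so \<open>s\<close>, \<open>t\<close> would also cross nearby
  related pairs, whose values still differ from \<open>f s\<close>, against
  \<open>R_noncrossing\<close>.\<close>

lemma closed_R: "closed (R b)"
proof -
  have "closedin (top_of_set (S1 \<times> S1)) (R b)"
    unfolding closedin_def
  proof
    show "R b \<subseteq> topspace (top_of_set (S1 \<times> S1))" by (auto simp: R_def)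
    have "openin (top_of_set (S1 \<times> S1)) (S1 \<times> S1 - R b)"
      unfolding openin_subopen[of _ "S1 \<times> S1 - R b"]
    proof
      fix z assume z: "z \<in> S1 \<times> S1 - R b"
      obtain p q where pq: "z = (p,q)" "p \<in> S1" "q \<in> S1" "(p,q) \<notin> R b" using z by auto
      have c1: "continuous_on (S1 \<times> S1) (\<lambda>z. f (fst z))" "continuous_on (S1 \<times> S1) (\<lambda>z. f (snd z))"
        by (intro continuous_on_compose2[OF cont_f] continuous_intros; auto)+
      show "\<exists>T. openin (top_of_set (S1 \<times> S1)) T \<and> z \<in> T \<and> T \<subseteq> S1 \<times> S1 - R b"
      proof (cases "f p = f q")
        case False
        have "openin (top_of_set (S1 \<times> S1)) (S1 \<times> S1 \<inter> (\<lambda>z. f (fst z) - f (snd z)) -` (- {0}))"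
          by (intro continuous_openin_preimage_gen continuous_intros c1)
        moreover have "z \<in> S1 \<times> S1 \<inter> (\<lambda>z. f (fst z) - f (snd z)) -` (- {0})" using pq False by auto
        moreover have "S1 \<times> S1 \<inter> (\<lambda>z. f (fst z) - f (snd z)) -` (- {0}) \<subseteq> S1 \<times> S1 - R b"
          by (auto dest: R_eq)
        ultimately show ?thesis by blast
      next
        case True
        have "p \<noteq> q" and Zb: "Zplus_nonempty f p q \<longleftrightarrow> \<not> b" using pq True by (auto simp: R_def)
        obtain s t where st: "s \<in> S1" "t \<in> S1" "ccw p s q" "ccw q t p" "f s = f t" "f s \<noteq> f p"
            "Zplus_nonempty f s t \<longleftrightarrow> \<not> Zplus_nonempty f p q"
          using degenerate_crossed[OF pq(2,3) \<open>p \<noteq> q\<close> True] .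
        define T where "T = (S1 \<times> S1 \<inter> (\<lambda>z. f (fst z) - f s) -` (- {0})) \<inter>
           {z. ccw (fst z) s (snd z)} \<inter> {z. ccw (snd z) t (fst z)}"
        have "openin (top_of_set (S1 \<times> S1)) (S1 \<times> S1 \<inter> (\<lambda>z. f (fst z) - f s) -` (- {0}))"
          by (intro continuous_openin_preimage_gen continuous_intros c1)
        moreover have "open {z. ccw (fst z) s (snd z)}" "open {z. ccw (snd z) t (fst z)}"
          unfolding ccw_def by (intro open_Collect_less continuous_intros)+
        ultimately have "openin (top_of_set (S1 \<times> S1)) T"
          unfolding T_def by (rule openin_Int_open[OF openin_Int_open])
        moreover have "z \<in> T" using pq st by (auto simp: T_def)
        moreover have "T \<subseteq> S1 \<times> S1 - R b"
        proof
          fix w assume w: "w \<in> T"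
          obtain p' q' where pq': "w = (p',q')" by (meson prod.exhaust)
          have "(p',q') \<notin> R b"
          proof
            assume r: "(p',q') \<in> R b"
            have "(s,t) \<in> R b" using st Zb by (auto simp: R_def)
            from R_noncrossing[OF r this] have "(p',s) \<in> R b" using w pq' by (auto simp: T_def)
            then show False using R_eq[of p' s] w pq' by (auto simp: T_def)
          qed
          then show "w \<in> S1 \<times> S1 - R b" using w pq' by (auto simp: T_def)
        qed
        ultimately show ?thesis by blast
      qed
    qed
    then show "openin (top_of_set (S1 \<times> S1)) (topspace (top_of_set (S1 \<times> S1)) - R b)" by simp
  qed
  moreover have "closed (S1 \<times> S1)" by (simp add: S1_def closed_Times)
  ultimately show ?thesis using closedin_closed_trans by blast
qed

end

subsection \<open>Convex hulls of a maximal lamination\<close>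

text \<open>The signed area behind \<open>ccw\<close>, read as an affine function of the last point:
  its sign separates the two sides of a chord for interior points too.\<close>

definition side :: "complex \<Rightarrow> complex \<Rightarrow> complex \<Rightarrow> real" where
  "side s t a = Im (cnj (t - s) * (a - s))"

lemma ccw_side: "ccw s t a \<longleftrightarrow> 0 < side s t a"
  by (simp add: ccw_def side_def)

lemma side_affine: "side s t ((1 - u) *\<^sub>R a + u *\<^sub>R b) = (1 - u) * side s t a + u * side s t b"
  by (simp add: side_def algebra_simps)

lemma convex_side_pos: "convex {a. 0 < side s t a}" "convex {a. 0 \<le> side s t a}" "convex {a. side s t a < 0}"
proof -
  have e: "side s t a = Im (cnj (t - s)) * Re a + Re (cnj (t - s)) * Im a - Im (cnj (t - s) * s)" for a
    by (simp add: side_def algebra_simps)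
  have e2: "side s t a = inner (Complex (Im (cnj (t - s))) (Re (cnj (t - s)))) a - Im (cnj (t - s) * s)" for a
    unfolding e by (simp add: inner_complex_def)
  show "convex {a. 0 < side s t a}" "convex {a. 0 \<le> side s t a}" "convex {a. side s t a < 0}"
    unfolding e2 by (simp_all only: diff_gt_0_iff_gt diff_ge_0_iff_ge diff_less_0_iff_less
      convex_halfspace_gt convex_halfspace_ge convex_halfspace_lt)
qed

lemma side_swap: "side s t a = - side t s a"
  by (simp add: side_def algebra_simps)

lemma side_zero_segment:
  assumes "side s t a > 0" "side s t b < 0"
  obtains u where "0 < u" "u < 1" "side s t ((1 - u) *\<^sub>R a + u *\<^sub>R b) = 0"
proof
  let ?u = "side s t a / (side s t a - side s t b)"
  show "0 < ?u" "?u < 1" using assms by (auto simp: field_simps)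
  show "side s t ((1 - ?u) *\<^sub>R a + ?u *\<^sub>R b) = 0"
    unfolding side_affine using assms by (simp add: field_simps)
qed

text \<open>The point with affine parameter \<open>u\<close> on the line has squared norm
  \<open>1 - u * (1 - u) * (cmod (t - s))^2\<close>; a value of at most 1 forces \<open>u\<close>
  into the unit interval.\<close>

lemma chord_mem:
  assumes S: "s \<in> S1" "t \<in> S1" "s \<noteq> t" and m: "m \<in> cball 0 1" "side s t m = 0"
  shows "m \<in> closed_segment s t"
proof -
  define r where "r = (m - s) / (t - s)"
  have "Im (cnj (t - s) * (m - s)) = 0" using m by (simp add: side_def)
  moreover have "r = cnj (t - s) * (m - s) / complex_of_real ((cmod (t - s))\<^sup>2)"
    using S unfolding r_def complex_norm_square by (simp add: mult.commute)
  ultimately have "Im r = 0" by (simp add: Im_divide_of_real)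
  then obtain u where u: "r = complex_of_real u" by (metis complex_is_Real_iff Reals_cases)
  have me: "m = s + complex_of_real u * (t - s)"
    using S unfolding u[symmetric] r_def by simp
  have "(cmod m)\<^sup>2 = (cmod s)\<^sup>2 * (1 - u) + (cmod t)\<^sup>2 * u - u * (1 - u) * (cmod (t - s))\<^sup>2"
    unfolding me cmod_power2 by (simp add: power2_eq_square algebra_simps)
  then have "(cmod m)\<^sup>2 = 1 - u * (1 - u) * (cmod (t - s))\<^sup>2"
    using S by (simp add: S1_iff)
  moreover have "(cmod m)\<^sup>2 \<le> 1" using m by (simp add: power_le_one)
  ultimately have "0 \<le> u * (1 - u) * (cmod (t - s))\<^sup>2" by simp
  then have "0 \<le> u * (1 - u)" using S by (simp add: zero_le_mult_iff)
  then have "0 \<le> u" "u \<le> 1" by (auto simp: zero_le_mult_iff)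
  moreover have "m = (1 - u) *\<^sub>R s + u *\<^sub>R t"
    unfolding me by (simp add: scaleR_conv_of_real algebra_simps)
  ultimately show ?thesis unfolding in_segment by blast
qed

text \<open>Circle points are extreme points of the closed disk, so removing one of them leaves a
  convex set.\<close>

lemma convex_hull_delete_S1:
  assumes "\<nu> \<subseteq> cball 0 1" "a \<in> S1" "a \<in> convex hull \<nu>"
  shows "a \<in> \<nu>"
proof (rule ccontr)
  assume "a \<notin> \<nu>"
  have "convex (cball 0 1 - {a})"
    unfolding convex_contains_segment using segment_S1_avoids[OF _ _ assms(2)] by blast
  then have "convex hull \<nu> \<subseteq> cball 0 1 - {a}"
    using assms \<open>a \<notin> \<nu>\<close> by (intro hull_minimal) auto
  then show False using assms by blast
qed

lemma same_norm_inner_less: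
  fixes a b c :: complex
  assumes "dist c a = dist c b" "a \<noteq> b"
  shows "(a - c) \<bullet> (b - a) < 0"
proof -
  have "(norm (b - c))\<^sup>2 = (norm (a - c))\<^sup>2" using assms by (simp add: dist_norm norm_minus_commute)
  then have "(b - c) \<bullet> (b - c) = (a - c) \<bullet> (a - c)" by (simp add: power2_norm_eq_inner)
  moreover have "(b - c) \<bullet> (b - c) = (a - c) \<bullet> (a - c) + 2 * ((a - c) \<bullet> (b - a)) + (b - a) \<bullet> (b - a)"
    by (simp add: inner_diff_left inner_diff_right inner_commute algebra_simps)
  moreover have "0 < (b - a) \<bullet> (b - a)" using assms by simp
  ultimately show ?thesis by linarith
qed

section \<open>Hulls of an abstract maximal lamination, applied later to each sign\<close>

locale lamination =
  fixes R :: "(complex \<times> complex) set"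
  assumes equiv: "equiv S1 R" and closed_rel: "closed R"
    and noncrossing: "\<And>p q s t. (p,q) \<in> R \<Longrightarrow> (s,t) \<in> R \<Longrightarrow> ccw p s q \<Longrightarrow> ccw q t p \<Longrightarrow> (p,s) \<in> R"
    and maximal: "\<And>p q. p \<in> S1 \<Longrightarrow> q \<in> S1 \<Longrightarrow> (p,q) \<notin> R \<Longrightarrow> \<exists>s t. (s,t) \<in> R \<and> ccw p s q \<and> ccw q t p"
begin

lemma R_S1: "(p,q) \<in> R \<Longrightarrow> p \<in> S1 \<and> q \<in> S1"
  using equiv unfolding equiv_def refl_on_def by blast

lemma R_refl: "p \<in> S1 \<Longrightarrow> (p,p) \<in> R"
  using equiv unfolding equiv_def refl_on_def by blast

lemma R_sym: "(p,q) \<in> R \<Longrightarrow> (q,p) \<in> R"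
  using equiv unfolding equiv_def sym_def by blast

lemma R_trans: "(p,q) \<in> R \<Longrightarrow> (q,r) \<in> R \<Longrightarrow> (p,r) \<in> R"
  using equiv unfolding equiv_def trans_def by blast

lemma class_sub: "R `` {p} \<subseteq> S1" "R `` {p} \<subseteq> cball 0 1"
  using R_S1 by (auto simp: S1_def)

lemma hull_sub: "convex hull (R `` {p}) \<subseteq> cball 0 1"
  by (rule hull_minimal[OF class_sub(2)]) simp

lemma closed_class: "closed (R `` {p})"
proof -
  have "R `` {p} = (\<lambda>q. (p,q)) -` R" by auto
  moreover have "closed ((\<lambda>q. (p,q)) -` R)"
    by (intro closed_vimage closed_rel continuous_intros)
  ultimately show ?thesis by simp
qed

lemma compact_class: "compact (R `` {p})"
  using closed_class class_sub(2)[of p] bounded_cball bounded_subset compact_eq_bounded_closed by blast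

text \<open>A class with points on both sides of a leaf contains a pair linked with it and would
  therefore be the class of that leaf.\<close>

lemma class_same_side:
  assumes "(s,t) \<in> R" "(s,a) \<notin> R" "(a,b) \<in> R"
  shows "0 < side s t a \<Longrightarrow> 0 < side s t b" "side s t a < 0 \<Longrightarrow> side s t b < 0"
proof -
  have m: "s \<in> S1" "t \<in> S1" "a \<in> S1" "b \<in> S1" using assms R_S1 by blast+
  have sb: "(s,b) \<notin> R" using assms R_trans R_sym by blast
  have ne: "s \<noteq> a" "t \<noteq> a" "s \<noteq> b" "t \<noteq> b" using assms sb m R_refl by blast+
  show "0 < side s t b" if "0 < side s t a"
  proof (rule ccontr)
    assume "\<not> 0 < side s t b"
    then have nb: "\<not> ccw s t b" by (simp add: ccw_side)
    have at: "ccw s t a" using that by (simp add: ccw_side)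
    have st: "s \<noteq> t" using ccw_distinct[OF at] by auto
    have "ccw s b t" using ccw_total[OF m(1,2,4)] st ne nb by blast
    then show False using noncrossing[OF assms(1) R_sym[OF assms(3)], of] ccw_rotate[OF at] sb by blast
  qed
  show "side s t b < 0" if "side s t a < 0"
  proof (rule ccontr)
    assume n: "\<not> side s t b < 0"
    have ts: "ccw t s a" using that by (simp add: ccw_side side_swap[of t s])
    have st: "s \<noteq> t" using ccw_distinct[OF ts] by auto
    have "\<not> ccw t s b" using n by (simp add: ccw_side side_swap[of t s])
    then have "ccw t b s" using ccw_total[OF m(2,1,4)] st ne by blast
    moreover have "ccw s a t" using ccw_rotate[OF ts] .
    ultimately show False using noncrossing[OF assms(1,3)] assms(2) by blast
  qed
qed

lemma hull_same_side:
  assumes "(s,t) \<in> R" "(s,a) \<notin> R" "w \<in> convex hull (R `` {a})"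
  shows "0 < side s t a \<Longrightarrow> 0 < side s t w" "side s t a < 0 \<Longrightarrow> side s t w < 0"
proof -
  assume "0 < side s t a"
  then have "R `` {a} \<subseteq> {b. 0 < side s t b}" using class_same_side(1)[OF assms(1,2)] by blast
  then have "convex hull (R `` {a}) \<subseteq> {b. 0 < side s t b}" by (intro hull_minimal convex_side_pos)
  then show "0 < side s t w" using assms by blast
next
  assume "side s t a < 0"
  then have "R `` {a} \<subseteq> {b. side s t b < 0}" using class_same_side(2)[OF assms(1,2)] by blast
  then have "convex hull (R `` {a}) \<subseteq> {b. side s t b < 0}" by (intro hull_minimal convex_side_pos)
  then show "side s t w < 0" using assms by blast
qed

text \<open>Unrelated classes are separated by a chord. Cut at \<open>q\<close>, the circle orders
  the class of \<open>p\<close> linearly; the line through its last point \<open>a\<close> and first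
  point \<open>b\<close> has this class on its nonnegative side and the class of \<open>q\<close>
  strictly on the other.\<close>

lemma hulls_disjoint:
  assumes p: "p \<in> S1" "q \<in> S1" and w: "w \<in> convex hull (R `` {p})" "w \<in> convex hull (R `` {q})"
  shows "(p,q) \<in> R"
proof (rule ccontr)
  assume n: "(p,q) \<notin> R"
  have qn: "(x,y) \<notin> R" if "x \<in> R `` {p}" "y \<in> R `` {q}" for x y
    using that n R_trans R_sym by blast
  \<comment> \<open>Since \<open>q\<close> is outside the class of \<open>p\<close>, the argument
    measured from \<open>q\<close> is continuous there and attains its extremes on the compact
    class.\<close>
  define k where "k x = Arg2pi (x / q)" for x
  have xq: "x / q \<notin> \<real>\<^sub>\<ge>\<^sub>0" if "x \<in> R `` {p}" for x
  proof -
    have "x \<noteq> q" using qn[OF that, of q] p R_refl class_sub that by blast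
    moreover have "x \<in> S1" using that class_sub(1) by blast
    then have "cmod (x / q) = 1" using p by (simp add: S1_iff norm_divide)
    moreover have "q \<noteq> 0" using p S1_nz by blast
    ultimately show ?thesis by (auto simp: nonneg_Reals_def)
  qed
  have cont: "continuous_on (R `` {p}) k"
  proof -
    have "continuous_on (R `` {p}) (\<lambda>x. x / q)" using p S1_nz by (intro continuous_intros) auto
    moreover have "continuous_on {z. z \<notin> \<real>\<^sub>\<ge>\<^sub>0} Arg2pi"
      by (intro continuous_at_imp_continuous_on ballI continuous_at_Arg2pi) auto
    ultimately show ?thesis unfolding k_def using xq
      by (intro continuous_on_compose2[of _ Arg2pi "R `` {p}" "\<lambda>z. z / q"]) auto
  qed
  have ne: "R `` {p} \<noteq> {}" using R_refl p by blast
  obtain a where a: "a \<in> R `` {p}" "\<And>x. x \<in> R `` {p} \<Longrightarrow> k x \<le> k a"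
    using continuous_attains_sup[OF compact_class ne cont] by blast
  obtain b where b: "b \<in> R `` {p}" "\<And>x. x \<in> R `` {p} \<Longrightarrow> k b \<le> k x"
    using continuous_attains_inf[OF compact_class ne cont] by blast
  have kle: "k x \<le> k y \<longleftrightarrow> x = q \<or> x = y \<or> ccw q x y" if "x \<in> R `` {p}" "y \<in> R `` {p}" for x y
    unfolding k_def using arc_le_iff[of q x y] p that class_sub unfolding arc_le_def by blast
  have nq: "x \<noteq> q" if "x \<in> R `` {p}" for x using qn[OF that, of q] p R_refl class_sub that by blast
  have aS: "a \<in> S1" "b \<in> S1" using a b class_sub by blast+
  show False
  proof (cases "a = b")
    case True
    then have "x = a" if "x \<in> R `` {p}" for x
      using kle[OF that a(1)] kle[OF a(1) that] a(2)[OF that] b(2)[OF that] nq ccw_asym that a by blast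
    then have "R `` {p} = {a}" using a by blast
    then have "w = a" using w by simp
    then have "a \<in> R `` {q}" using convex_hull_delete_S1[OF class_sub(2) aS(1)] w by blast
    then show False using qn[OF a(1)] R_refl aS by blast
  next
    case False
    have qba: "ccw q b a" using kle[OF b(1) a(1)] b(2)[OF a(1)] nq b False by blast
    have 1: "R `` {p} \<subseteq> {x. 0 \<le> side a b x}"
    proof
      fix x assume x: "x \<in> R `` {p}"
      have xS: "x \<in> S1" using x class_sub by blast
      have "x = a \<or> x = b \<or> ccw q b x \<and> ccw q x a"
        using kle[OF x a(1)] kle[OF b(1) x] a(2)[OF x] b(2)[OF x] nq x b by blast
      then have "x = a \<or> x = b \<or> ccw a b x"
        using ccw_trans(2)[OF p(2) aS(2) xS aS(1)] ccw_rotate by blast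
      then show "x \<in> {x. 0 \<le> side a b x}" by (auto simp: ccw_side) (auto simp: side_def algebra_simps)
    qed
    have 2: "R `` {q} \<subseteq> {x. side a b x < 0}"
    proof
      fix d assume d: "d \<in> R `` {q}"
      have dS: "d \<in> S1" using d class_sub by blast
      have ab: "(a,b) \<in> R" using a b R_sym R_trans by blast
      have "\<not> ccw b d a"
        using noncrossing[OF ab, of q d] d ccw_rotate[OF ccw_rotate[OF qba]] qn[OF a(1), of q] R_refl p by blast
      moreover have "d \<noteq> a" "d \<noteq> b" using qn d a b R_refl aS by blast+
      ultimately have "ccw b a d" using ccw_total[OF aS(2) dS aS(1)] False by blast
      then show "d \<in> {x. side a b x < 0}" by (simp add: ccw_side side_swap[of b a])
    qed
    have "convex hull (R `` {p}) \<subseteq> {x. 0 \<le> side a b x}" by (intro hull_minimal 1 convex_side_pos)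
    moreover have "convex hull (R `` {q}) \<subseteq> {x. side a b x < 0}" by (intro hull_minimal 2 convex_side_pos)
    ultimately show False using w by force
  qed
qed

text \<open>Caratheodory in the plane: every hull point lies in a triangle with vertices in its
  class. The union is thus a continuous image of the compact set of related triples with two affine
  coordinates. This is how closedness of the relation becomes continuity of the quotient
  map.\<close>

lemma compact_hull_union:
  assumes A: "closed A" "A \<subseteq> S1" and sat: "\<And>a b. a \<in> A \<Longrightarrow> (a,b) \<in> R \<Longrightarrow> b \<in> A"
  shows "compact (\<Union>p\<in>A. convex hull (R `` {p}))"
proof -
  define T where "T = {(u::real,v::real). 0 \<le> u \<and> 0 \<le> v \<and> u + v \<le> 1}"
  define M where "M = {((a,b,c),(u,v)). a \<in> A \<and> (a,b) \<in> R \<and> (a,c) \<in> R \<and> (u,v) \<in> T}"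
  define F where "F = (\<lambda>((a,b,c),(u,v)). a + u *\<^sub>R (b - a) + v *\<^sub>R (c - a) :: complex)"
  have "closed M"
  proof -
    have "M = {z. fst (fst z) \<in> A} \<inter> {z. (fst (fst z), fst (snd (fst z))) \<in> R} \<inter>
       {z. (fst (fst z), snd (snd (fst z))) \<in> R} \<inter> {z. 0 \<le> fst (snd z)} \<inter> {z. 0 \<le> snd (snd z)} \<inter>
       {z. fst (snd z) + snd (snd z) \<le> 1}"
      by (auto simp: M_def T_def)
    moreover have "closed {z::(complex\<times>complex\<times>complex)\<times>(real\<times>real). fst (fst z) \<in> A}"
      using closed_vimage[OF A(1), of "\<lambda>z::(complex\<times>complex\<times>complex)\<times>(real\<times>real). fst (fst z)"]
      by (simp add: vimage_def continuous_intros)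
    moreover have "closed {z::(complex\<times>complex\<times>complex)\<times>(real\<times>real). (fst (fst z), fst (snd (fst z))) \<in> R}"
      using closed_vimage[OF closed_rel, of "\<lambda>z::(complex\<times>complex\<times>complex)\<times>(real\<times>real). (fst (fst z), fst (snd (fst z)))"]
      by (simp add: vimage_def continuous_intros)
    moreover have "closed {z::(complex\<times>complex\<times>complex)\<times>(real\<times>real). (fst (fst z), snd (snd (fst z))) \<in> R}"
      using closed_vimage[OF closed_rel, of "\<lambda>z::(complex\<times>complex\<times>complex)\<times>(real\<times>real). (fst (fst z), snd (snd (fst z)))"]
      by (simp add: vimage_def continuous_intros)
    moreover have "closed {z::(complex\<times>complex\<times>complex)\<times>(real\<times>real). 0 \<le> fst (snd z)}"
       "closed {z::(complex\<times>complex\<times>complex)\<times>(real\<times>real). 0 \<le> snd (snd z)}"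
       "closed {z::(complex\<times>complex\<times>complex)\<times>(real\<times>real). fst (snd z) + snd (snd z) \<le> 1}"
      by (intro closed_Collect_le continuous_intros)+
    ultimately show ?thesis by (simp add: closed_Int)
  qed
  moreover have "M \<subseteq> (cball 0 1 \<times> cball 0 1 \<times> cball 0 1) \<times> (cball 0 1 \<times> cball 0 1)"
  proof
    fix z assume "z \<in> M"
    then obtain a b c u v where z: "z = ((a,b,c),(u,v))" "a \<in> A" "(a,b) \<in> R" "(a,c) \<in> R" "(u,v) \<in> T"
      by (auto simp: M_def)
    then have "a \<in> S1" "b \<in> S1" "c \<in> S1" using R_S1 by blast+
    moreover have "\<bar>u\<bar> \<le> 1" "\<bar>v\<bar> \<le> 1" using z by (auto simp: T_def)
    ultimately show "z \<in> (cball 0 1 \<times> cball 0 1 \<times> cball 0 1) \<times> (cball 0 1 \<times> cball 0 1)"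
      using z(1) by (simp add: S1_def)
  qed
  ultimately have "compact M"
    using compact_Int_closed[OF compact_Times[OF compact_Times[OF compact_cball compact_Times[OF compact_cball compact_cball]]
         compact_Times[OF compact_cball compact_cball]]] by (metis inf.absorb_iff2)
  moreover have "continuous_on M F"
    unfolding F_def case_prod_unfold by (intro continuous_intros)
  ultimately have "compact (F ` M)" by (intro compact_continuous_image)
  moreover have "F ` M = (\<Union>p\<in>A. convex hull (R `` {p}))"
  proof (intro equalityI subsetI)
    fix x assume "x \<in> F ` M"
    then obtain a b c u v where z: "x = F ((a,b,c),(u,v))" "a \<in> A" "(a,b) \<in> R" "(a,c) \<in> R" "(u,v) \<in> T"
      by (auto simp: M_def)
    have "x \<in> convex hull {a,b,c}"
      unfolding convex_hull_3_alt using z by (auto simp: F_def T_def)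
    moreover have "convex hull {a,b,c} \<subseteq> convex hull (R `` {a})"
      using z A R_refl by (intro hull_mono) auto
    ultimately show "x \<in> (\<Union>p\<in>A. convex hull (R `` {p}))" using z by blast
  next
    fix x assume "x \<in> (\<Union>p\<in>A. convex hull (R `` {p}))"
    then obtain p where p: "p \<in> A" "x \<in> convex hull (R `` {p})" by blast
    then obtain T' where T': "finite T'" "T' \<subseteq> R `` {p}" "card T' \<le> 3" "x \<in> convex hull T'"
      unfolding caratheodory[of "R `` {p}"] by auto
    have "T' \<noteq> {}" using T' by auto
    then have "card T' \<noteq> 0" using T' by simp
    then consider "card T' = 1" | "card T' = 2" | "card T' = 3" using T' by linarith
    then obtain a b c where abc: "T' = {a,b,c}"
    proof cases
      case 1
      then obtain a where "T' = {a}" by (auto simp: card_1_singleton_iff)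
      then show ?thesis using that[of a a a] by simp
    next
      case 2
      then obtain a b where "T' = {a,b}" by (auto simp: card_2_iff)
      then show ?thesis using that[of a b b] by simp
    next
      case 3
      then obtain a b c where "T' = {a,b,c}" by (auto simp: card_3_iff)
      then show ?thesis using that by simp
    qed
    obtain u v where uv: "0 \<le> u" "0 \<le> v" "u + v \<le> 1" "x = a + u *\<^sub>R (b - a) + v *\<^sub>R (c - a)"
      using T'(4) unfolding abc convex_hull_3_alt by auto
    have "(p,a) \<in> R" "(p,b) \<in> R" "(p,c) \<in> R" using T' abc by auto
    then have "a \<in> A" "(a,b) \<in> R" "(a,c) \<in> R" using sat p R_trans R_sym by blast+
    then have "((a,b,c),(u,v)) \<in> M" using uv by (simp add: M_def T_def)
    moreover have "x = F ((a,b,c),(u,v))" using uv by (simp add: F_def)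
    ultimately show "x \<in> F ` M" by blast
  qed
  ultimately show ?thesis by simp
qed

text \<open>A largest open disk missing all hulls would touch two hulls; the leaf crossing between suitable
  points of the two classes would enter the disk or cross one of the classes.\<close>

lemma hulls_cover:
  assumes "w \<in> cball 0 1"
  obtains p where "p \<in> S1" "w \<in> convex hull (R `` {p})"
proof (rule ccontr)
  assume "\<not> thesis"
  define Q where "Q = (\<Union>p\<in>S1. convex hull (R `` {p}))"
  have wQ: "w \<notin> Q" using \<open>\<not> thesis\<close> that by (auto simp: Q_def)
  have cQ: "compact Q" unfolding Q_def by (rule compact_hull_union) (use R_S1 in \<open>auto simp: S1_def\<close>)
  have SQ: "S1 \<subseteq> Q"
  proof
    fix p assume p: "p \<in> S1"
    then have "p \<in> convex hull (R `` {p})" using R_refl by (intro hull_inc) auto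
    with p show "p \<in> Q" by (auto simp: Q_def)
  qed
  have Qne: "Q \<noteq> {}" using SQ by (auto simp: S1_def)
  have "continuous_on (cball 0 1) (\<lambda>x. infdist x Q)" by (intro continuous_intros)
  then obtain o' where o': "o' \<in> cball 0 1" "\<And>x. x \<in> cball 0 1 \<Longrightarrow> infdist x Q \<le> infdist o' Q"
    using continuous_attains_sup[of "cball (0::complex) 1" "\<lambda>x. infdist x Q"] by auto
  define \<rho> where "\<rho> = infdist o' Q"
  have clQ: "closed Q" using cQ compact_imp_closed by blast
  have \<rho>: "\<rho> > 0"
    using o'(2)[OF assms] infdist_pos_not_in_closed[OF clQ Qne wQ] by (simp add: \<rho>_def)
  have far: "\<rho> \<le> dist o' x" if "x \<in> Q" for x using infdist_le[OF that] by (simp add: \<rho>_def)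
  have ob: "o' \<in> ball 0 1"
  proof -
    have "o' \<notin> S1"
    proof
      assume "o' \<in> S1"
      then have "infdist o' Q = 0" using SQ by auto
      then show False using \<rho> by (simp add: \<rho>_def)
    qed
    then show ?thesis using o'(1) by (auto simp: S1_def)
  qed
  obtain w1 where w1: "w1 \<in> Q" "dist o' w1 = \<rho>"
    using infdist_attains_inf[OF clQ Qne, of o'] unfolding \<rho>_def by metis
  \<comment> \<open>If \<open>w1\<close> were the only contact point, shifting the centre away from
    it would give a larger disk missing \<open>Q\<close>.\<close>
  obtain w2 where w2: "w2 \<in> Q" "dist o' w2 = \<rho>" "w2 \<noteq> w1"
  proof (rule ccontr)
    assume "\<not> thesis"
    then have only: "\<rho> < dist o' z" if "z \<in> Q" "z \<noteq> w1" for z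
      using that far[OF that(1)] \<open>\<And>w2. w2 \<in> Q \<Longrightarrow> dist o' w2 = \<rho> \<Longrightarrow> w2 \<noteq> w1 \<Longrightarrow> thesis\<close> by force
    define K where "K = Q \<inter> {z. (w1 - o') \<bullet> (z - o') \<le> 0}"
    have "closed {z. (w1 - o') \<bullet> (z - o') \<le> 0}" by (intro closed_Collect_le continuous_intros)
    then have cK: "compact K" unfolding K_def using cQ by (rule compact_Int_closed[rotated])
    have n1: "(w1 - o') \<bullet> (w1 - o') = \<rho>\<^sup>2"
      using w1 by (simp add: dist_norm norm_minus_commute power2_norm_eq_inner[symmetric])
    have "\<exists>\<delta>>0. \<forall>z\<in>K. \<rho> + \<delta> \<le> dist o' z"
    proof (cases "K = {}")
      case True
      then show ?thesis by (intro exI[of _ 1]) auto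
    next
      case False
      have "continuous_on K (dist o')" by (intro continuous_intros)
      then obtain z0 where z0: "z0 \<in> K" "\<And>z. z \<in> K \<Longrightarrow> dist o' z0 \<le> dist o' z"
        using continuous_attains_inf[OF cK False, of "dist o'"] by blast
      have "z0 \<noteq> w1" using z0(1) n1 \<rho> by (auto simp: K_def)
      then have "\<rho> < dist o' z0" using only z0(1) by (auto simp: K_def)
      then show ?thesis using z0 by (intro exI[of _ "dist o' z0 - \<rho>"]) auto
    qed
    then obtain \<delta> where \<delta>: "\<delta> > 0" "\<And>z. z \<in> K \<Longrightarrow> \<rho> + \<delta> \<le> dist o' z" by blast
    \<comment> \<open>The first bound keeps the new centre farther than \<open>\<rho>\<close> from
      the points of \<open>K\<close>, which are at distance at least
      \<open>\<rho> + \<delta>\<close> from the old one; the second keeps it in the unit disk.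
      Points of \<open>Q\<close> outside \<open>K\<close> recede under the shift.\<close>
    define t where "t = min (\<delta> / (2 * \<rho>)) ((1 - norm o') / (2 * \<rho>))"
    have t: "t > 0" using \<delta> \<rho> ob by (simp add: t_def)
    have t\<rho>: "t * \<rho> \<le> \<delta> / 2" "t * \<rho> \<le> (1 - norm o') / 2"
    proof -
      have "t * \<rho> \<le> \<delta> / (2 * \<rho>) * \<rho>" "t * \<rho> \<le> (1 - norm o') / (2 * \<rho>) * \<rho>"
        using \<rho> by (intro mult_right_mono; simp add: t_def)+
      then show "t * \<rho> \<le> \<delta> / 2" "t * \<rho> \<le> (1 - norm o') / 2" using \<rho> by auto
    qed
    define o2 where "o2 = o' - t *\<^sub>R (w1 - o')"
    have no: "norm (t *\<^sub>R (w1 - o')) = t * \<rho>"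
      using t w1 by (simp add: dist_norm norm_minus_commute)
    have "norm o2 \<le> norm o' + t * \<rho>" unfolding o2_def using norm_triangle_ineq4[of o' "t *\<^sub>R (w1 - o')"] no by simp
    then have "o2 \<in> cball 0 1" using t\<rho>(2) ob by simp
    then have le: "infdist o2 Q \<le> \<rho>" using o'(2) by (simp add: \<rho>_def)
    obtain z where z: "z \<in> Q" "infdist o2 Q = dist o2 z" using infdist_attains_inf[OF clQ Qne] by blast
    show False
    proof (cases "z \<in> K")
      case True
      have "dist o' z \<le> dist o' o2 + dist o2 z" by (rule dist_triangle)
      moreover have "dist o' o2 = t * \<rho>" using no by (simp add: o2_def dist_norm)
      ultimately show False using \<delta>(1) \<delta>(2)[OF True] le z t\<rho>(1) by linarith
    next
      case False
      then have pos: "0 < (w1 - o') \<bullet> (z - o')" using z by (simp add: K_def)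
      have "(dist o2 z)\<^sup>2 = (z - o2) \<bullet> (z - o2)"
        by (simp only: dist_norm norm_minus_commute[of o2 z] power2_norm_eq_inner)
      also have "z - o2 = (z - o') + t *\<^sub>R (w1 - o')" by (simp add: o2_def)
      also have "\<dots> \<bullet> \<dots> = (z - o') \<bullet> (z - o') + 2 * t * ((w1 - o') \<bullet> (z - o')) + t\<^sup>2 * ((w1 - o') \<bullet> (w1 - o'))"
        by (simp add: inner_add_left inner_add_right inner_commute power2_eq_square algebra_simps)
      also have "(z - o') \<bullet> (z - o') = (dist o' z)\<^sup>2"
        by (simp only: dist_norm norm_minus_commute[of o' z] power2_norm_eq_inner)
      finally have "(dist o2 z)\<^sup>2 = (dist o' z)\<^sup>2 + 2 * t * ((w1 - o') \<bullet> (z - o')) + t\<^sup>2 * ((w1 - o') \<bullet> (w1 - o'))" .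
      moreover have "\<rho>\<^sup>2 \<le> (dist o' z)\<^sup>2" using far[OF z(1)] \<rho> by (simp add: power_mono)
      moreover have "0 < 2 * t * ((w1 - o') \<bullet> (z - o'))" "0 \<le> t\<^sup>2 * ((w1 - o') \<bullet> (w1 - o'))" using pos t by simp_all
      ultimately have "\<rho>\<^sup>2 < (dist o2 z)\<^sup>2" by linarith
      then have "\<rho> < dist o2 z" by (rule power2_less_imp_less) simp
      then show False using le z by simp
    qed
  qed
  obtain p1 where p1: "p1 \<in> S1" "w1 \<in> convex hull (R `` {p1})" using w1 by (auto simp: Q_def)
  obtain p2 where p2: "p2 \<in> S1" "w2 \<in> convex hull (R `` {p2})" using w2 by (auto simp: Q_def)
  have hQ: "convex hull (R `` {p}) \<subseteq> Q" if "p \<in> S1" for p using that by (auto simp: Q_def)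
  have sup: "0 \<le> (w' - o') \<bullet> (x - w')"
    if "p \<in> S1" "w' \<in> convex hull (R `` {p})" "dist o' w' = \<rho>" "x \<in> convex hull (R `` {p})" for p w' x
  proof -
    have "(o' - w') \<bullet> (x - w') \<le> 0"
    proof (rule any_closest_point_dot[of "convex hull (R `` {p})"])
      show "convex (convex hull (R `` {p}))" by simp
      show "closed (convex hull (R `` {p}))" using compact_convex_hull[OF compact_class] compact_imp_closed by blast
      show "\<forall>z\<in>convex hull (R `` {p}). dist o' w' \<le> dist o' z" using far hQ[OF that(1)] that by auto
    qed (use that in auto)
    then show ?thesis by (simp add: inner_diff_left)
  qed
  \<comment> \<open>The contact point is a convex combination of points of its class, all on the
    outer side of the tangent there, so one of them must lie on the tangent itself.\<close>
  have tangent: "\<exists>a. (p,a) \<in> R \<and> (w' - o') \<bullet> (a - w') = 0"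
    if "p \<in> S1" "w' \<in> convex hull (R `` {p})" "dist o' w' = \<rho>" for p w'
  proof (rule ccontr)
    assume "\<not> ?thesis"
    moreover have "0 \<le> (w' - o') \<bullet> (a - w')" if "(p,a) \<in> R" for a
      using sup[OF \<open>p \<in> S1\<close> \<open>w' \<in> _\<close> \<open>dist o' w' = \<rho>\<close>] that hull_inc[of a "R `` {p}"] by auto
    ultimately have "R `` {p} \<subseteq> {a. (w' - o') \<bullet> a > (w' - o') \<bullet> w'}"
      by (force simp: inner_diff_right)
    then have "convex hull (R `` {p}) \<subseteq> {a. (w' - o') \<bullet> a > (w' - o') \<bullet> w'}"
      by (intro hull_minimal) (simp_all add: convex_halfspace_gt)
    then show False using that by auto
  qed
  obtain a where a: "(p1,a) \<in> R" "(w1 - o') \<bullet> (a - w1) = 0" using tangent[OF p1 w1(2)] by blast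
  obtain d where d: "(p2,d) \<in> R" "(w2 - o') \<bullet> (d - w2) = 0" using tangent[OF p2 w2(2)] by blast
  have cl: "R `` {a} = R `` {p1}" "R `` {d} = R `` {p2}"
    using a d R_trans R_sym by blast+
  have lt12: "(w1 - o') \<bullet> (w2 - w1) < 0" "(w2 - o') \<bullet> (w1 - w2) < 0"
    using same_norm_inner_less[of o' w1 w2] same_norm_inner_less[of o' w2 w1] w1 w2 by auto
  \<comment> \<open>In a common class \<open>w2\<close> would belong to the hull supported at
    \<open>w1\<close>, but it lies strictly on the inner side of the tangent at
    \<open>w1\<close>.\<close>
  have p12: "(a,d) \<notin> R"
  proof
    assume "(a,d) \<in> R"
    then have "R `` {a} = R `` {d}" using R_trans R_sym by blast
    then have "w2 \<in> convex hull (R `` {p1})" using p2 cl by simp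
    then show False using sup[OF p1 w1(2)] lt12 by force
  qed
  have aS: "a \<in> S1" "d \<in> S1" using a d R_S1 by blast+
  obtain s t where st: "(s,t) \<in> R" "ccw a s d" "ccw d t a" using maximal[OF aS p12] by blast
  have sS: "s \<in> S1" "t \<in> S1" using st R_S1 by blast+
  have "ccw s t a \<and> ccw t s d"
    using aS sS st(2,3) by (simp add: ccw_iff_Arg2pi) (smt (verit))
  then have sd: "0 < side s t a" "side s t d < 0" "s \<noteq> t"
    using ccw_distinct by (auto simp: ccw_side side_swap[of t s])
  have chord: "m \<in> convex hull (R `` {s})" if "m \<in> cball 0 1" "side s t m = 0" for m
  proof -
    have "m \<in> closed_segment s t" using chord_mem[OF sS sd(3) that] .
    moreover have "closed_segment s t \<subseteq> convex hull (R `` {s})"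
      using st R_refl sS by (intro closed_segment_subset) (auto intro: hull_inc)
    ultimately show ?thesis by blast
  qed
  have wcb: "w1 \<in> cball 0 1" "w2 \<in> cball 0 1" "a \<in> cball 0 1" "d \<in> cball 0 1"
    using p1(2) p2(2) hull_sub aS S1_def sphere_cball by blast+
  have cvx: "(1 - u) *\<^sub>R x + u *\<^sub>R y \<in> cball 0 1" if "x \<in> cball 0 1" "y \<in> cball 0 1" "0 < u" "u < 1" for x y :: complex and u
    using convexD[OF convex_cball that(1,2), of "1 - u" u] that by simp
  \<comment> \<open>The leaf \<open>s\<close>, \<open>t\<close> separates \<open>a\<close> from
    \<open>d\<close>. If it belongs to the class of \<open>a\<close>, it meets the segment from
    \<open>a\<close> to \<open>w2\<close> in a point of that hull on the inner side of the tangent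
    at \<open>w1\<close>; the second case is symmetric. If it belongs to neither class, it separates
    \<open>w1\<close> from \<open>w2\<close> and enters the open disk between them.\<close>
  consider "(s,a) \<in> R" "(s,d) \<notin> R" | "(s,d) \<in> R" "(s,a) \<notin> R" | "(s,a) \<notin> R" "(s,d) \<notin> R"
    using p12 R_trans R_sym by blast
  then show False
  proof cases
    case 1
    have "side s t w2 < 0" using hull_same_side(2)[OF st(1) 1(2)] p2 cl sd by auto
    then obtain u where u: "0 < u" "u < 1" "side s t ((1 - u) *\<^sub>R a + u *\<^sub>R w2) = 0"
      using side_zero_segment[OF sd(1)] by blast
    have "(1 - u) *\<^sub>R a + u *\<^sub>R w2 \<in> convex hull (R `` {s})"
      by (rule chord[OF cvx u(3)]) (use wcb u in auto)
    moreover have "R `` {s} = R `` {p1}" using 1 cl R_trans R_sym by blast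
    ultimately have "0 \<le> (w1 - o') \<bullet> ((1 - u) *\<^sub>R a + u *\<^sub>R w2 - w1)" using sup[OF p1 w1(2)] by auto
    also have "(1 - u) *\<^sub>R a + u *\<^sub>R w2 - w1 = (1 - u) *\<^sub>R (a - w1) + u *\<^sub>R (w2 - w1)"
      by (simp add: algebra_simps)
    also have "(w1 - o') \<bullet> \<dots> = u * ((w1 - o') \<bullet> (w2 - w1))"
      using a(2) by (simp add: inner_add_right)
    finally show False using lt12 u by (simp add: zero_le_mult_iff)
  next
    case 2
    have "side s t w1 > 0" using hull_same_side(1)[OF st(1) 2(2)] p1 cl sd by auto
    then obtain u where u: "0 < u" "u < 1" "side s t ((1 - u) *\<^sub>R w1 + u *\<^sub>R d) = 0"
      using side_zero_segment sd(2) by blast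
    have "(1 - u) *\<^sub>R w1 + u *\<^sub>R d \<in> convex hull (R `` {s})"
      by (rule chord[OF cvx u(3)]) (use wcb u in auto)
    moreover have "R `` {s} = R `` {p2}" using 2 cl R_trans R_sym by blast
    ultimately have "0 \<le> (w2 - o') \<bullet> ((1 - u) *\<^sub>R w1 + u *\<^sub>R d - w2)" using sup[OF p2 w2(2)] by auto
    also have "(1 - u) *\<^sub>R w1 + u *\<^sub>R d - w2 = (1 - u) *\<^sub>R (w1 - w2) + u *\<^sub>R (d - w2)"
      by (simp add: algebra_simps)
    also have "(w2 - o') \<bullet> \<dots> = (1 - u) * ((w2 - o') \<bullet> (w1 - w2))"
      using d(2) by (simp add: inner_add_right)
    finally show False using lt12 u by (simp add: zero_le_mult_iff)
  next
    case 3
    have "side s t w1 > 0" "side s t w2 < 0"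
      using hull_same_side(1)[OF st(1) 3(1)] hull_same_side(2)[OF st(1) 3(2)] p1 p2 cl sd by auto
    then obtain u where u: "0 < u" "u < 1" "side s t ((1 - u) *\<^sub>R w1 + u *\<^sub>R w2) = 0"
      using side_zero_segment by blast
    let ?m = "(1 - u) *\<^sub>R w1 + u *\<^sub>R w2"
    have "?m \<in> Q" using chord[OF cvx u(3)] wcb u hQ sS by blast
    then have "\<rho> \<le> dist o' ?m" by (rule far)
    moreover have "?m \<in> open_segment w1 w2" using u w2 by (auto simp: in_segment)
    then have "dist o' ?m < \<rho>" using dist_decreases_open_segment[of ?m w1 w2 o'] w1 w2 by auto
    ultimately show False by simp
  qed
qed

end

subsection \<open>From the Poincare to the Klein model\<close>

definition klein :: "complex \<Rightarrow> complex" where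
  "klein z = (2 / (1 + (cmod z)\<^sup>2)) *\<^sub>R z"

definition klein_inv :: "complex \<Rightarrow> complex" where
  "klein_inv w = (1 / (1 + sqrt (1 - (cmod w)\<^sup>2))) *\<^sub>R w"

text \<open>Minkowski product of the lifts \<open>(1, p)\<close> and \<open>(1, q)\<close> with
  signature (+, -, -); points of the open disk lift to timelike vectors.\<close>

definition mk :: "complex \<Rightarrow> complex \<Rightarrow> real" where
  "mk p q = 1 - p \<bullet> q"

lemma mk_commute: "mk p q = mk q p"
  by (simp add: mk_def inner_commute)

lemma mk_self: "mk p p = 1 - (cmod p)\<^sup>2"
  by (simp add: mk_def dot_square_norm)

lemma one_plus_norm_pos: "0 < 1 + (cmod z)\<^sup>2"
  by (simp add: add_pos_nonneg)

lemma mk_klein: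
  "mk (klein x) (klein y) = ((1 + (cmod x)\<^sup>2) * (1 + (cmod y)\<^sup>2) - 4 * (x \<bullet> y)) / ((1 + (cmod x)\<^sup>2) * (1 + (cmod y)\<^sup>2))"
proof -
  have "1 - 2 / A * (2 / B * s) = (A * B - 4 * s) / (A * B)" if "A \<noteq> 0" "B \<noteq> 0" for A B s :: real
    using that by (simp add: field_simps)
  from this[of "1 + (cmod x)\<^sup>2" "1 + (cmod y)\<^sup>2" "x \<bullet> y"]
  show ?thesis
    using one_plus_norm_pos[of x] one_plus_norm_pos[of y] by (simp add: mk_def klein_def mult_ac)
qed

lemma mk_klein_self: "mk (klein x) (klein x) = ((1 - (cmod x)\<^sup>2) / (1 + (cmod x)\<^sup>2))\<^sup>2"
  using one_plus_norm_pos[of x] unfolding mk_klein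
  by (simp add: dot_square_norm power2_eq_square field_simps)

lemma klein_ball: "x \<in> ball 0 1 \<Longrightarrow> klein x \<in> ball 0 1"
proof -
  assume x: "x \<in> ball 0 1"
  then have "(cmod x)\<^sup>2 < 1" by (simp add: abs_square_less_1)
  then have "0 < mk (klein x) (klein x)"
    unfolding mk_klein_self using one_plus_norm_pos[of x] by simp
  then show ?thesis unfolding mk_self by (simp add: abs_square_less_1)
qed

lemma klein_S1: "x \<in> S1 \<Longrightarrow> klein x = x"
  by (simp add: klein_def S1_iff)

lemma klein_cball: "x \<in> cball 0 1 \<Longrightarrow> klein x \<in> cball 0 1"
  using klein_ball[of x] klein_S1[of x] by (cases "cmod x = 1") (auto simp: S1_iff)

lemma klein_inv_klein:
  assumes "x \<in> cball 0 1"
  shows "klein_inv (klein x) = x"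
proof -
  have p: "0 < 1 + (cmod x)\<^sup>2" by (rule one_plus_norm_pos)
  have le: "(cmod x)\<^sup>2 \<le> 1" using assms by (simp add: abs_square_le_1)
  have "sqrt (1 - (cmod (klein x))\<^sup>2) = (1 - (cmod x)\<^sup>2) / (1 + (cmod x)\<^sup>2)"
    using mk_klein_self[of x] le p unfolding mk_self by (simp add: real_sqrt_abs abs_of_nonneg)
  then have "1 + sqrt (1 - (cmod (klein x))\<^sup>2) = 2 / (1 + (cmod x)\<^sup>2)"
    using p by (simp add: field_simps)
  then have "klein_inv (klein x) = (1 / (2 / (1 + (cmod x)\<^sup>2))) *\<^sub>R klein x"
    by (simp only: klein_inv_def)
  also have "\<dots> = ((1 / (2 / (1 + (cmod x)\<^sup>2))) * (2 / (1 + (cmod x)\<^sup>2))) *\<^sub>R x"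
    by (simp only: klein_def scaleR_scaleR)
  also have "(1 / (2 / (1 + (cmod x)\<^sup>2))) * (2 / (1 + (cmod x)\<^sup>2)) = 1"
    using p by (metis divide_self_if less_irrefl mult.commute nonzero_eq_divide_eq zero_neq_numeral divide_eq_0_iff)
  finally show ?thesis by simp
qed

lemma klein_klein_inv:
  assumes "w \<in> cball 0 1"
  shows "klein (klein_inv w) = w" "klein_inv w \<in> cball 0 1" "w \<in> ball 0 1 \<Longrightarrow> klein_inv w \<in> ball 0 1"
proof -
  define r where "r = sqrt (1 - (cmod w)\<^sup>2)"
  have le: "(cmod w)\<^sup>2 \<le> 1" using assms by (simp add: abs_square_le_1)
  have r: "0 \<le> r" "r\<^sup>2 = 1 - (cmod w)\<^sup>2" using le by (auto simp: r_def)
  have n: "(cmod (klein_inv w))\<^sup>2 = (1 - r) / (1 + r)"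
  proof -
    have "(cmod (klein_inv w))\<^sup>2 = (cmod w)\<^sup>2 / (1 + r)\<^sup>2"
      using r by (simp add: klein_inv_def r_def[symmetric] power_divide norm_divide)
    also have "(cmod w)\<^sup>2 = (1 - r) * (1 + r)" using r by (simp add: power2_eq_square algebra_simps)
    finally show ?thesis using r by (simp add: power2_eq_square)
  qed
  have "1 + (cmod (klein_inv w))\<^sup>2 = 2 / (1 + r)" unfolding n using r by (simp add: field_simps)
  then show "klein (klein_inv w) = w"
    using r by (simp add: klein_def) (simp add: klein_inv_def r_def[symmetric])
  have "(cmod (klein_inv w))\<^sup>2 \<le> 1" unfolding n using r by (simp add: field_simps)
  then show "klein_inv w \<in> cball 0 1" by (simp add: abs_square_le_1)
  assume "w \<in> ball 0 1"
  then have "(cmod w)\<^sup>2 < 1" by (simp add: abs_square_less_1)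
  then have "0 < r" by (simp add: r_def)
  then have "(cmod (klein_inv w))\<^sup>2 < 1" unfolding n by (simp add: field_simps)
  then show "klein_inv w \<in> ball 0 1" by (simp add: abs_square_less_1)
qed

lemma continuous_on_klein: "continuous_on A klein"
  unfolding klein_def using one_plus_norm_pos by (intro continuous_intros) (metis less_irrefl)

lemma continuous_on_klein_inv: "continuous_on (cball 0 1) klein_inv"
proof -
  have "1 + sqrt (1 - (cmod w)\<^sup>2) \<noteq> 0" if "w \<in> cball 0 1" for w
  proof -
    have "(cmod w)\<^sup>2 \<le> 1" using that by (simp add: abs_square_le_1)
    then have "0 \<le> sqrt (1 - (cmod w)\<^sup>2)" by simp
    then show ?thesis by linarith
  qed
  then show ?thesis unfolding klein_inv_def by (intro continuous_intros) auto
qed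

lemma mk_reverse_cauchy:
  assumes "p \<in> ball 0 1" "q \<in> ball 0 1" "p \<noteq> q"
  shows "mk p p * mk q q < (mk p q)\<^sup>2"
proof -
  define d where "d = q - p"
  have q: "q = p + d" by (simp add: d_def)
  have "(mk p q)\<^sup>2 - mk p p * mk q q = d \<bullet> d - (Re p * Im d - Im p * Re d)\<^sup>2"
    unfolding q mk_def inner_complex_def by (simp add: power2_eq_square algebra_simps)
  also have "(Re p * Im d - Im p * Re d)\<^sup>2 = (p \<bullet> p) * (d \<bullet> d) - (p \<bullet> d)\<^sup>2"
    unfolding inner_complex_def by (simp add: power2_eq_square algebra_simps)
  finally have "(mk p q)\<^sup>2 - mk p p * mk q q = d \<bullet> d * (1 - p \<bullet> p) + (p \<bullet> d)\<^sup>2"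
    by (simp add: algebra_simps)
  moreover have "0 < d \<bullet> d" using assms by (simp add: d_def)
  moreover have "0 < 1 - p \<bullet> p" using assms by (simp add: dot_square_norm abs_square_less_1)
  ultimately show ?thesis by (smt (verit) mult_pos_pos zero_le_power2)
qed

text \<open>The Gram determinant of the lifts of \<open>p\<close>, \<open>m\<close>,
  \<open>q\<close> is the square of their determinant, which is \<open>side p q m\<close>.
  Multiplied by \<open>mk m m\<close> it takes the form needed for equality in the triangle
  inequality.\<close>

lemma mk_gram:
  "(mk p m)\<^sup>2 * (mk m q)\<^sup>2 + mk p p * (mk m m)\<^sup>2 * mk q q - (mk p m)\<^sup>2 * mk m m * mk q q - mk p p * mk m m * (mk m q)\<^sup>2
     - (mk p q * mk m m - mk p m * mk m q)\<^sup>2 = mk m m * (side p q m)\<^sup>2"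
proof -
  have det: "mk p p * mk m m * mk q q - (mk p m)\<^sup>2 * mk q q - mk p p * (mk m q)\<^sup>2 - (mk p q)\<^sup>2 * mk m m
      + 2 * mk p q * mk p m * mk m q = (side p q m)\<^sup>2"
    unfolding mk_def inner_complex_def side_def by (simp add: power2_eq_square algebra_simps)
  have "(mk p m)\<^sup>2 * (mk m q)\<^sup>2 + mk p p * (mk m m)\<^sup>2 * mk q q - (mk p m)\<^sup>2 * mk m m * mk q q - mk p p * mk m m * (mk m q)\<^sup>2
     - (mk p q * mk m m - mk p m * mk m q)\<^sup>2
     = mk m m * (mk p p * mk m m * mk q q - (mk p m)\<^sup>2 * mk q q - mk p p * (mk m q)\<^sup>2 - (mk p q)\<^sup>2 * mk m m
      + 2 * mk p q * mk p m * mk m q)"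
    by (simp add: power2_eq_square algebra_simps)
  then show ?thesis unfolding det .
qed

lemma line_param:
  assumes "side p q m = 0" "p \<noteq> q"
  obtains u where "m = (1 - u) *\<^sub>R p + u *\<^sub>R q"
proof -
  define r where "r = (m - p) / (q - p)"
  have "Im (cnj (q - p) * (m - p)) = 0" using assms by (simp add: side_def)
  moreover have "r = cnj (q - p) * (m - p) / complex_of_real ((cmod (q - p))\<^sup>2)"
    using assms unfolding r_def complex_norm_square by (simp add: mult.commute)
  ultimately have "Im r = 0" by (simp add: Im_divide_of_real)
  then obtain u where u: "r = complex_of_real u" by (metis complex_is_Real_iff Reals_cases)
  have "m = p + complex_of_real u * (q - p)"
    using assms unfolding u[symmetric] r_def by simp
  then show ?thesis using that[of u] by (simp add: scaleR_conv_of_real algebra_simps)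
qed

text \<open>For \<open>m = (1 - u) *\<^sub>R p + u *\<^sub>R q\<close> is meant the affine parameter
  \<open>u\<close>: the expression equals \<open>u * (1 - u)\<close> times the positive defect in
  the reverse Cauchy inequality, so its sign tells whether \<open>m\<close> is between. If
  \<open>p = q\<close>, collinearity says nothing and the reverse inequality forces
  \<open>m = p\<close>.\<close>

lemma mk_between:
  assumes B: "p \<in> ball 0 1" "q \<in> ball 0 1" "m \<in> ball 0 1"
  shows "side p q m = 0 \<and> 0 \<le> mk p q * mk m m - mk p m * mk m q \<longleftrightarrow> m \<in> closed_segment p q"
proof (cases "p = q")
  case True
  show ?thesis
  proof (cases "m = p")
    case True
    then show ?thesis using \<open>p = q\<close> by (simp add: side_def)
  next
    case False
    then have "mk p p * mk m m < (mk p m)\<^sup>2"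
      using mk_reverse_cauchy[OF B(1,3)] by auto
    then have "mk p q * mk m m - mk p m * mk m q < 0"
      unfolding True[symmetric] mk_commute[of m p] power2_eq_square by linarith
    then show ?thesis using False True by auto
  qed
next
  case False
  have f: "mk p q * mk m m - mk p m * mk m q = u * (1 - u) * ((mk p q)\<^sup>2 - mk p p * mk q q)"
    if "m = (1 - u) *\<^sub>R p + u *\<^sub>R q" for u
    unfolding that mk_def by (simp add: inner_add_left inner_add_right inner_commute power2_eq_square algebra_simps)
  have pos: "0 < (mk p q)\<^sup>2 - mk p p * mk q q" using mk_reverse_cauchy[OF B(1,2) False] by simp
  show ?thesis
  proof
    assume h: "side p q m = 0 \<and> 0 \<le> mk p q * mk m m - mk p m * mk m q"
    then obtain u where u: "m = (1 - u) *\<^sub>R p + u *\<^sub>R q" using line_param False by blast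
    have "0 \<le> u * (1 - u)" using h f[OF u] pos by (simp add: zero_le_mult_iff)
    then have "0 \<le> u" "u \<le> 1" by (auto simp: zero_le_mult_iff)
    then show "m \<in> closed_segment p q" unfolding in_segment using u by blast
  next
    assume "m \<in> closed_segment p q"
    then obtain u where u: "0 \<le> u" "u \<le> 1" "m = (1 - u) *\<^sub>R p + u *\<^sub>R q" unfolding in_segment by blast
    have "side p q m = 0" unfolding u(3) side_affine by (simp add: side_def algebra_simps)
    moreover have "0 \<le> mk p q * mk m m - mk p m * mk m q" unfolding f[OF u(3)] using u pos by simp
    ultimately show "side p q m = 0 \<and> 0 \<le> mk p q * mk m m - mk p m * mk m q" by blast
  qed
qed

lemma arcosh_add_eq:
  assumes "1 \<le> a" "1 \<le> b" "1 \<le> (c::real)"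
  shows "arcosh a + arcosh b = arcosh c \<longleftrightarrow> a * b \<le> c \<and> (c - a * b)\<^sup>2 = (a\<^sup>2 - 1) * (b\<^sup>2 - 1)"
proof -
  have "arcosh a + arcosh b = arcosh c \<longleftrightarrow> cosh (arcosh a + arcosh b) = cosh (arcosh c)"
    using assms arcosh_nonneg_real by (metis add_nonneg_nonneg arcosh_cosh_real)
  also have "\<dots> \<longleftrightarrow> sqrt (a\<^sup>2 - 1) * sqrt (b\<^sup>2 - 1) = c - a * b"
    using assms by (auto simp: cosh_add cosh_arcosh_real sinh_arcosh_real)
  also have "\<dots> \<longleftrightarrow> a * b \<le> c \<and> (c - a * b)\<^sup>2 = (a\<^sup>2 - 1) * (b\<^sup>2 - 1)"
  proof -
    have n: "0 \<le> a\<^sup>2 - 1" "0 \<le> b\<^sup>2 - 1" using assms by (simp_all add: one_le_power)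
    have s: "sqrt (a\<^sup>2 - 1) * sqrt (b\<^sup>2 - 1) = sqrt ((a\<^sup>2 - 1) * (b\<^sup>2 - 1))" by (simp add: real_sqrt_mult)
    show ?thesis unfolding s
    proof
      assume e: "sqrt ((a\<^sup>2 - 1) * (b\<^sup>2 - 1)) = c - a * b"
      then have "0 \<le> c - a * b" using n by (metis mult_nonneg_nonneg real_sqrt_ge_zero)
      moreover have "(c - a * b)\<^sup>2 = (a\<^sup>2 - 1) * (b\<^sup>2 - 1)" unfolding e[symmetric] using n by simp
      ultimately show "a * b \<le> c \<and> (c - a * b)\<^sup>2 = (a\<^sup>2 - 1) * (b\<^sup>2 - 1)" by simp
    next
      assume "a * b \<le> c \<and> (c - a * b)\<^sup>2 = (a\<^sup>2 - 1) * (b\<^sup>2 - 1)"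
      then show "sqrt ((a\<^sup>2 - 1) * (b\<^sup>2 - 1)) = c - a * b" by (metis abs_of_nonneg diff_ge_0_iff_ge real_sqrt_abs)
    qed
  qed
  finally show ?thesis .
qed

text \<open>\<open>cosh\<close> of the distance is the normalised Minkowski product of the Klein
  points. The addition formula turns additivity of distances into an equation with a sign condition;
  by \<open>mk_gram\<close> the equation says collinearity, and the sign selects the
  segment.\<close>

lemma hdist_between:
  assumes B: "x \<in> ball 0 1" "y \<in> ball 0 1" "z \<in> ball 0 1"
  shows "hdist x z + hdist z y = hdist x y \<longleftrightarrow> klein z \<in> closed_segment (klein x) (klein y)"
proof -
  \<comment> \<open>\<open>G x\<close> scales the lift of \<open>klein x\<close> to the unit
    hyperboloid, see \<open>Gm\<close>; \<open>ch\<close> is the argument of \<open>arcosh\<close>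
    in \<open>hdist\<close>.\<close>
  define G where "G x = (1 + (cmod x)\<^sup>2) / (1 - (cmod x)\<^sup>2)" for x
  define ch where "ch x y = 1 + 2 * (cmod (x - y))\<^sup>2 / ((1 - (cmod x)\<^sup>2) * (1 - (cmod y)\<^sup>2))" for x y
  have lt: "(cmod x)\<^sup>2 < 1" if "x \<in> ball 0 1" for x using that by (simp add: abs_square_less_1)
  have Gp: "0 < G x" if "x \<in> ball 0 1" for x
    using lt[OF that] one_plus_norm_pos[of x] by (simp add: G_def)
  have Gm: "(G x)\<^sup>2 * mk (klein x) (klein x) = 1" if "x \<in> ball 0 1" for x
    using lt[OF that] one_plus_norm_pos[of x] unfolding mk_klein_self G_def by (simp add: power_divide power_mult_distrib[symmetric])
  have ch1: "1 \<le> ch x y" if "x \<in> ball 0 1" "y \<in> ball 0 1" for x y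
    using lt[OF that(1)] lt[OF that(2)] by (simp add: ch_def)
  have chG: "ch x y = G x * G y * mk (klein x) (klein y)" if "x \<in> ball 0 1" "y \<in> ball 0 1" for x y
  proof -
    have n: "(cmod (x - y))\<^sup>2 = (cmod x)\<^sup>2 + (cmod y)\<^sup>2 - 2 * (x \<bullet> y)"
      unfolding power2_norm_eq_inner by (simp add: inner_diff_left inner_diff_right inner_commute)
    have nz: "1 - (cmod x)\<^sup>2 \<noteq> 0" "1 - (cmod y)\<^sup>2 \<noteq> 0" "1 + (cmod x)\<^sup>2 \<noteq> 0" "1 + (cmod y)\<^sup>2 \<noteq> 0"
      using lt[OF that(1)] lt[OF that(2)] one_plus_norm_pos[of x] one_plus_norm_pos[of y] by linarith+
    have "ch x y = ((1 + (cmod x)\<^sup>2) * (1 + (cmod y)\<^sup>2) - 4 * (x \<bullet> y)) / ((1 - (cmod x)\<^sup>2) * (1 - (cmod y)\<^sup>2))"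
    proof -
      have "(1 - (cmod x)\<^sup>2) * (1 - (cmod y)\<^sup>2) + 2 * ((cmod x)\<^sup>2 + (cmod y)\<^sup>2 - 2 * (x \<bullet> y))
          = (1 + (cmod x)\<^sup>2) * (1 + (cmod y)\<^sup>2) - 4 * (x \<bullet> y)" by (simp add: algebra_simps)
      moreover have "1 + N / d = (d + N) / d" if "d \<noteq> 0" for N d :: real using that by (simp add: add_divide_distrib)
      ultimately show ?thesis unfolding ch_def n using nz by (metis mult_eq_0_iff)
    qed
    also have "\<dots> = G x * G y * mk (klein x) (klein y)"
      unfolding mk_klein G_def using nz by simp
    finally show ?thesis .
  qed
  define p q m where "p = klein x" and "q = klein y" and "m = klein z"
  define g h k where "g = G x" and "h = G y" and "k = G z"
  have P: "p \<in> ball 0 1" "q \<in> ball 0 1" "m \<in> ball 0 1" using B klein_ball by (auto simp: p_def q_def m_def)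
  have gp: "0 < g" "0 < h" "0 < k" using Gp B by (auto simp: g_def h_def k_def)
  have gm: "g\<^sup>2 * mk p p = 1" "h\<^sup>2 * mk q q = 1" "k\<^sup>2 * mk m m = 1"
    using Gm B by (auto simp: g_def h_def k_def p_def q_def m_def)
  have c: "ch x z = g * k * mk p m" "ch z y = k * h * mk m q" "ch x y = g * h * mk p q"
    using chG B by (auto simp: g_def h_def k_def p_def q_def m_def)
  define \<Phi> where "\<Phi> = mk p q * mk m m - mk p m * mk m q"
  have d: "ch x y - ch x z * ch z y = g * h * k\<^sup>2 * \<Phi>"
  proof -
    have "g * h * k\<^sup>2 * \<Phi> = g * h * mk p q * (k\<^sup>2 * mk m m) - g * h * k\<^sup>2 * mk p m * mk m q"
      unfolding \<Phi>_def by (simp add: algebra_simps)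
    then show ?thesis unfolding c gm by (simp add: power2_eq_square algebra_simps)
  qed
  have a2: "(ch x z)\<^sup>2 - 1 = g\<^sup>2 * k\<^sup>2 * ((mk p m)\<^sup>2 - mk p p * mk m m)"
  proof -
    have "g\<^sup>2 * k\<^sup>2 * ((mk p m)\<^sup>2 - mk p p * mk m m) = g\<^sup>2 * k\<^sup>2 * (mk p m)\<^sup>2 - (g\<^sup>2 * mk p p) * (k\<^sup>2 * mk m m)"
      by (simp add: algebra_simps)
    then show ?thesis unfolding c gm by (simp add: power_mult_distrib)
  qed
  have b2: "(ch z y)\<^sup>2 - 1 = k\<^sup>2 * h\<^sup>2 * ((mk m q)\<^sup>2 - mk m m * mk q q)"
  proof -
    have "k\<^sup>2 * h\<^sup>2 * ((mk m q)\<^sup>2 - mk m m * mk q q) = k\<^sup>2 * h\<^sup>2 * (mk m q)\<^sup>2 - (k\<^sup>2 * mk m m) * (h\<^sup>2 * mk q q)"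
      by (simp add: algebra_simps)
    then show ?thesis unfolding c gm by (simp add: power_mult_distrib)
  qed
  have "hdist x z + hdist z y = hdist x y \<longleftrightarrow> arcosh (ch x z) + arcosh (ch z y) = arcosh (ch x y)"
    by (simp add: hdist_def ch_def)
  also have "\<dots> \<longleftrightarrow> ch x z * ch z y \<le> ch x y \<and> (ch x y - ch x z * ch z y)\<^sup>2 = ((ch x z)\<^sup>2 - 1) * ((ch z y)\<^sup>2 - 1)"
    by (rule arcosh_add_eq) (use ch1 B in auto)
  also have "\<dots> \<longleftrightarrow> 0 \<le> \<Phi> \<and> \<Phi>\<^sup>2 = ((mk p m)\<^sup>2 - mk p p * mk m m) * ((mk m q)\<^sup>2 - mk m m * mk q q)"
  proof -
    have pos: "0 < g * h * k\<^sup>2" using gp by simp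
    have "ch x z * ch z y \<le> ch x y \<longleftrightarrow> 0 \<le> g * h * k\<^sup>2 * \<Phi>" unfolding d[symmetric] by simp
    also have "\<dots> \<longleftrightarrow> 0 \<le> \<Phi>" using mult_le_cancel_left_pos[OF pos, of 0 \<Phi>] by (simp only: mult_zero_right)
    finally have 1: "ch x z * ch z y \<le> ch x y \<longleftrightarrow> 0 \<le> \<Phi>" .
    have e1: "(g * h * k\<^sup>2 * \<Phi>)\<^sup>2 = (g * h * k\<^sup>2)\<^sup>2 * \<Phi>\<^sup>2" by (rule power_mult_distrib)
    have e2: "g\<^sup>2 * k\<^sup>2 * u * (k\<^sup>2 * h\<^sup>2 * v) = (g * h * k\<^sup>2)\<^sup>2 * (u * v)" for u v
      by (simp add: power2_eq_square algebra_simps)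
    have "(ch x y - ch x z * ch z y)\<^sup>2 = ((ch x z)\<^sup>2 - 1) * ((ch z y)\<^sup>2 - 1) \<longleftrightarrow>
        (g * h * k\<^sup>2)\<^sup>2 * \<Phi>\<^sup>2 = (g * h * k\<^sup>2)\<^sup>2 * (((mk p m)\<^sup>2 - mk p p * mk m m) * ((mk m q)\<^sup>2 - mk m m * mk q q))"
      unfolding d a2 b2 e1 e2 ..
    also have "\<dots> \<longleftrightarrow> \<Phi>\<^sup>2 = ((mk p m)\<^sup>2 - mk p p * mk m m) * ((mk m q)\<^sup>2 - mk m m * mk q q)"
      using mult_left_cancel[of "(g * h * k\<^sup>2)\<^sup>2"] pos by (metis less_irrefl power_not_zero)
    finally show ?thesis using 1 by blast
  qed
  also have "\<dots> \<longleftrightarrow> side p q m = 0 \<and> 0 \<le> \<Phi>"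
  proof -
    have "((mk p m)\<^sup>2 - mk p p * mk m m) * ((mk m q)\<^sup>2 - mk m m * mk q q) - \<Phi>\<^sup>2 = mk m m * (side p q m)\<^sup>2"
      unfolding mk_gram[symmetric] \<Phi>_def by (simp add: power2_eq_square algebra_simps)
    moreover have "mk m m \<noteq> 0" using gm(3) by auto
    ultimately show ?thesis by (metis diff_eq_diff_eq cancel_comm_monoid_add_class.diff_cancel mult_eq_0_iff power2_eq_iff_nonneg zero_eq_power2 eq_iff_diff_eq_0)
  qed
  also have "\<dots> \<longleftrightarrow> m \<in> closed_segment p q" unfolding \<Phi>_def by (rule mk_between[OF P])
  finally show ?thesis by (simp add: p_def q_def m_def)
qed

text \<open>The Klein preimage of the Euclidean hull is itself one of the sets intersected in
  \<open>hhull\<close>. Conversely, the Klein image of any such set is convex, and its closure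
  contains \<open>\<nu>\<close> and so the Euclidean hull; \<open>klein_inv\<close> is continuous up
  to the circle and carries this back.\<close>

lemma hhull_eq:
  assumes \<nu>: "compact \<nu>" "\<nu> \<subseteq> S1" and two: "p \<in> \<nu>" "q \<in> \<nu>" "p \<noteq> q"
  shows "hhull \<nu> = {z \<in> ball 0 1. klein z \<in> convex hull \<nu>}"
proof
  define H where "H = convex hull \<nu>"
  define C0 where "C0 = {z \<in> ball 0 1. klein z \<in> H}"
  have cH: "closed H" unfolding H_def using compact_convex_hull[OF \<nu>(1)] compact_imp_closed by blast
  have "hconvex C0"
    unfolding hconvex_def
  proof (intro conjI ballI impI)
    show "C0 \<subseteq> PD" by (auto simp: C0_def PD_def)
    fix x y z assume a: "x \<in> C0" "y \<in> C0" "z \<in> PD" "hdist x z + hdist z y = hdist x y"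
    have "klein z \<in> closed_segment (klein x) (klein y)"
      using hdist_between[of x y z] a by (auto simp: C0_def PD_def)
    moreover have "closed_segment (klein x) (klein y) \<subseteq> H"
      using a by (intro closed_segment_subset) (auto simp: C0_def H_def)
    ultimately show "z \<in> C0" using a by (auto simp: C0_def PD_def)
  qed
  moreover have "closedin (top_of_set PD) C0"
  proof -
    have "closedin (top_of_set PD) (PD \<inter> klein -` H)"
      by (rule continuous_closedin_preimage[OF continuous_on_klein cH])
    moreover have "PD \<inter> klein -` H = C0" by (auto simp: C0_def PD_def)
    ultimately show ?thesis by simp
  qed
  moreover have "\<nu> \<subseteq> closure C0"
  proof
    fix a assume a: "a \<in> \<nu>"
    obtain b where b: "b \<in> \<nu>" "b \<noteq> a" using two by metis
    have S: "a \<in> S1" "b \<in> S1" using a b \<nu> by auto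
    \<comment> \<open>A second point of \<open>\<nu>\<close> is used here: the ideal point
      \<open>a\<close> is approached along the chord to \<open>b\<close>, whose interior lies in the
      disk and in the hull.\<close>
    define l where "l u = klein_inv ((1 - u) *\<^sub>R a + u *\<^sub>R b)" for u :: real
    have cb: "(1 - u) *\<^sub>R a + u *\<^sub>R b \<in> cball 0 1" if "u \<in> {0..1}" for u
      using convexD[OF convex_cball, of a 0 1 b "1 - u" u] S that by (simp add: S1_def)
    have "continuous_on (closure {0<..<1}) l"
      unfolding l_def
      by (intro continuous_on_compose2[OF continuous_on_klein_inv] continuous_intros) (use cb in auto)
    moreover have "l ` {0<..<1} \<subseteq> closure C0"
    proof
      fix y assume "y \<in> l ` {0<..<1}"
      then obtain u where u: "0 < u" "u < 1" "y = l u" by auto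
      define m where "m = (1 - u) *\<^sub>R a + u *\<^sub>R b"
      have os: "m \<in> open_segment a b" using u b by (auto simp: in_segment m_def)
      have mb: "m \<in> ball 0 1" using dist_decreases_open_segment[OF os, of 0] S by (auto simp: S1_def)
      have "m \<in> H" using os a b closed_segment_subset[of a H b] open_closed_segment[OF os]
        unfolding H_def by (meson convex_convex_hull hull_inc subsetD closed_segment_subset)
      then have "y \<in> C0" using u mb klein_klein_inv[of m] by (auto simp: C0_def l_def m_def)
      then show "y \<in> closure C0" using closure_subset by blast
    qed
    ultimately have "l ` closure {0<..<1} \<subseteq> closure C0"
      by (intro image_closure_subset) auto
    moreover have "l 0 = a" using S klein_inv_klein[of a] klein_S1[of a] by (simp add: l_def S1_def)
    moreover have "(0::real) \<in> closure {0<..<1}" by simp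
    ultimately show "a \<in> closure C0" by (metis image_subset_iff)
  qed
  ultimately show "hhull \<nu> \<subseteq> {z \<in> ball 0 1. klein z \<in> convex hull \<nu>}"
    unfolding hhull_def C0_def H_def by blast
next
  show "{z \<in> ball 0 1. klein z \<in> convex hull \<nu>} \<subseteq> hhull \<nu>"
    unfolding hhull_def
  proof (intro subsetI InterI)
    fix z C assume z: "z \<in> {z \<in> ball 0 1. klein z \<in> convex hull \<nu>}"
      and "C \<in> {C. hconvex C \<and> closedin (top_of_set PD) C \<and> \<nu> \<subseteq> closure C}"
    then have C: "hconvex C" "closedin (top_of_set PD) C" "\<nu> \<subseteq> closure C" by auto
    have CP: "C \<subseteq> ball 0 1" using C(1) by (auto simp: hconvex_def PD_def)
    have clC: "closure C \<subseteq> cball 0 1" using CP by (intro closure_minimal) auto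
    have "convex (klein ` C)"
      unfolding convex_contains_segment
    proof (intro ballI subsetI)
      fix a b m assume a: "a \<in> klein ` C" "b \<in> klein ` C" and m: "m \<in> closed_segment a b"
      obtain x y where xy: "x \<in> C" "y \<in> C" "a = klein x" "b = klein y" using a by auto
      have ab: "a \<in> ball 0 1" "b \<in> ball 0 1" using xy CP klein_ball by auto
      have mb: "m \<in> ball 0 1" using m closed_segment_subset[OF ab convex_ball] by blast
      define w where "w = klein_inv m"
      have w: "w \<in> ball 0 1" "klein w = m" using klein_klein_inv[of m] mb by (auto simp: w_def)
      have "hdist x w + hdist w y = hdist x y"
      proof -
        have "x \<in> ball 0 1" "y \<in> ball 0 1" using xy CP by blast+
        then show ?thesis using hdist_between[of x y w] xy w m by simp
      qed
      then have "w \<in> C" using C(1) xy w unfolding hconvex_def PD_def by blast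
      then show "m \<in> klein ` C" using w by blast
    qed
    then have cvx: "convex (closure (klein ` C))" by (rule convex_closure)
    have "\<nu> \<subseteq> closure (klein ` C)"
    proof
      fix a assume a: "a \<in> \<nu>"
      have "klein ` closure C \<subseteq> closure (klein ` C)"
        using image_closure_subset[OF continuous_on_klein, of "closure (klein ` C)" C] closure_subset[of "klein ` C"] by auto
      moreover have "klein a = a" using a \<nu> klein_S1 by blast
      ultimately show "a \<in> closure (klein ` C)" using a C(3) by (metis image_subset_iff subsetD)
    qed
    then have "convex hull \<nu> \<subseteq> closure (klein ` C)" using cvx by (intro hull_minimal)
    then have kz: "klein z \<in> closure (klein ` C)" using z by blast
    have kc: "closure (klein ` C) \<subseteq> cball 0 1"
      using CP klein_ball by (intro closure_minimal) (auto, force)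
    have "klein_inv ` klein ` C \<subseteq> closure C"
      using klein_inv_klein CP closure_subset[of C] by (fastforce simp: image_iff)
    then have "klein_inv ` closure (klein ` C) \<subseteq> closure C"
      by (intro image_closure_subset continuous_on_subset[OF continuous_on_klein_inv kc]) auto
    then have "klein_inv (klein z) \<in> closure C" using kz by blast
    then have "z \<in> closure C" using klein_inv_klein[of z] z by auto
    moreover obtain T where "closed T" "C = PD \<inter> T" using C(2) by (auto simp: closedin_closed)
    ultimately show "z \<in> C" using z closure_minimal[of C T] by (auto simp: PD_def)
  qed
qed

subsection \<open>The quotient map\<close>

definition flat :: "real^3 \<Rightarrow> complex" where
  "flat x = Complex (x $ 1) (x $ 2)"

lemma norm_vec3: "(norm (x::real^3))\<^sup>2 = (x $ 1)\<^sup>2 + (x $ 2)\<^sup>2 + (x $ 3)\<^sup>2"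
  unfolding power2_norm_eq_inner by (simp add: inner_vec_def sum_3 power2_eq_square)

lemma hemi_nth [simp]: "hemi b z $ 1 = Re z" "hemi b z $ 2 = Im z"
  "hemi b z $ 3 = (if b then 1 else -1) * sqrt (1 - (cmod z)\<^sup>2)"
  by (simp_all add: hemi_def)

lemma flat_hemi [simp]: "flat (hemi b z) = z"
  by (simp add: flat_def)

lemma eqemb_hemi: "z \<in> S1 \<Longrightarrow> eqemb z = hemi b z"
  by (simp add: eqemb_def hemi_def S1_iff)

lemma hemi_S2f: "z \<in> cball 0 1 \<Longrightarrow> hemi b z \<in> S2f"
proof -
  assume "z \<in> cball 0 1"
  then have "(cmod z)\<^sup>2 \<le> 1" by (simp add: abs_square_le_1)
  then have "(norm (hemi b z))\<^sup>2 = 1" unfolding norm_vec3 by (auto simp: cmod_power2)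
  then have "norm (hemi b z) = 1" by (simp add: power2_eq_1_iff) (metis norm_ge_zero neg_0_le_iff_le not_one_le_zero)
  then show ?thesis by (simp add: S2f_def)
qed

lemma S2f_hemi:
  assumes "x \<in> S2f"
  shows "flat x \<in> cball 0 1" "x = hemi (0 \<le> x $ 3) (flat x)"
proof -
  have e: "(x $ 1)\<^sup>2 + (x $ 2)\<^sup>2 + (x $ 3)\<^sup>2 = 1"
    using assms norm_vec3[of x] by (simp add: S2f_def)
  have f: "(cmod (flat x))\<^sup>2 = 1 - (x $ 3)\<^sup>2" using e by (simp add: flat_def cmod_power2)
  then have "(cmod (flat x))\<^sup>2 \<le> 1" by simp
  then show "flat x \<in> cball 0 1" by (simp add: abs_square_le_1)
  show "x = hemi (0 \<le> x $ 3) (flat x)"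
    unfolding vec_eq_iff forall_3 using f by (simp add: flat_def)
qed

lemma continuous_on_hemi: "continuous_on A (hemi b)"
proof -
  define s :: real where "s = (if b then 1 else -1)"
  have "hemi b = (\<lambda>z. \<chi> i. if i = 1 then Re z else if i = 2 then Im z else s * sqrt (1 - (cmod z)\<^sup>2))"
    by (auto simp: fun_eq_iff vec_eq_iff forall_3 s_def)
  moreover have "continuous_on A (\<lambda>z. if i = (1::3) then Re z else if i = 2 then Im z else s * sqrt (1 - (cmod z)\<^sup>2))" for i
    by (cases "i = 1"; cases "i = 2") (auto intro!: continuous_intros)
  ultimately show ?thesis by (simp add: continuous_on_vec_lambda)
qed

lemma hemi_sign:
  assumes "z \<in> ball 0 1"
  shows "0 \<le> hemi b z $ 3 \<longleftrightarrow> b"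
proof -
  have "(cmod z)\<^sup>2 < 1" using assms by (simp add: abs_square_less_1)
  then show ?thesis by (cases b) auto
qed

text \<open>\<open>klein\<close> fixes the circle, and the circle points of the convex hull are
  exactly those of \<open>\<nu>\<close>; so ideal points and hyperbolic hull together form one Klein
  preimage.\<close>

lemma hemi_hull_eq:
  assumes \<nu>: "compact \<nu>" "\<nu> \<subseteq> S1" and two: "p \<in> \<nu>" "q \<in> \<nu>" "p \<noteq> q"
  shows "eqemb ` \<nu> \<union> hemi b ` hhull \<nu> = hemi b ` {z \<in> cball 0 1. klein z \<in> convex hull \<nu>}"
proof -
  have cb: "\<nu> \<subseteq> cball 0 1" using \<nu> by (auto simp: S1_def)
  have "{z \<in> cball 0 1. klein z \<in> convex hull \<nu>} = \<nu> \<union> hhull \<nu>"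
  proof (intro equalityI subsetI)
    fix z assume z: "z \<in> {z \<in> cball 0 1. klein z \<in> convex hull \<nu>}"
    show "z \<in> \<nu> \<union> hhull \<nu>"
    proof (cases "z \<in> S1")
      case True
      then have "z \<in> convex hull \<nu>" using z klein_S1 by auto
      then show ?thesis using convex_hull_delete_S1[OF cb True] by blast
    next
      case False
      then have "z \<in> ball 0 1" using z by (auto simp: S1_def)
      then show ?thesis using z hhull_eq[OF assms] by auto
    qed
  next
    fix z assume "z \<in> \<nu> \<union> hhull \<nu>"
    then show "z \<in> {z \<in> cball 0 1. klein z \<in> convex hull \<nu>}"
    proof
      assume z: "z \<in> \<nu>"
      have "klein z = z" using z \<nu> klein_S1 by blast
      moreover have "z \<in> convex hull \<nu>" using z by (rule hull_inc)
      ultimately show ?thesis using z cb by auto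
    next
      assume "z \<in> hhull \<nu>"
      then show ?thesis unfolding hhull_eq[OF assms] by auto
    qed
  qed
  moreover have "eqemb ` \<nu> = hemi b ` \<nu>" using \<nu> eqemb_hemi by (intro image_cong) auto
  ultimately show ?thesis by (simp add: image_Un)
qed

section \<open>Construction and continuity of the quotient map\<close>

context wheel
begin

lemma lamination_R: "lamination (R b)"
proof
  show "equiv S1 (R b)" by (rule equiv_R)
  show "closed (R b)" by (rule closed_R)
  show "(p,s) \<in> R b" if "(p,q) \<in> R b" "(s,t) \<in> R b" "ccw p s q" "ccw q t p" for p q s t
    using R_noncrossing that by blast
  show "\<exists>s t. (s,t) \<in> R b \<and> ccw p s q \<and> ccw q t p" if "p \<in> S1" "q \<in> S1" "(p,q) \<notin> R b" for p q
    using R_maximal[OF that] by blast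
qed

text \<open>The upper hemisphere carries \<open>Lplus_rel f = R False\<close>, hence the negations.\<close>

definition Hull :: "bool \<Rightarrow> complex \<Rightarrow> complex set" where
  "Hull b p = convex hull (R (\<not> b) `` {p})"

text \<open>Any parameter whose hull contains \<open>w\<close> would do: all of them belong to one
  class, so \<open>f\<close> has the same value there, see \<open>Hull_same\<close>.\<close>

definition sel :: "bool \<Rightarrow> complex \<Rightarrow> complex" where
  "sel b w = (SOME p. p \<in> S1 \<and> w \<in> Hull b p)"

definition F :: "real^3 \<Rightarrow> real^3" where
  "F x = f (sel (0 \<le> x $ 3) (klein (flat x)))"

lemma sel: "w \<in> cball 0 1 \<Longrightarrow> sel b w \<in> S1 \<and> w \<in> Hull b (sel b w)"
  unfolding sel_def using someI_ex[of "\<lambda>p. p \<in> S1 \<and> w \<in> Hull b p"]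
    lamination.hulls_cover[OF lamination_R, of w "\<not> b"] unfolding Hull_def by blast

lemma Hull_same: "p \<in> S1 \<Longrightarrow> q \<in> S1 \<Longrightarrow> w \<in> Hull b p \<Longrightarrow> w \<in> Hull b q \<Longrightarrow> f p = f q"
  using lamination.hulls_disjoint[OF lamination_R] R_eq unfolding Hull_def by blast

lemma self_Hull: "p \<in> S1 \<Longrightarrow> p \<in> Hull b p"
  unfolding Hull_def by (intro hull_inc) (simp add: R_def)

lemma F_eqemb: "p \<in> S1 \<Longrightarrow> F (eqemb p) = f p"
proof -
  assume p: "p \<in> S1"
  have e: "eqemb p = hemi True p" using eqemb_hemi p by blast
  have "F (eqemb p) = f (sel True p)"
    unfolding F_def e using p klein_S1 by (simp add: S1_iff)
  also have "\<dots> = f p"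
    using sel[of p True] self_Hull[OF p] Hull_same[of "sel True p" p p True] p by (auto simp: S1_def)
  finally show ?thesis .
qed

lemma F_hemi:
  assumes "z \<in> cball 0 1" "p \<in> S1" "klein z \<in> Hull b p"
  shows "F (hemi b z) = f p"
proof (cases "z \<in> S1")
  case True
  \<comment> \<open>On the equator \<open>F\<close> always consults the upper hemisphere, whatever
    \<open>b\<close> is; \<open>F_eqemb\<close> makes both sides agree there.\<close>
  have "F (hemi b z) = f z" using F_eqemb[OF True] eqemb_hemi[OF True] by metis
  also have "f z = f p" using Hull_same[of z p z b] assms True self_Hull klein_S1 by metis
  finally show ?thesis .
next
  case False
  then have "z \<in> ball 0 1" using assms by (auto simp: S1_def)
  then have "F (hemi b z) = f (sel b (klein z))" unfolding F_def using hemi_sign[of z b] by simp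
  also have "\<dots> = f p" using sel[of "klein z" b] klein_cball[OF assms(1)] Hull_same assms by blast
  finally show ?thesis .
qed

text \<open>Preimages are described by hulls over the parameters with values in \<open>T\<close>,
  the shape to which \<open>compact_hull_union\<close> applies.\<close>

lemma F_preimage:
  assumes "T \<subseteq> S2"
  shows "{x \<in> S2f. F x \<in> T} = (\<Union>b. hemi b ` {z \<in> cball 0 1. \<exists>p\<in>S1. f p \<in> T \<and> klein z \<in> Hull b p})"
proof (intro equalityI subsetI)
  fix x assume x: "x \<in> {x \<in> S2f. F x \<in> T}"
  define b where "b = (0 \<le> x $ 3)"
  have h: "flat x \<in> cball 0 1" "x = hemi b (flat x)" using S2f_hemi x by (auto simp: b_def)
  have "sel b (klein (flat x)) \<in> S1" "klein (flat x) \<in> Hull b (sel b (klein (flat x)))"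
    using sel klein_cball[OF h(1)] by auto
  moreover have "F x = f (sel b (klein (flat x)))" by (simp add: F_def b_def)
  ultimately have "flat x \<in> {z \<in> cball 0 1. \<exists>p\<in>S1. f p \<in> T \<and> klein z \<in> Hull b p}"
    using h(1) x by auto
  then show "x \<in> (\<Union>b. hemi b ` {z \<in> cball 0 1. \<exists>p\<in>S1. f p \<in> T \<and> klein z \<in> Hull b p})"
    using h(2) by blast
next
  fix x assume "x \<in> (\<Union>b. hemi b ` {z \<in> cball 0 1. \<exists>p\<in>S1. f p \<in> T \<and> klein z \<in> Hull b p})"
  then obtain b z p where "x = hemi b z" "z \<in> cball 0 1" "p \<in> S1" "f p \<in> T" "klein z \<in> Hull b p" by blast
  then show "x \<in> {x \<in> S2f. F x \<in> T}" using F_hemi hemi_S2f by auto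
qed

lemma F_in_S2: "x \<in> S2f \<Longrightarrow> F x \<in> S2"
proof -
  assume "x \<in> S2f"
  then have "sel (0 \<le> x $ 3) (klein (flat x)) \<in> S1" using sel klein_cball S2f_hemi(1) by blast
  then show ?thesis unfolding F_def using image_f by blast
qed

lemma eqemb_S2f: "p \<in> S1 \<Longrightarrow> eqemb p \<in> S2f"
  using hemi_S2f[of p True] eqemb_hemi[of p True] by (simp add: S1_def)

lemma F_image: "F ` S2f = S2"
proof (intro equalityI subsetI)
  fix y assume "y \<in> S2"
  then obtain p where "p \<in> S1" "y = f p" using image_f by blast
  then have "y = F (eqemb p)" "eqemb p \<in> S2f" using F_eqemb eqemb_S2f by auto
  then show "y \<in> F ` S2f" by blast
qed (use F_in_S2 in blast)

lemma closed_S2f: "closed S2f" "compact S2f"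
  by (simp_all add: S2f_def)

lemma continuous_F: "continuous_on S2f F"
proof -
  have "closed (F -` T \<inter> S2f)" if T: "closed T" for T
  proof -
    define A where "A = {p \<in> S1. f p \<in> T \<inter> S2}"
    have "closed A"
    proof -
      have "closedin (top_of_set S1) (S1 \<inter> f -` (T \<inter> S2))"
        by (rule continuous_closedin_preimage[OF cont_f]) (use T in \<open>simp add: closed_Int S2_def\<close>)
      moreover have "S1 \<inter> f -` (T \<inter> S2) = A" by (auto simp: A_def)
      moreover have "closed S1" by (simp add: S1_def)
      ultimately show ?thesis using closedin_closed_trans by metis
    qed
    have "compact (hemi b ` {z \<in> cball 0 1. \<exists>p\<in>S1. f p \<in> T \<inter> S2 \<and> klein z \<in> Hull b p})" for b
    proof -
      have "compact (\<Union>p\<in>A. Hull b p)"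
        unfolding Hull_def
        by (rule lamination.compact_hull_union[OF lamination_R \<open>closed A\<close>]) (use R_eq in \<open>auto simp: A_def\<close>)
      then have "closed (\<Union>p\<in>A. Hull b p)" by (rule compact_imp_closed)
      then have "closedin (top_of_set (cball 0 1)) (cball 0 1 \<inter> klein -` (\<Union>p\<in>A. Hull b p))"
        by (rule continuous_closedin_preimage[OF continuous_on_klein])
      then have "compact (cball 0 1 \<inter> klein -` (\<Union>p\<in>A. Hull b p))"
        using closedin_compact compact_cball by blast
      moreover have "cball 0 1 \<inter> klein -` (\<Union>p\<in>A. Hull b p) = {z \<in> cball 0 1. \<exists>p\<in>S1. f p \<in> T \<inter> S2 \<and> klein z \<in> Hull b p}"
        by (auto simp: A_def)
      ultimately show ?thesis by (metis compact_continuous_image continuous_on_hemi)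
    qed
    then have "compact (\<Union>b. hemi b ` {z \<in> cball 0 1. \<exists>p\<in>S1. f p \<in> T \<inter> S2 \<and> klein z \<in> Hull b p})"
      by (intro compact_UN) auto
    then have "compact {x \<in> S2f. F x \<in> T \<inter> S2}" by (subst F_preimage) auto
    moreover have "{x \<in> S2f. F x \<in> T \<inter> S2} = F -` T \<inter> S2f" using F_in_S2 by auto
    ultimately show ?thesis using compact_imp_closed by metis
  qed
  then show ?thesis using continuous_on_closed_vimage[OF closed_S2f(1)] by blast
qed

section \<open>Fibres of the quotient map and elements of the decomposition\<close>

definition Fib :: "real^3 \<Rightarrow> (real^3) set" where
  "Fib y = {x \<in> S2f. F x = y}"

definition fb :: "real^3 \<Rightarrow> complex set" where
  "fb y = {p \<in> S1. f p = y}"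

lemma fb_sign:
  assumes p: "p \<in> fb y" "q \<in> fb y" "p \<noteq> q" and r: "r \<in> fb y" "s \<in> fb y" "r \<noteq> s"
  shows "Zplus_nonempty f r s \<longleftrightarrow> Zplus_nonempty f p q"
proof -
  note D = p[unfolded fb_def] r[unfolded fb_def]
  have 1: "Zplus_nonempty f p u \<longleftrightarrow> Zplus_nonempty f p q" if "u \<in> fb y" "u \<noteq> p" for u
  proof (cases "u = q")
    case False
    then show ?thesis
      using Zplus_fibre[of q p u] Zplus_sym[of p q] p that by (auto simp: fb_def)
  qed auto
  show ?thesis
  proof (cases "r = p")
    case True
    then show ?thesis using 1 r by blast
  next
    case rp: False
    show ?thesis
    proof (cases "s = p")
      case True
      then show ?thesis using 1[OF r(1) rp] Zplus_sym[of r s] r by (auto simp: fb_def)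
    next
      case False
      then show ?thesis using 1[OF r(1) rp] Zplus_fibre[of p r s] p r rp by (auto simp: fb_def)
    qed
  qed
qed

text \<open>Constancy of the sign makes a fibre with at least two points a single class for its own
  sign and a set of trivial classes for the other. So it is filled in by a hull in one hemisphere
  only.\<close>

lemma class_fb:
  assumes p: "p \<in> fb y" "q \<in> fb y" "p \<noteq> q" and r: "r \<in> fb y"
  shows "R (Zplus_nonempty f p q) `` {r} = fb y" "R (\<not> Zplus_nonempty f p q) `` {r} = {r}"
proof -
  have Z: "Zplus_nonempty f r s \<longleftrightarrow> Zplus_nonempty f p q" if "s \<in> fb y" "r \<noteq> s" for s
    using fb_sign[OF p r that] .
  have rs: "r \<in> S1" "f r = y" using r by (auto simp: fb_def)
  have iff: "s \<in> R b `` {r} \<longleftrightarrow> s \<in> fb y \<and> (s = r \<or> (Zplus_nonempty f r s \<longleftrightarrow> b))" for s b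
    using rs by (auto simp: R_def fb_def)
  show "R (Zplus_nonempty f p q) `` {r} = fb y" using Z iff by blast
  show "R (\<not> Zplus_nonempty f p q) `` {r} = {r}"
  proof (rule set_eqI)
    show "s \<in> R (\<not> Zplus_nonempty f p q) `` {r} \<longleftrightarrow> s \<in> {r}" for s
      using iff[of s "\<not> Zplus_nonempty f p q"] Z[of s] r by auto
  qed
qed

lemma Fib_eq: "Fib y = (\<Union>b. hemi b ` {z \<in> cball 0 1. \<exists>p\<in>fb y. klein z \<in> Hull b p})" if "y \<in> S2"
proof -
  have "Fib y = {x \<in> S2f. F x \<in> {y}}" by (auto simp: Fib_def)
  also have "\<dots> = (\<Union>b. hemi b ` {z \<in> cball 0 1. \<exists>p\<in>S1. f p \<in> {y} \<and> klein z \<in> Hull b p})"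
    by (rule F_preimage) (use that in auto)
  also have "\<dots> = (\<Union>b. hemi b ` {z \<in> cball 0 1. \<exists>p\<in>fb y. klein z \<in> Hull b p})"
    unfolding fb_def by (intro arg_cong[of _ _ Union] image_cong refl arg_cong2[of _ _ _ _ image]) auto
  finally show ?thesis .
qed

lemma klein_eq_S1: "z \<in> cball 0 1 \<Longrightarrow> p \<in> S1 \<Longrightarrow> klein z = p \<Longrightarrow> z = p"
  using klein_inv_klein[of z] klein_inv_klein[of p] klein_S1[of p] by (auto simp: S1_def)

lemma Fib_single:
  assumes "fb y = {p}"
  shows "Fib y = {eqemb p}"
proof -
  have p: "p \<in> S1" "f p = y" using assms by (auto simp: fb_def)
  have yS: "y \<in> S2" using p image_f by blast
  have "R b `` {p} = {p}" for b
  proof -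
    have "q = p" if "(p,q) \<in> R b" for q
    proof -
      have "q \<in> fb y" using R_eq[OF that] p by (simp add: fb_def)
      then show ?thesis using assms by simp
    qed
    moreover have "(p,p) \<in> R b" using p by (simp add: R_def)
    ultimately show ?thesis by blast
  qed
  then have H: "Hull b p = {p}" for b by (simp add: Hull_def)
  have "{z \<in> cball 0 1. \<exists>p\<in>fb y. klein z \<in> Hull b p} = {p}" for b
    unfolding assms using H klein_eq_S1 p klein_S1 by (auto simp: S1_def)
  then show ?thesis unfolding Fib_eq[OF yS] using eqemb_hemi[OF p(1)] by auto
qed

lemma Fib_class:
  assumes pq: "p \<in> fb y" "q \<in> fb y" "p \<noteq> q"
  shows "Fib y = eqemb ` fb y \<union> hemi (\<not> Zplus_nonempty f p q) ` hhull (fb y)"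
proof -
  define c where "c = Zplus_nonempty f p q"
  have yS: "y \<in> S2" using pq image_f by (auto simp: fb_def)
  note cl = class_fb[OF pq, folded c_def]
  have cmp: "compact (fb y)" using lamination.compact_class[OF lamination_R, of c p] cl(1)[OF pq(1)] by simp
  have sub: "fb y \<subseteq> S1" by (auto simp: fb_def)
  have H1: "Hull (\<not> c) r = convex hull (fb y)" "Hull c r = {r}" if "r \<in> fb y" for r
    using cl[OF that] by (simp_all add: Hull_def)
  have A: "{z \<in> cball 0 1. \<exists>p\<in>fb y. klein z \<in> Hull (\<not> c) p} = {z \<in> cball 0 1. klein z \<in> convex hull (fb y)}"
    using H1 pq by auto
  have B: "{z \<in> cball 0 1. \<exists>p\<in>fb y. klein z \<in> Hull c p} = fb y"
  proof (intro equalityI subsetI)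
    fix z assume "z \<in> {z \<in> cball 0 1. \<exists>p\<in>fb y. klein z \<in> Hull c p}"
    then obtain p where "z \<in> cball 0 1" "p \<in> fb y" "klein z = p" using H1 by auto
    then show "z \<in> fb y" using klein_eq_S1[of z p] sub by auto
  next
    fix z assume z: "z \<in> fb y"
    then have "z \<in> S1" "klein z = z" using sub klein_S1 by blast+
    then show "z \<in> {z \<in> cball 0 1. \<exists>p\<in>fb y. klein z \<in> Hull c p}" using z H1(2)[OF z] by (auto simp: S1_def)
  qed
  have "(\<Union>b. hemi b ` {z \<in> cball 0 1. \<exists>p\<in>fb y. klein z \<in> Hull b p})
     = hemi (\<not> c) ` {z \<in> cball 0 1. \<exists>p\<in>fb y. klein z \<in> Hull (\<not> c) p} \<union> hemi c ` {z \<in> cball 0 1. \<exists>p\<in>fb y. klein z \<in> Hull c p}"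
    unfolding UNIV_bool by (cases c) auto
  also have "hemi c ` {z \<in> cball 0 1. \<exists>p\<in>fb y. klein z \<in> Hull c p} = eqemb ` fb y"
    unfolding B using eqemb_hemi sub by (intro image_cong) auto
  also have "hemi (\<not> c) ` {z \<in> cball 0 1. \<exists>p\<in>fb y. klein z \<in> Hull (\<not> c) p} = eqemb ` fb y \<union> hemi (\<not> c) ` hhull (fb y)"
    unfolding A by (rule hemi_hull_eq[OF cmp sub pq, symmetric])
  finally show ?thesis unfolding Fib_eq[OF yS] c_def by auto
qed

lemma nontrivial_class_iff:
  "\<nu> \<in> nontrivial_classes (R c) \<longleftrightarrow> (\<exists>y p q. \<nu> = fb y \<and> p \<in> fb y \<and> q \<in> fb y \<and> p \<noteq> q \<and> (Zplus_nonempty f p q \<longleftrightarrow> c))"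
proof
  assume "\<nu> \<in> nontrivial_classes (R c)"
  then have "\<nu> \<in> S1 // R c" and ns: "\<not> (\<exists>p. \<nu> = {p})" by (auto simp: nontrivial_classes_def)
  then obtain p where p: "p \<in> S1" "\<nu> = R c `` {p}" by (auto elim: quotientE)
  have "p \<in> \<nu>" using p by (auto simp: R_def)
  then obtain q where q: "q \<in> \<nu>" "q \<noteq> p" using ns by blast
  then have pq: "(p,q) \<in> R c" using p by auto
  have m: "p \<in> fb (f p)" "q \<in> fb (f p)" using pq R_eq by (auto simp: fb_def)
  have Z: "Zplus_nonempty f p q \<longleftrightarrow> c" using pq q by (auto simp: R_def)
  have "\<nu> = fb (f p)" using class_fb(1)[OF m q(2)[symmetric] m(1)] Z p by simp
  then show "\<exists>y p q. \<nu> = fb y \<and> p \<in> fb y \<and> q \<in> fb y \<and> p \<noteq> q \<and> (Zplus_nonempty f p q \<longleftrightarrow> c)"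
    using m q Z by blast
next
  assume "\<exists>y p q. \<nu> = fb y \<and> p \<in> fb y \<and> q \<in> fb y \<and> p \<noteq> q \<and> (Zplus_nonempty f p q \<longleftrightarrow> c)"
  then obtain y p q where a: "\<nu> = fb y" "p \<in> fb y" "q \<in> fb y" "p \<noteq> q" "Zplus_nonempty f p q \<longleftrightarrow> c" by blast
  have "\<nu> = R c `` {p}" using class_fb(1)[OF a(2,3,4,2)] a by simp
  moreover have "p \<in> S1" using a by (simp add: fb_def)
  ultimately have "\<nu> \<in> S1 // R c" by (auto intro: quotientI)
  moreover have "\<not> (\<exists>p. \<nu> = {p})" using a by (metis singletonD)
  ultimately show "\<nu> \<in> nontrivial_classes (R c)" by (simp add: nontrivial_classes_def)
qed

lemma decomp_eq: "decomp f = Fib ` S2"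
proof (intro equalityI subsetI)
  fix K assume "K \<in> decomp f"
  then consider (1) p where "K = {eqemb p}" "p \<in> S1"
      "\<forall>\<nu> \<in> nontrivial_classes (R False) \<union> nontrivial_classes (R True). p \<notin> \<nu>"
    | (2) \<nu> where "K = eqemb ` \<nu> \<union> hemi True ` hhull \<nu>" "\<nu> \<in> nontrivial_classes (R False)"
    | (3) \<nu> where "K = eqemb ` \<nu> \<union> hemi False ` hhull \<nu>" "\<nu> \<in> nontrivial_classes (R True)"
    unfolding decomp_def Lplus_R Lminus_R by blast
  then show "K \<in> Fib ` S2"
  proof cases
    case 1
    have pf: "p \<in> fb (f p)" using 1 by (simp add: fb_def)
    have "q = p" if q: "q \<in> fb (f p)" for q
    proof (rule ccontr)
      assume "q \<noteq> p"
      then have "fb (f p) \<in> nontrivial_classes (R (Zplus_nonempty f p q))"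
        using pf q nontrivial_class_iff by blast
      then show False using 1 pf by (cases "Zplus_nonempty f p q") auto
    qed
    then have "fb (f p) = {p}" using pf by blast
    then have "K = Fib (f p)" using Fib_single 1 by simp
    then show ?thesis using 1 image_f by blast
  next
    case 2
    then obtain y p q where a: "\<nu> = fb y" "p \<in> fb y" "q \<in> fb y" "p \<noteq> q" "Zplus_nonempty f p q \<longleftrightarrow> False"
      unfolding nontrivial_class_iff by blast
    then have "K = Fib y" using Fib_class[OF a(2-4)] 2 by simp
    moreover have "y \<in> S2" using a image_f by (auto simp: fb_def)
    ultimately show ?thesis by blast
  next
    case 3
    then obtain y p q where a: "\<nu> = fb y" "p \<in> fb y" "q \<in> fb y" "p \<noteq> q" "Zplus_nonempty f p q \<longleftrightarrow> True"
      unfolding nontrivial_class_iff by blast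
    then have "K = Fib y" using Fib_class[OF a(2-4)] 3 by simp
    moreover have "y \<in> S2" using a image_f by (auto simp: fb_def)
    ultimately show ?thesis by blast
  qed
next
  fix K assume "K \<in> Fib ` S2"
  then obtain y where y: "y \<in> S2" "K = Fib y" by blast
  from y(1) image_f obtain p where p: "p \<in> fb y" unfolding fb_def by (metis (mono_tags, lifting) imageE mem_Collect_eq)
  have pS: "p \<in> S1" "f p = y" using p by (auto simp: fb_def)
  show "K \<in> decomp f"
  proof (cases "fb y = {p}")
    case True
    have "\<forall>\<nu> \<in> nontrivial_classes (R False) \<union> nontrivial_classes (R True). p \<notin> \<nu>"
    proof (intro ballI notI)
      fix \<nu> assume n: "\<nu> \<in> nontrivial_classes (R False) \<union> nontrivial_classes (R True)" and "p \<in> \<nu>"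
      from n obtain y' a b where "\<nu> = fb y'" "a \<in> fb y'" "b \<in> fb y'" "a \<noteq> b"
        by (auto simp: nontrivial_class_iff)
      moreover from this have "y' = y" using \<open>p \<in> \<nu>\<close> pS by (simp add: fb_def)
      ultimately show False using True by auto
    qed
    moreover have "K = {eqemb p}" using Fib_single[OF True] y by simp
    ultimately show ?thesis unfolding decomp_def Lplus_R Lminus_R using pS by blast
  next
    case False
    then obtain q where q: "q \<in> fb y" "p \<noteq> q" using p by blast
    have n: "fb y \<in> nontrivial_classes (R (Zplus_nonempty f p q))"
      using nontrivial_class_iff p q by blast
    have K: "K = eqemb ` fb y \<union> hemi (\<not> Zplus_nonempty f p q) ` hhull (fb y)"
      using Fib_class[OF p q] y by simp
    show ?thesis unfolding decomp_def Lplus_R Lminus_R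
      using n K by (cases "Zplus_nonempty f p q") auto
  qed
qed

lemma same_element_iff:
  assumes "x \<in> S2f" "x' \<in> S2f"
  shows "(\<exists>K\<in>decomp f. x \<in> K \<and> x' \<in> K) \<longleftrightarrow> F x = F x'"
  unfolding decomp_eq using assms F_in_S2 by (auto simp: Fib_def)

lemma usc: "usc_decomposition (top_of_set S2f) (decomp f)"
  unfolding usc_decomposition_def
proof (intro conjI ballI allI impI)
  fix K assume "K \<in> decomp f"
  then obtain y where "K = Fib y" by (auto simp: decomp_eq)
  then have "K = S2f \<inter> F -` {y}" by (auto simp: Fib_def)
  then show "closedin (top_of_set S2f) K" using continuous_closedin_preimage[OF continuous_F, of "{y}"] by simp
next
  show "pairwise disjnt (decomp f)"
    unfolding decomp_eq pairwise_def disjnt_def by (auto simp: Fib_def)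
  show "\<Union> (decomp f) = topspace (top_of_set S2f)"
    unfolding decomp_eq using F_in_S2 by (auto simp: Fib_def)
next
  fix K V assume K: "K \<in> decomp f" and V: "openin (top_of_set S2f) V \<and> K \<subseteq> V"
  obtain y where y: "y \<in> S2" "K = Fib y" using K by (auto simp: decomp_eq)
  have "closedin (top_of_set S2f) (S2f - V)" using V by (simp add: closedin_diff)
  then have "compact (S2f - V)" using closed_S2f closedin_compact by blast
  then have cl: "closed (F ` (S2f - V))"
    using compact_continuous_image[OF continuous_on_subset[OF continuous_F]] compact_imp_closed by blast
  \<comment> \<open>The largest union of fibres inside \<open>V\<close>; it is open because
    \<open>F\<close> maps the compact complement of \<open>V\<close> to a closed set.\<close>
  define U where "U = S2f \<inter> F -` (- F ` (S2f - V))"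
  have "openin (top_of_set S2f) U"
    unfolding U_def using continuous_F cl by (intro continuous_openin_preimage_gen) auto
  moreover have "K \<subseteq> U"
  proof
    fix x assume "x \<in> K"
    then have x: "x \<in> S2f" "F x = y" using y by (auto simp: Fib_def)
    have "y \<notin> F ` (S2f - V)"
    proof
      assume "y \<in> F ` (S2f - V)"
      then obtain x' where "x' \<in> S2f" "x' \<notin> V" "F x' = y" by auto
      then have "x' \<in> K" using y by (simp add: Fib_def)
      then show False using V \<open>x' \<notin> V\<close> by blast
    qed
    with x show "x \<in> U" by (simp add: U_def)
  qed
  moreover have "U \<subseteq> V" by (auto simp: U_def)
  moreover have "U = \<Union> (Fib ` (S2 - F ` (S2f - V)))" using F_in_S2 by (auto simp: U_def Fib_def)
  moreover have "Fib ` (S2 - F ` (S2f - V)) \<subseteq> decomp f" by (auto simp: decomp_eq)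
  ultimately show "\<exists>U. openin (top_of_set S2f) U \<and> K \<subseteq> U \<and> U \<subseteq> V \<and> (\<exists>\<U>. \<U> \<subseteq> decomp f \<and> U = \<Union> \<U>)"
    by blast
qed

lemma quotient_F: "quotient_by (top_of_set S2f) (decomp f) (top_of_set S2) F"
  unfolding quotient_by_def
proof
  have "continuous_map (top_of_set S2f) (top_of_set S2) F"
    using continuous_F F_in_S2 by auto
  then show "quotient_map (top_of_set S2f) (top_of_set S2) F"
    by (rule continuous_imp_quotient_map)
       (simp_all add: closed_S2f F_image compact_space_subtopology Hausdorff_space_subtopology)
  show "\<forall>x\<in>topspace (top_of_set S2f). \<forall>y\<in>topspace (top_of_set S2f). F x = F y \<longleftrightarrow> (\<exists>K\<in>decomp f. x \<in> K \<and> y \<in> K)"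
    using same_element_iff by simp
qed

end

theorem theorem1p20:
  fixes f :: "complex \<Rightarrow> real^3"
  assumes "catherine_wheel f"
  shows "usc_decomposition (top_of_set S2f) (decomp f) \<and>
         (\<exists>F. quotient_by (top_of_set S2f) (decomp f) (top_of_set S2) F \<and>
              (\<forall>z\<in>S1. F (eqemb z) = f z) \<and>
              (\<forall>G. quotient_by (top_of_set S2f) (decomp f) (top_of_set S2) G \<and>
                   (\<forall>z\<in>S1. G (eqemb z) = f z) \<longrightarrow> (\<forall>x\<in>S2f. G x = F x)))"
proof -
  interpret wheel f by unfold_locales (rule assms)
  have "G x = F x" if G: "quotient_by (top_of_set S2f) (decomp f) (top_of_set S2) G" "\<forall>z\<in>S1. G (eqemb z) = f z"
    and x: "x \<in> S2f" for G x
  proof -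
    \<comment> \<open>As \<open>f\<close> is onto, every fibre meets the equator, where the values
      of both maps are prescribed.\<close>
    obtain p where p: "p \<in> S1" "f p = F x" using F_in_S2[OF x] image_f by (metis imageE)
    have e: "eqemb p \<in> S2f" "F x = F (eqemb p)" using p eqemb_S2f F_eqemb by auto
    then have "G x = G (eqemb p)"
      using G(1) x same_element_iff[OF x e(1)] unfolding quotient_by_def by simp
    then show ?thesis using G(2) p by simp
  qed
  then show ?thesis using usc quotient_F F_eqemb by blast
qed

end
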